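(* Let $d\ge 1$ and $N\ge 1$ be integers. There are at most $$2^{d^2\cdot ((d+1)!)^2\cdot N}$$ distinct combinatorial types of geometric triangulations of the standard unit sphere $S^d$ with $N$ facets.
   Context: $S^d$ is the unit sphere in $\mathbb{R}^{d+1}$ with its standard intrinsic metric. A geometric triangulation of $S^d$ is a tiling of $S^d$ into finitely many regions that are convex simplices with respect to this metric and that combinatorially form a simplicial complex (the intersection of any two simplices is a face of both). Here a spherical simplex is a spherical polytope, i.e. the convex hull of finitely many points of $S^d$ all lying in some open hemisphere, that is combinatorially equivalent to a simplex. Facets are the inclusion-maximal faces (the $d$-simplices). Two complexes have the same combinatorial type if their face posets (nonempty faces ordered by inclusion) are isomorphic. *)

theory Defs
  imports "HOL-Analysis.Analysis"
begin

definition poset_isomorphic :: "'a::order set \<Rightarrow> 'b::order set \<Rightarrow> bool"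
  where "poset_isomorphic A B \<longleftrightarrow>
    (\<exists>f. bij_betw f A B \<and> (\<forall>x\<in>A. \<forall>y\<in>A. f x \<le> f y \<longleftrightarrow> x \<le> y))"


subsection \<open>Spherical convexity\<close>

text \<open>The unit sphere is \<^term>\<open>sphere (0::'a::euclidean_space) 1\<close>; its intrinsic (great-circle)
  distance is the angle between unit vectors.\<close>

definition sphere_dist :: "'a::euclidean_space \<Rightarrow> 'a \<Rightarrow> real"
  where "sphere_dist x y = arccos (x \<bullet> y)"

text \<open>The points \<open>z\<close> with equality in the triangle inequality are those on shortest arcs from
  \<open>x\<close> to \<open>y\<close>.  For antipodal \<open>x\<close>, \<open>y\<close> this demands every such arc, so that convex sets are
  closed under intersection; inside an open hemisphere there are no antipodal pairs.\<close>

definition sphere_convex :: "'a::euclidean_space set \<Rightarrow> bool"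
  where "sphere_convex C \<longleftrightarrow> C \<subseteq> sphere 0 1 \<and>
    (\<forall>x\<in>C. \<forall>y\<in>C. \<forall>z\<in>sphere 0 1.
       sphere_dist x z + sphere_dist z y = sphere_dist x y \<longrightarrow> z \<in> C)"

definition spherical_polytope :: "'a::euclidean_space set \<Rightarrow> bool"
  where "spherical_polytope P \<longleftrightarrow>
    (\<exists>V. finite V \<and> V \<subseteq> sphere 0 1 \<and> (\<exists>a\<in>sphere 0 1. \<forall>v\<in>V. 0 < a \<bullet> v) \<and>
         P = sphere_convex hull V)"

text \<open>Faces are cut out by supporting great hyperspheres; \<open>a = 0\<close> yields \<open>P\<close> itself, and the
  empty set is a face of every spherical polytope.\<close>

definition spherical_face_of :: "'a::euclidean_space set \<Rightarrow> 'a set \<Rightarrow> bool"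
    (infix \<open>spherical'_face'_of\<close> 50)
  where "F spherical_face_of P \<longleftrightarrow>
    (\<exists>a. (\<forall>x\<in>P. 0 \<le> a \<bullet> x) \<and> F = P \<inter> {x. a \<bullet> x = 0})"

definition spherical_simplex :: "nat \<Rightarrow> 'a::euclidean_space set \<Rightarrow> bool"
  where "spherical_simplex k P \<longleftrightarrow> spherical_polytope P \<and>
    (\<exists>D::'a set. int k simplex D \<and>
       poset_isomorphic {F. F spherical_face_of P \<and> F \<noteq> {}} {F. F face_of D \<and> F \<noteq> {}})"


subsection \<open>Geometric triangulations of the sphere\<close>

text \<open>A triangulation is given by its set of tiles.  That distinct tiles have disjoint interiors
  is a consequence of the intersection condition.\<close>

definition geometric_triangulation :: "nat \<Rightarrow> 'a::euclidean_space set set \<Rightarrow> bool"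
  where "geometric_triangulation d T \<longleftrightarrow>
    finite T \<and> (\<forall>P\<in>T. spherical_simplex d P) \<and> \<Union>T = sphere 0 1 \<and>
    (\<forall>P\<in>T. \<forall>Q\<in>T. (P \<inter> Q) spherical_face_of P \<and> (P \<inter> Q) spherical_face_of Q)"

definition complex_faces :: "'a::euclidean_space set set \<Rightarrow> 'a set set"
  where "complex_faces T = {F. F \<noteq> {} \<and> (\<exists>P\<in>T. F spherical_face_of P)}"

definition complex_facets :: "'a::euclidean_space set set \<Rightarrow> 'a set set"
  where "complex_facets T =
    {F \<in> complex_faces T. \<forall>G\<in>complex_faces T. F \<subseteq> G \<longrightarrow> F = G}"

definition triangulations :: "nat \<Rightarrow> nat \<Rightarrow> 'a::euclidean_space set set set"
  where "triangulations d N =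
    {T. geometric_triangulation d T \<and> card (complex_facets T) = N}"

definition same_combinatorial_type :: "nat \<Rightarrow> nat \<Rightarrow> 'a::euclidean_space set set rel"
  where "same_combinatorial_type d N =
    {(S, T). S \<in> triangulations d N \<and> T \<in> triangulations d N \<and>
             poset_isomorphic (complex_faces S) (complex_faces T)}"

definition combinatorial_types :: "nat \<Rightarrow> nat \<Rightarrow> 'a::euclidean_space set set set set"
  where "combinatorial_types d N = triangulations d N // same_combinatorial_type d N"

end

(*
A triangulation is encoded, up to isomorphism, by a plane tree with at most
((k - 1)^2 (k!)^2 / 2) N nodes, where k = d + 1; there are at most 4^n plane trees with at
most n nodes.  Equivalently one encodes complete simplicial fans in dimension k, whose links are
again such fans, so codes can be built by induction on k.  For k = 2 the fan is a cycle and its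
length suffices.

For k >= 3 fix a generic vector a.  The facets meeting the open hemisphere around a are spanned by
a tree in the dual graph, which costs O(1) per facet, and the tree carries the codes of the links
of all faces in that hemisphere, each stored once.  The remaining gluings follow by sweeping the
hemisphere with a growing spherical cap around a.  A ridge R is first met at the point nearest to
a, in the relative interior of a face S of R.  The facets around S that the cap met earlier form
an open half of link(S), hence they are connected through gluings deduced before, and the facets
met only now are attached to them by tree edges, provided the parent of a facet F in the tree
contains the face of F nearest to a.  So every facet around S has been identified,
and the code of link(S) yields all gluings around S, including R.  The same is done around -a.
The two halves overlap in the facets crossing the equator, which are connected through ridges
crossing the equator because k >= 3; so it is enough to record one common facet.
*)

theory Submission
  imports Defs
begin

section \<open>Plane trees\<close>

text \<open>The decoder never rebuilds a complex. Two complexes with the same code are compared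
  directly: nodes at equal addresses are matched position by position, and a deduction only says
  that these vertex bijections agree across a gluing. Hence \<open>known\<close> has to be sound for
  every complex with that code, although it is the geometry of one of them that shows it to be
  complete. This is why it is a least relation stated without geometry, and why the combinatorial
  half works with \<open>npm\<close>, which keeps of a fan just what is needed: two facets at a
  ridge and strongly connected stars, both inherited by links. The outcome is a morphism in each
  direction, and rigidity makes the two inverse. On the geometric side, caps on spheres are replaced
  by nearest points in convex cones, where the norm of the projection of \<open>a\<close> orders the
  faces, and links are orthogonal projections. The constant \<open>code_bound\<close> is half of the
  exponent of the theorem because 4^n = 2^(2n). It must absorb two trees, two paths and the codes of
  all links; the vertex links dominate, and at \<open>k = 3\<close> the final polynomial inequality
  is an equality.\<close>

datatype rose = Rose "rose list"

abbreviation leaf :: rose where "leaf \<equiv> Rose []"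

primrec rsize :: "rose \<Rightarrow> nat" where
  "rsize (Rose ts) = Suc (sum_list (map rsize ts))"

primrec parens :: "rose \<Rightarrow> bool list" where
  "parens (Rose ts) = True # concat (map parens ts) @ [False]"

lemma length_parens: "length (parens t) = 2 * rsize t"
proof (induction t)
  case (Rose ts)
  then have "length (concat (map parens ts)) = 2 * sum_list (map rsize ts)"
    by (induction ts) auto
  then show ?case by simp
qed

text \<open>Prefix-freeness, rather than mere injectivity, is what an induction through lists of
  sons can carry, and it makes the padding in \<open>card_rose_le\<close> harmless.\<close>

lemma parens_prefix_free: "parens t @ xs = parens u @ ys \<Longrightarrow> t = u"
proof (induction t arbitrary: u xs ys)
  case (Rose ts)
  obtain us where u: "u = Rose us" by (cases u)
  \<comment> \<open>A son starts with \<open>True\<close> while the list is closed by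
    \<open>False\<close>, so two lists whose words agree end at the same son.\<close>
  have *: "ts = us"
    if "concat (map parens ts) @ False # xs = concat (map parens us) @ False # ys"
      "\<And>t u xs ys. t \<in> set ts \<Longrightarrow> parens t @ xs = parens u @ ys \<Longrightarrow> t = u"
    for xs ys ts us
    using that
  proof (induction ts arbitrary: us)
    case Nil
    show ?case
    proof (cases us)
      case (Cons u us')
      then show ?thesis using Nil.prems(1) by (cases u) auto
    qed simp
  next
    case (Cons t ts)
    show ?case
    proof (cases us)
      case Nil
      then show ?thesis using Cons.prems(1) by (cases t) auto
    next
      case (Cons u us')
      have eq: "parens t @ (concat (map parens ts) @ False # xs)
          = parens u @ (concat (map parens us') @ False # ys)"
        using Cons.prems(1) Cons by simp
      then have "t = u"
        using Cons.prems(2)[of t] by auto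
      moreover have "ts = us'"
        by (rule Cons.IH) (use eq \<open>t = u\<close> Cons.prems(2) in auto)
      ultimately show ?thesis using Cons by simp
    qed
  qed
  from Rose.prems show ?case unfolding u
    by (auto intro: *[of _ xs _ ys] Rose.IH)
qed

text \<open>Words are filled up with \<open>False\<close> to the common length 2n; a prefix code
  stays injective under any padding, so there are at most 2^(2n) trees.\<close>

lemma card_rose_le:
  "finite {t. rsize t \<le> n} \<and> card {t. rsize t \<le> n} \<le> 4 ^ n"
proof -
  let ?pad = "\<lambda>t. parens t @ replicate (2 * n - length (parens t)) False"
  let ?B = "{xs. set xs \<subseteq> (UNIV :: bool set) \<and> length xs = 2 * n}"
  have inj: "inj_on ?pad {t. rsize t \<le> n}"
    using parens_prefix_free by (auto intro!: inj_onI)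
  have sub: "?pad ` {t. rsize t \<le> n} \<subseteq> ?B"
    by (auto simp: length_parens)
  have fin: "finite ?B"
    by (rule finite_lists_length_eq) simp
  have "card ?B = 2 ^ (2 * n)"
    by (subst card_lists_length_eq) auto
  then show ?thesis
    using inj_on_finite[OF inj sub fin] card_inj_on_le[OF inj sub fin]
    by (simp add: power_mult)
qed

section \<open>Normal pseudomanifolds\<close>

definition adj :: "'v set \<Rightarrow> 'v set \<Rightarrow> bool"
  where "adj F G \<longleftrightarrow> (\<exists>v w. v \<in> F \<and> w \<notin> F \<and> G = insert w (F - {v}))"

text \<open>Normal pseudomanifolds.  The last condition says that every star is strongly connected; for
  disjoint \<open>F\<close> and \<open>G\<close> it says so of the whole complex.\<close>

definition npm :: "nat \<Rightarrow> 'v set set \<Rightarrow> bool"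
  where "npm k \<Phi> \<longleftrightarrow> finite \<Phi> \<and>
    (\<forall>F\<in>\<Phi>. finite F \<and> card F = k) \<and>
    (\<forall>F\<in>\<Phi>. \<forall>v\<in>F. \<exists>!w. w \<noteq> v \<and> insert w (F - {v}) \<in> \<Phi>) \<and>
    (\<forall>F\<in>\<Phi>. \<forall>G\<in>\<Phi>. (\<lambda>X Y. adj X Y \<and> Y \<in> \<Phi> \<and> F \<inter> G \<subseteq> Y)\<^sup>*\<^sup>* F G)"

definition link :: "'v set set \<Rightarrow> 'v set \<Rightarrow> 'v set set"
  where "link \<Phi> \<sigma> = (\<lambda>F. F - \<sigma>) ` {F \<in> \<Phi>. \<sigma> \<subseteq> F}"

text \<open>Non-degenerate maps that do not fold two adjacent facets together.  Being preserved along the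
  dual graph, this rigidity makes a morphism determined by its values on one facet.\<close>

definition mor :: "'v set set \<Rightarrow> 'w set set \<Rightarrow> ('v \<Rightarrow> 'w) \<Rightarrow> bool"
  where "mor \<Phi> \<Psi> f \<longleftrightarrow>
    (\<forall>F\<in>\<Phi>. inj_on f F \<and> f ` F \<in> \<Psi>) \<and>
    (\<forall>F\<in>\<Phi>. \<forall>G\<in>\<Phi>. adj F G \<longrightarrow> f ` F \<noteq> f ` G)"

definition ordered_facet :: "'v set set \<Rightarrow> 'v list \<Rightarrow> bool"
  where "ordered_facet \<Phi> \<kappa> \<longleftrightarrow> distinct \<kappa> \<and> set \<kappa> \<in> \<Phi>"

text \<open>The facet across the ridge opposite \<open>\<kappa> ! i\<close>, with the new vertex put at position \<open>i\<close>; the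
  description is meaningful only for \<open>i < length \<kappa>\<close>.\<close>

definition nb :: "'v set set \<Rightarrow> 'v list \<Rightarrow> nat \<Rightarrow> 'v list"
  where "nb \<Phi> \<kappa> i = \<kappa>[i := THE w. w \<noteq> \<kappa> ! i \<and> insert w (set \<kappa> - {\<kappa> ! i}) \<in> \<Phi>]"

lemma adjI: "v \<in> F \<Longrightarrow> w \<notin> F \<Longrightarrow> adj F (insert w (F - {v}))"
  unfolding adj_def by blast

lemma adj_sym: "adj F G \<Longrightarrow> adj G F"
proof -
  assume "adj F G"
  then obtain v w where *: "v \<in> F" "w \<notin> F" "G = insert w (F - {v})"
    unfolding adj_def by blast
  then have "w \<in> G" "v \<notin> G" "F = insert v (G - {w})" by auto
  then show "adj G F" unfolding adj_def by blast
qed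

lemma adj_card_Int:
  assumes "finite F" "finite G" "card F = k" "card G = k" "card (F \<inter> G) + 1 = k"
  shows "adj F G"
proof -
  have "card (F - G) = 1" "card (G - F) = 1"
    using assms card_Diff_subset_Int[of F G] card_Diff_subset_Int[of G F]
    by (auto simp: Int_commute)
  then obtain v w where v: "F - G = {v}" and w: "G - F = {w}"
    by (auto simp: card_1_singleton_iff)
  have "G = insert w (F - {v})" using v w by auto
  then show ?thesis using v w unfolding adj_def by blast
qed

lemma adjE:
  assumes "adj F G"
  obtains v w where "v \<in> F" "w \<notin> F" "w \<in> G" "v \<notin> G" "G = insert w (F - {v})"
    "F \<inter> G = F - {v}" "F \<inter> G = G - {w}" "F = insert v (F \<inter> G)" "G = insert w (F \<inter> G)"
proof -
  obtain v w where *: "v \<in> F" "w \<notin> F" "G = insert w (F - {v})"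
    using assms unfolding adj_def by blast
  show thesis by (rule that[of v w]) (use * in auto)
qed

lemma npm_facet: "npm k \<Phi> \<Longrightarrow> F \<in> \<Phi> \<Longrightarrow> finite F \<and> card F = k"
  unfolding npm_def by blast

lemma npm_nb_ex1:
  "npm k \<Phi> \<Longrightarrow> F \<in> \<Phi> \<Longrightarrow> v \<in> F \<Longrightarrow> \<exists>!w. w \<noteq> v \<and> insert w (F - {v}) \<in> \<Phi>"
  unfolding npm_def by blast

lemma npm_connected:
  "npm k \<Phi> \<Longrightarrow> F \<in> \<Phi> \<Longrightarrow> G \<in> \<Phi> \<Longrightarrow>
    (\<lambda>X Y. adj X Y \<and> Y \<in> \<Phi> \<and> F \<inter> G \<subseteq> Y)\<^sup>*\<^sup>* F G"
  unfolding npm_def by blast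

text \<open>A facet containing a ridge is the ridge plus one vertex, and the uniqueness clause of
  \<open>npm\<close> leaves two choices for it. Used when the face carrying a nearest point is a
  whole ridge.\<close>

lemma npm_two_facets:
  assumes "npm k \<Phi>" "F \<in> \<Phi>" "G \<in> \<Phi>" "H \<in> \<Phi>" "adj F G" "F \<inter> G \<subseteq> H" "H \<noteq> F"
  shows "H = G"
proof -
  obtain v w where vw: "v \<in> F" "w \<notin> F" "F \<inter> G = F - {v}" "G = insert w (F - {v})"
    using adjE[OF \<open>adj F G\<close>] by metis
  have fin: "finite F" "finite H" "card F = card H"
    using npm_facet[OF assms(1)] assms by auto
  have "card (H - (F - {v})) = 1"
    using card_Diff_subset[of "F - {v}" H] fin vw assms(6) card_Suc_Diff1[of F v] by auto
  then obtain u where u: "H - (F - {v}) = {u}"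
    by (auto simp: card_1_singleton_iff)
  then have H: "H = insert u (F - {v})" using assms(6) vw by auto
  then have "u \<noteq> v" using \<open>H \<noteq> F\<close> vw by auto
  moreover have "w \<noteq> v" using vw by auto
  ultimately have "u = w"
    using npm_nb_ex1[OF assms(1,2) vw(1)] H vw \<open>G \<in> \<Phi>\<close> \<open>H \<in> \<Phi>\<close> by blast
  then show ?thesis using H vw by simp
qed

text \<open>The new vertex takes the position of the one it replaces. Hence crossing port
  \<open>i\<close> twice restores the ordering, and two complexes under comparison change the same
  position.\<close>

lemma nb_facts:
  assumes P: "npm k \<Phi>" and o: "ordered_facet \<Phi> \<kappa>" and i: "i < k"
  obtains w where "w \<notin> set \<kappa>" "nb \<Phi> \<kappa> i = \<kappa>[i := w]"
    "set (nb \<Phi> \<kappa> i) = insert w (set \<kappa> - {\<kappa> ! i})" "ordered_facet \<Phi> (nb \<Phi> \<kappa> i)"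
    "adj (set \<kappa>) (set (nb \<Phi> \<kappa> i))" "nb \<Phi> (nb \<Phi> \<kappa> i) i = \<kappa>"
proof -
  have d: "distinct \<kappa>" and s: "set \<kappa> \<in> \<Phi>" using o by (auto simp: ordered_facet_def)
  have len: "length \<kappa> = k"
    using npm_facet[OF P s] distinct_card[OF d] by simp
  let ?v = "\<kappa> ! i"
  have v: "?v \<in> set \<kappa>" using i len by simp
  define w where "w = (THE w. w \<noteq> ?v \<and> insert w (set \<kappa> - {?v}) \<in> \<Phi>)"
  have w: "w \<noteq> ?v" "insert w (set \<kappa> - {?v}) \<in> \<Phi>"
    using theI'[OF npm_nb_ex1[OF P s v]] unfolding w_def by auto
  have wn: "w \<notin> set \<kappa>"
  proof
    assume "w \<in> set \<kappa>"
    then have "insert w (set \<kappa> - {?v}) = set \<kappa> - {?v}" using w by auto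
    then show False
      using npm_facet[OF P w(2)] npm_facet[OF P s] v by (metis card_Diff1_less less_irrefl)
  qed
  have nb: "nb \<Phi> \<kappa> i = \<kappa>[i := w]" by (simp add: nb_def w_def)
  have st: "set (\<kappa>[i := w]) = insert w (set \<kappa> - {?v})"
    using d i len by (simp add: set_update_distinct)
  have d': "distinct (\<kappa>[i := w])" using d wn by (simp add: distinct_list_update)
  have o': "ordered_facet \<Phi> (\<kappa>[i := w])" using d' st w by (simp add: ordered_facet_def)
  have nth: "\<kappa>[i := w] ! i = w" using i len by simp
  have diff: "set (\<kappa>[i := w]) - {w} = set \<kappa> - {?v}" using st wn by auto
  have "(THE u. u \<noteq> w \<and> insert u (set (\<kappa>[i := w]) - {w}) \<in> \<Phi>) = ?v"
  proof (rule the1_equality)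
    show "\<exists>!u. u \<noteq> w \<and> insert u (set (\<kappa>[i := w]) - {w}) \<in> \<Phi>"
      by (rule npm_nb_ex1[OF P]) (use o' st in \<open>auto simp: ordered_facet_def\<close>)
    show "?v \<noteq> w \<and> insert ?v (set (\<kappa>[i := w]) - {w}) \<in> \<Phi>"
      using w v s unfolding diff by (auto simp: insert_absorb)
  qed
  then have "nb \<Phi> (\<kappa>[i := w]) i = \<kappa>"
    unfolding nb_def nth by simp
  moreover have "adj (set \<kappa>) (set (\<kappa>[i := w]))"
    unfolding st using v wn by (rule adjI)
  ultimately show thesis
    using that[of w] wn nb st o' by simp
qed

lemma nb_ordered: "npm k \<Phi> \<Longrightarrow> ordered_facet \<Phi> \<kappa> \<Longrightarrow> i < k \<Longrightarrow> ordered_facet \<Phi> (nb \<Phi> \<kappa> i)"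
  by (rule nb_facts)

lemma nb_adj: "npm k \<Phi> \<Longrightarrow> ordered_facet \<Phi> \<kappa> \<Longrightarrow> i < k \<Longrightarrow> adj (set \<kappa>) (set (nb \<Phi> \<kappa> i))"
  by (rule nb_facts)

lemma nb_nb: "npm k \<Phi> \<Longrightarrow> ordered_facet \<Phi> \<kappa> \<Longrightarrow> i < k \<Longrightarrow> nb \<Phi> (nb \<Phi> \<kappa> i) i = \<kappa>"
  by (rule nb_facts)

lemma ordered_facet_length: "npm k \<Phi> \<Longrightarrow> ordered_facet \<Phi> \<kappa> \<Longrightarrow> length \<kappa> = k"
  using npm_facet distinct_card unfolding ordered_facet_def by metis

lemma adj_nb:
  assumes P: "npm k \<Phi>" and o: "ordered_facet \<Phi> \<kappa>" and G: "G \<in> \<Phi>" and a: "adj (set \<kappa>) G"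
  shows "\<exists>i<k. set (nb \<Phi> \<kappa> i) = G"
proof -
  obtain v w where vw: "v \<in> set \<kappa>" "w \<notin> set \<kappa>" "G = insert w (set \<kappa> - {v})"
    using a unfolding adj_def by blast
  then obtain i where i: "i < k" "\<kappa> ! i = v"
    using ordered_facet_length[OF P o] by (metis in_set_conv_nth)
  obtain u where u: "u \<notin> set \<kappa>" "set (nb \<Phi> \<kappa> i) = insert u (set \<kappa> - {\<kappa> ! i})"
    "ordered_facet \<Phi> (nb \<Phi> \<kappa> i)"
    using nb_facts[OF P o i(1)] by metis
  have "u = w"
    using npm_nb_ex1[OF P _ vw(1)] o u vw G i unfolding ordered_facet_def by metis
  then show ?thesis using u vw i by blast
qed

text \<open>Crossing port \<open>i\<close> removes the vertex \<open>\<kappa> ! i\<close>, which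
  survives the crossing of any other port.\<close>

lemma nb_inj:
  assumes P: "npm k \<Phi>" and o: "ordered_facet \<Phi> \<kappa>" and "i < k" "j < k"
    and e: "set (nb \<Phi> \<kappa> i) = set (nb \<Phi> \<kappa> j)"
  shows "i = j"
proof (rule ccontr)
  assume "i \<noteq> j"
  have len: "length \<kappa> = k" and d: "distinct \<kappa>"
    using ordered_facet_length[OF P o] o by (auto simp: ordered_facet_def)
  obtain u where u: "u \<notin> set \<kappa>" "set (nb \<Phi> \<kappa> i) = insert u (set \<kappa> - {\<kappa> ! i})"
    using nb_facts[OF P o \<open>i < k\<close>] by metis
  obtain w where w: "w \<notin> set \<kappa>" "set (nb \<Phi> \<kappa> j) = insert w (set \<kappa> - {\<kappa> ! j})"
    using nb_facts[OF P o \<open>j < k\<close>] by metis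
  have "\<kappa> ! i \<noteq> \<kappa> ! j" "\<kappa> ! i \<in> set \<kappa>"
    using \<open>i \<noteq> j\<close> d len assms by (auto simp: nth_eq_iff_index_eq)
  then show False using u w e by auto
qed

text \<open>Removing \<open>\<sigma>\<close> is a bijection on the facets around
  \<open>\<sigma>\<close> that respects exchanges of a vertex. Connectivity transfers because a path
  in the star of the intersection of two facets around \<open>\<sigma>\<close> never leaves the
  facets containing \<open>\<sigma>\<close>.\<close>

lemma npm_link:
  assumes P: "npm k \<Phi>"
  shows "npm (k - card \<sigma>) (link \<Phi> \<sigma>)"
  unfolding npm_def
proof (intro conjI ballI)
  show "finite (link \<Phi> \<sigma>)" using P by (auto simp: link_def npm_def)
next
  fix F assume "F \<in> link \<Phi> \<sigma>"
  then obtain F' where F': "F' \<in> \<Phi>" "\<sigma> \<subseteq> F'" "F = F' - \<sigma>" by (auto simp: link_def)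
  have "finite F'" "card F' = k" using npm_facet[OF P] F' by auto
  then show "finite F" "card F = k - card \<sigma>"
    using F' card_Diff_subset[of \<sigma> F'] finite_subset[of \<sigma> F'] by auto
  fix v assume v: "v \<in> F"
  have eq: "w \<noteq> v \<and> insert w (F - {v}) \<in> link \<Phi> \<sigma> \<longleftrightarrow> w \<noteq> v \<and> insert w (F' - {v}) \<in> \<Phi>" for w
  proof
    assume "w \<noteq> v \<and> insert w (F - {v}) \<in> link \<Phi> \<sigma>"
    then obtain G where "G \<in> \<Phi>" "\<sigma> \<subseteq> G" "insert w (F - {v}) = G - \<sigma>" "w \<noteq> v"
      by (auto simp: link_def)
    moreover from this have "G = insert w (F' - {v})" using F' v by blast
    ultimately show "w \<noteq> v \<and> insert w (F' - {v}) \<in> \<Phi>" by simp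
  next
    assume *: "w \<noteq> v \<and> insert w (F' - {v}) \<in> \<Phi>"
    have "w \<notin> F'"
    proof
      assume "w \<in> F'"
      then have "insert w (F' - {v}) = F' - {v}" using * by auto
      then show False
        using npm_facet[OF P] F' * v by (metis Diff_iff card_Diff1_less less_irrefl)
    qed
    then have "insert w (F - {v}) = insert w (F' - {v}) - \<sigma>" "\<sigma> \<subseteq> insert w (F' - {v})"
      using F' v by auto
    then show "w \<noteq> v \<and> insert w (F - {v}) \<in> link \<Phi> \<sigma>"
      using * by (auto simp: link_def)
  qed
  show "\<exists>!w. w \<noteq> v \<and> insert w (F - {v}) \<in> link \<Phi> \<sigma>"
    unfolding eq using npm_nb_ex1[OF P F'(1)] v F' by blast
next
  fix F G assume "F \<in> link \<Phi> \<sigma>" "G \<in> link \<Phi> \<sigma>"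
  then obtain F' G' where F': "F' \<in> \<Phi>" "\<sigma> \<subseteq> F'" "F = F' - \<sigma>"
    and G': "G' \<in> \<Phi>" "\<sigma> \<subseteq> G'" "G = G' - \<sigma>" by (auto simp: link_def)
  have "(\<lambda>X Y. adj X Y \<and> Y \<in> \<Phi> \<and> F' \<inter> G' \<subseteq> Y)\<^sup>*\<^sup>* F' H \<Longrightarrow> \<sigma> \<subseteq> H \<and>
     (\<lambda>X Y. adj X Y \<and> Y \<in> link \<Phi> \<sigma> \<and> F \<inter> G \<subseteq> Y)\<^sup>*\<^sup>* F (H - \<sigma>)" for H
  proof (induction rule: rtranclp_induct)
    case base
    then show ?case using F' by simp
  next
    case (step X Y)
    have "\<sigma> \<subseteq> Y" using step F' G' by auto
    moreover obtain v w where "v \<in> X" "w \<notin> X" "w \<in> Y" "v \<notin> Y" "Y = insert w (X - {v})"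
      using step.hyps(2) adjE[of X Y] by metis
    then have "adj (X - \<sigma>) (Y - \<sigma>)"
      using step \<open>\<sigma> \<subseteq> Y\<close> adjI[of v "X - \<sigma>" w]
      by (smt (verit, best) Diff_iff Diff_insert2 insert_Diff_if subset_eq Diff_insert)
    moreover have "Y - \<sigma> \<in> link \<Phi> \<sigma>" "F \<inter> G \<subseteq> Y - \<sigma>"
      using step \<open>\<sigma> \<subseteq> Y\<close> F' G' by (auto simp: link_def)
    ultimately show ?case using step by (metis (no_types, lifting) rtranclp.rtrancl_into_rtrancl)
  qed
  from this[OF npm_connected[OF P F'(1) G'(1)]] G'
  show "(\<lambda>X Y. adj X Y \<and> Y \<in> link \<Phi> \<sigma> \<and> F \<inter> G \<subseteq> Y)\<^sup>*\<^sup>* F G" by simp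
qed

section \<open>Cycles\<close>

text \<open>For \<open>k = 2\<close> a normal pseudomanifold is a finite connected 2-regular graph.
  Walking without turning back from the oriented edge from \<open>a\<close> to \<open>b\<close> is
  periodic, and the period turns out to be the number of edges.\<close>

lemma cycle_walk:
  assumes P: "npm 2 \<Phi>" and ab: "a \<noteq> b" "{a, b} \<in> \<Phi>"
  obtains p :: "nat \<Rightarrow> 'v" where "p 0 = a" "p 1 = b"
    "\<And>i j. p i = p j \<longleftrightarrow> i mod card \<Phi> = j mod card \<Phi>"
    "\<And>i. p i \<noteq> p (Suc i)"
    "\<Phi> = range (\<lambda>n. {p n, p (Suc n)})"
    "inj_on (\<lambda>n. {p n, p (Suc n)}) {..<card \<Phi>}"
proof -
  define nx where "nx x y = (THE z. z \<noteq> x \<and> {y, z} \<in> \<Phi>)" for x y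
  have ex1: "\<exists>!z. z \<noteq> x \<and> {y, z} \<in> \<Phi>" if "{x, y} \<in> \<Phi>" "x \<noteq> y" for x y
    using npm_nb_ex1[OF P that(1), of x] that by (simp add: insert_Diff_if insert_commute)
  have nx: "nx x y \<noteq> x" "{y, nx x y} \<in> \<Phi>" if "{x, y} \<in> \<Phi>" "x \<noteq> y" for x y
    using theI'[OF ex1[OF that]] unfolding nx_def by auto
  have nxu: "z = nx x y" if "{x, y} \<in> \<Phi>" "x \<noteq> y" "z \<noteq> x" "{y, z} \<in> \<Phi>" for x y z
    using ex1[OF that(1,2)] nx[OF that(1,2)] that(3,4) by blast
  have ne: "x \<noteq> y" if "{x, y} \<in> \<Phi>" for x y
    using npm_facet[OF P that] by auto
  define st where "st n = ((\<lambda>(x, y). (y, nx x y)) ^^ n) (a, b)" for n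
  define p where "p n = fst (st n)" for n
  have st: "st n = (p n, p (Suc n))" for n
    by (auto simp: p_def st_def split: prod.splits)
  have p01: "p 0 = a" "p (Suc 0) = b" by (auto simp: p_def st_def)
  have pSS: "p (Suc (Suc n)) = nx (p n) (p (Suc n))" for n
    using st[of "Suc n"] st[of n] by (simp add: st_def)
  have E: "{p n, p (Suc n)} \<in> \<Phi>" for n
  proof (induction n)
    case 0 then show ?case using p01 ab by simp
  next
    case (Suc n) then show ?case using nx(2)[OF Suc ne[OF Suc]] by (simp add: pSS)
  qed
  have p1: "p n \<noteq> p (Suc n)" for n using ne E by blast
  have p2: "p (Suc (Suc n)) \<noteq> p n" for n using nx(1)[OF E p1] by (simp add: pSS)
  \<comment> \<open>The step on oriented edges is reversible, so any coincidence of states can be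
    pulled back to index 0.\<close>
  have bkw: "p n = nx (p (Suc (Suc n))) (p (Suc n))" for n
    using nxu[of "p (Suc (Suc n))" "p (Suc n)" "p n"] E[of n] E[of "Suc n"] p1 p2
    by (metis insert_commute)
  have shift: "p (i + t) = p (j + t)" if "p i = p j" "p (Suc i) = p (Suc j)" for i j t
    using that
  proof (induction t arbitrary: i j)
    case (Suc t)
    then show ?case using Suc.IH[of "Suc i" "Suc j"] by (simp add: pSS)
  qed simp
  have unshift: "p 0 = p d \<and> p (Suc 0) = p (Suc d)" if "p i = p (i + d)" "p (Suc i) = p (Suc (i + d))" for i d
    using that
  proof (induction i)
    case (Suc i)
    have "p i = p (i + d)"
      unfolding bkw[of i] bkw[of "i + d"] using Suc.prems by simp
    then show ?case using Suc by simp
  qed simp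
  have "\<not> inj st"
  proof
    assume "inj st"
    moreover have "range st \<subseteq> \<Union>\<Phi> \<times> \<Union>\<Phi>" using E by (auto simp: st)
    moreover have "finite (\<Union>\<Phi>)" using P by (auto simp: npm_def)
    ultimately show False using finite_subset finite_imageD by blast
  qed
  then obtain i j where "st i = st j" "i < j" unfolding inj_def by (metis linorder_neqE_nat)
  then have "0 < j - i \<and> p 0 = p (j - i) \<and> p (Suc 0) = p (Suc (j - i))"
    using unshift[of i "j - i"] by (auto simp: st)
  then have ex: "\<exists>m. 0 < m \<and> p 0 = p m \<and> p (Suc 0) = p (Suc m)" by blast
  define m where "m = (LEAST m. 0 < m \<and> p 0 = p m \<and> p (Suc 0) = p (Suc m))"
  have m: "0 < m" "p 0 = p m" "p (Suc 0) = p (Suc m)"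
    using LeastI_ex[OF ex] unfolding m_def by auto
  have least: "m \<le> d" if "0 < d" "p i = p (i + d)" "p (Suc i) = p (Suc (i + d))" for i d
    unfolding m_def using unshift[OF that(2,3)] that(1) by (intro Least_le) auto
  have per: "p (n + m) = p n" for n using shift[OF m(2,3), of n] by (simp add: add.commute)
  have permul: "p (n + m * q) = p n" for n q
    by (induction q) (auto simp: per add.assoc[symmetric] add.commute[of m] mult.commute)
  have pmod: "p n = p (n mod m)" for n
    using permul[of "n mod m" "n div m"] by simp
  \<comment> \<open>If an edge is met again in the opposite direction, the walk retraces itself from
    there.\<close>
  have rev: "p (i + t) = p (j - t) \<and> (t < j \<longrightarrow> p (Suc (i + t)) = p (j - Suc t))"
    if "p i = p j" "p (Suc i) = p (j - 1)" "t \<le> j" for i j t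
    using that(3)
  proof (induction t)
    case (Suc t)
    then have IH: "p (i + t) = p (j - t)" "p (Suc (i + t)) = p (j - Suc t)" by auto
    show ?case
    proof (intro conjI impI)
      assume "Suc t < j"
      then obtain u where u: "j = Suc (Suc t) + u" by (metis add_Suc less_imp_Suc_add)
      then have j: "j - Suc t = Suc u" "j - t = Suc (Suc u)" "j - Suc (Suc t) = u" by auto
      have "p (Suc (Suc (i + t))) = nx (p (Suc (Suc u))) (p (Suc u))"
        unfolding pSS[of "i + t"] IH j ..
      then show "p (Suc (i + Suc t)) = p (j - Suc (Suc t))"
        using bkw[of u] j by simp
    qed (use IH in simp)
  qed (use that in simp)
  have Einj: "i = j" if "{p i, p (Suc i)} = {p j, p (Suc j)}" "i \<le> j" "j < m" for i j
  proof (rule ccontr)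
    assume "i \<noteq> j"
    then have ij: "i < j" using that by simp
    note eqE = that(1)
    consider "p i = p j" "p (Suc i) = p (Suc j)" | "p i = p (Suc j)" "p (Suc i) = p j"
      using eqE by (metis doubleton_eq_iff)
    then show False
    proof cases
      case 1
      then show False using least[of "j - i" i] ij \<open>j < m\<close> by simp
    next
      case 2
      define d where "d = Suc j - i"
      have R: "p (i + t) = p (Suc j - t)" if "t \<le> Suc j" for t
        using rev[of i "Suc j" t] 2 that by simp
      show False
      \<comment> \<open>Halfway, the retracing identifies vertices two steps apart (even
        \<open>d\<close>) or the two ends of an edge (odd \<open>d\<close>); both are
        excluded.\<close>
      proof (cases "even d")
        case True
        then obtain t where t: "d = 2 * t" by blast
        then have "t > 0" using ij d_def by auto
        then obtain u where u: "t = Suc u" by (cases t) auto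
        have "Suc j - u = Suc (Suc (i + u))" using t u d_def ij by auto
        moreover have "u \<le> Suc j" using t u d_def by linarith
        ultimately show False using R[of u] p2[of "i + u"] by simp
      next
        case False
        then obtain t where t: "d = 2 * t + 1" using oddE by blast
        have "Suc j - t = Suc (i + t)" using t d_def ij by auto
        moreover have "t \<le> Suc j" using t d_def by linarith
        ultimately show False using R[of t] p1[of "i + t"] by simp
      qed
    qed
  qed
  have Einj': "inj_on (\<lambda>n. {p n, p (Suc n)}) {..<m}"
    using Einj by (intro inj_onI) (metis lessThan_iff nat_le_linear)
  have sur: "F \<in> range (\<lambda>n. {p n, p (Suc n)})" if "F \<in> \<Phi>" for F
  proof -
    have "(\<lambda>X Y. adj X Y \<and> Y \<in> \<Phi> \<and> {a, b} \<inter> F \<subseteq> Y)\<^sup>*\<^sup>* {a, b} G \<Longrightarrow>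
      G \<in> range (\<lambda>n. {p n, p (Suc n)})" for G
    proof (induction rule: rtranclp_induct)
      case base
      have "{a, b} = {p 0, p (Suc 0)}" using p01 by simp
      then show ?case by blast
    next
      case (step X Y)
      then obtain n where X: "X = {p n, p (Suc n)}" by auto
      \<comment> \<open>Shifting by a period guarantees a predecessor index \<open>l\<close>, so
        that the edge can be left at either end.\<close>
      have *: "X = {p (n + m), p (Suc (n + m))}" using per[of n] per[of "Suc n"] X by simp
      obtain l where l: "n + m = Suc l" using m(1) by (cases "n + m") auto
      obtain v w where vw: "v \<in> X" "w \<notin> X" "Y = insert w (X - {v})"
        using step.hyps(2) by (auto simp: adj_def)
      consider "v = p (Suc l)" | "v = p (Suc (Suc l))" using vw(1) * l by auto
      then show ?case
      proof cases
        case 1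
        then have "Y = {p (Suc (Suc l)), w}" using vw * l p1 by auto
        then have "Y = {p (Suc (Suc l)), p (Suc (Suc (Suc l)))}"
          using nxu[OF E[of "Suc l"] p1, of w] vw step.hyps(2) 1 pSS by auto
        then show ?thesis by blast
      next
        case 2
        then have Y: "Y = {p (Suc l), w}" using vw * l p1[of "Suc l"] by auto
        have "{p (Suc (Suc l)), p (Suc l)} \<in> \<Phi>" using E[of "Suc l"] by (simp add: insert_commute)
        then have "w = p l"
          using nxu[of "p (Suc (Suc l))" "p (Suc l)" w] p1[of "Suc l"] vw step.hyps(2) 2 Y bkw[of l]
          by auto
        then have "Y = {p l, p (Suc l)}" using Y by auto
        then show ?thesis by blast
      qed
    qed
    from this[OF npm_connected[OF P ab(2) that]] show ?thesis .
  qed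
  have range: "\<Phi> = range (\<lambda>n. {p n, p (Suc n)})" using sur E by blast
  have Emod: "{p n, p (Suc n)} = {p (n mod m), p (Suc (n mod m))}" for n
    using pmod[of n] pmod[of "Suc n"] pmod[of "Suc (n mod m)"] by (simp add: mod_simps)
  have "range (\<lambda>n. {p n, p (Suc n)}) = (\<lambda>n. {p n, p (Suc n)}) ` {..<m}"
  proof (intro subset_antisym subsetI)
    fix F assume "F \<in> range (\<lambda>n. {p n, p (Suc n)})"
    then obtain n where "F = {p n, p (Suc n)}" by blast
    then have "F = {p (n mod m), p (Suc (n mod m))}" using Emod[of n] by (rule trans)
    then show "F \<in> (\<lambda>n. {p n, p (Suc n)}) ` {..<m}" using m(1) by auto
  qed auto
  then have cm: "card \<Phi> = m" using range card_image[OF Einj'] by simp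
  have m3: "m \<noteq> 1" "m \<noteq> 2" using m p1[of 0] p2[of 0] by (auto simp: numeral_2_eq_2)
  \<comment> \<open>A vertex visited at positions inequivalent mod \<open>m\<close> would have the
    same two edges at both visits, traversed in opposite directions. Then \<open>i'\<close> and
    \<open>j'\<close> are each the successor of the other mod \<open>m\<close>, so \<open>m\<close>
    divides 2, against \<open>m3\<close>.\<close>
  have pinj: "i mod m = j mod m" if "p i = p j" for i j
  proof (rule ccontr)
    assume ne: "i mod m \<noteq> j mod m"
    obtain i' where i': "i + m = Suc i'" using m(1) by (cases "i + m") auto
    obtain j' where j': "j + m = Suc j'" using m(1) by (cases "j + m") auto
    have im: "Suc i' mod m = i mod m" "Suc j' mod m = j mod m"
      using i' j' by (metis mod_add_self2)+
    have pe: "p (Suc i') = p (Suc j')" using that per[of i] per[of j] i' j' by simp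
    have Eeq: "n mod m = l mod m" if "{p n, p (Suc n)} = {p l, p (Suc l)}" for n l
      by (rule inj_onD[OF Einj' trans[OF trans[OF Emod[of n, symmetric] that] Emod[of l]]])
        (use m(1) in auto)
    let ?x = "p (Suc i')"
    have u: "z = p i' \<or> z = p (Suc (Suc i'))" if "{?x, z} \<in> \<Phi>" for z
      using nxu[OF E[of i'] p1 _ that] pSS by auto
    have "p (Suc (Suc j')) = p i'"
    proof -
      have "p (Suc (Suc j')) \<noteq> p (Suc (Suc i'))"
      proof
        assume "p (Suc (Suc j')) = p (Suc (Suc i'))"
        then have "Suc i' mod m = Suc j' mod m" using pe by (intro Eeq) simp
        then show False using im ne by simp
      qed
      moreover have "{?x, p (Suc (Suc j'))} \<in> \<Phi>" using E[of "Suc j'"] pe by simp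
      ultimately show ?thesis using u by blast
    qed
    then have "{p i', p (Suc i')} = {p (Suc j'), p (Suc (Suc j'))}" using pe by auto
    then have 1: "i' mod m = Suc j' mod m" by (rule Eeq)
    have "p j' = p (Suc (Suc i'))"
    proof -
      have "p j' \<noteq> p i'"
        using \<open>p (Suc (Suc j')) = p i'\<close> p2[of j'] by simp
      moreover have "{?x, p j'} \<in> \<Phi>" using E[of "j'"] pe by (simp add: insert_commute)
      ultimately show ?thesis using u by blast
    qed
    then have "{p j', p (Suc j')} = {p (Suc i'), p (Suc (Suc i'))}" using pe by auto
    then have "j' mod m = Suc i' mod m" by (rule Eeq)
    then have "Suc j' mod m = Suc (Suc i') mod m" by (metis mod_Suc_eq)
    with 1 have "i' mod m = (i' + 2) mod m" by simp
    then have "m dvd 2" by (metis add_diff_cancel_left' dvd_eq_mod_eq_0 le_add1 mod_eq_dvd_iff_nat)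
    then have "m \<le> 2" by (rule dvd_imp_le) simp
    then show False using m3 m(1) by linarith
  qed
  show thesis
  proof (rule that[of p])
    show "p i = p j \<longleftrightarrow> i mod card \<Phi> = j mod card \<Phi>" for i j
      unfolding cm using pinj pmod by metis
  qed (use p01 p1 range Einj' cm in auto)
qed

text \<open>\<open>f\<close> carries one walk to the other index by index; this is well defined and
  does not fold edges because equal lengths mean equal periods. Starting the walks at the given
  orderings yields the prescribed values.\<close>

lemma cycle_mor:
  assumes P: "npm 2 \<Phi>" and Q: "npm 2 \<Psi>" and c: "card \<Phi> = card \<Psi>"
    and \<kappa>: "ordered_facet \<Phi> \<kappa>" and \<mu>: "ordered_facet \<Psi> \<mu>"
  obtains f where "mor \<Phi> \<Psi> f" "map f \<kappa> = \<mu>"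
proof -
  obtain a b where ab: "\<kappa> = [a, b]"
    using ordered_facet_length[OF P \<kappa>] by (auto simp: numeral_2_eq_2 length_Suc_conv)
  obtain c' d where cd: "\<mu> = [c', d]"
    using ordered_facet_length[OF Q \<mu>] by (auto simp: numeral_2_eq_2 length_Suc_conv)
  have "a \<noteq> b" "{a, b} \<in> \<Phi>" using \<kappa> ab by (auto simp: ordered_facet_def)
  then obtain p where p: "p 0 = a" "p 1 = b"
    "\<And>i j. p i = p j \<longleftrightarrow> i mod card \<Phi> = j mod card \<Phi>"
    "\<And>i. p i \<noteq> p (Suc i)" "\<Phi> = range (\<lambda>n. {p n, p (Suc n)})"
    "inj_on (\<lambda>n. {p n, p (Suc n)}) {..<card \<Phi>}"
    by (rule cycle_walk[OF P]) (rule that)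
  have "c' \<noteq> d" "{c', d} \<in> \<Psi>" using \<mu> cd by (auto simp: ordered_facet_def)
  then obtain q where q: "q 0 = c'" "q 1 = d"
    "\<And>i j. q i = q j \<longleftrightarrow> i mod card \<Psi> = j mod card \<Psi>"
    "\<And>i. q i \<noteq> q (Suc i)" "\<Psi> = range (\<lambda>n. {q n, q (Suc n)})"
    "inj_on (\<lambda>n. {q n, q (Suc n)}) {..<card \<Psi>}"
    by (rule cycle_walk[OF Q]) (rule that)
  define f where "f v = q (SOME n. p n = v)" for v
  have f: "f (p n) = q n" for n
    unfolding f_def by (rule someI2[of _ n]) (use p(3) q(3) c in auto)
  have fE: "f ` {p n, p (Suc n)} = {q n, q (Suc n)}" for n using f by auto
  have fin: "0 < card \<Phi>"
    using P \<open>{a, b} \<in> \<Phi>\<close> by (auto simp: npm_def card_gt_0_iff)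
  have mor: "mor \<Phi> \<Psi> f"
    unfolding mor_def
  proof (intro conjI ballI impI)
    fix F assume "F \<in> \<Phi>"
    then obtain n where F: "F = {p n, p (Suc n)}" using p(5) by auto
    show "inj_on f F" using F f q(4)[of n] by auto
    show "f ` F \<in> \<Psi>" using F fE q(5) by auto
    fix G assume "G \<in> \<Phi>" "adj F G"
    then obtain l where G: "G = {p l, p (Suc l)}" using p(5) by auto
    have "F \<noteq> G" using \<open>adj F G\<close> by (auto simp: adj_def)
    have m: "{x n, x (Suc n)} = {x (n mod card \<Phi>), x (Suc (n mod card \<Phi>))}"
      if "\<And>i j. x i = x j \<longleftrightarrow> i mod card \<Phi> = j mod card \<Phi>" for x :: "nat \<Rightarrow> 'c" and n
    proof -
      have "x n = x (n mod card \<Phi>)" "x (Suc n) = x (Suc (n mod card \<Phi>))"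
        using that by (auto simp: mod_simps)
      then show ?thesis by simp
    qed
    have "n mod card \<Phi> \<noteq> l mod card \<Phi>"
      using \<open>F \<noteq> G\<close> F G p(3)[of n l] p(3)[of "Suc n" "Suc l"] by (metis mod_Suc_eq)
    then have "{q (n mod card \<Phi>), q (Suc (n mod card \<Phi>))} \<noteq> {q (l mod card \<Phi>), q (Suc (l mod card \<Phi>))}"
      using q(6) c fin unfolding inj_on_def by auto
    moreover have "{q i, q (Suc i)} = {q (i mod card \<Phi>), q (Suc (i mod card \<Phi>))}" for i
    proof -
      have "q i = q (i mod card \<Phi>)" "q (Suc i) = q (Suc (i mod card \<Phi>))"
        using q(3) c by (auto simp: mod_simps)
      then show ?thesis by simp
    qed
    ultimately show "f ` F \<noteq> f ` G" unfolding F G fE by metis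
  qed
  show thesis
    by (rule that[OF mor]) (use f[of 0] f[of 1] p q ab cd in auto)
qed

section \<open>Codes\<close>

text \<open>A tree node is a rose with two sons, the list of slots and the list of children; \<open>leaf\<close> stands
  for a missing child or an empty slot.  A node is addressed by the list of ports leading to it
  from the root, port \<open>i\<close> crossing the ridge opposite the \<open>i\<close>-th vertex.\<close>

fun child :: "rose \<Rightarrow> nat \<Rightarrow> rose" where
  "child (Rose [s, Rose cs]) i = (if i < length cs then cs ! i else leaf)"
| "child _ _ = leaf"

fun slot :: "rose \<Rightarrow> nat \<Rightarrow> rose" where
  "slot (Rose [Rose ss, c]) j = (if j < length ss then ss ! j else leaf)"
| "slot _ _ = leaf"

definition subtree :: "rose \<Rightarrow> nat list \<Rightarrow> rose"
  where "subtree t p = foldl child t p"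

definition addr :: "nat \<Rightarrow> rose \<Rightarrow> nat list set"
  where "addr k t = {p. set p \<subseteq> {..<k} \<and> subtree t p \<noteq> leaf}"

definition walk :: "'v set set \<Rightarrow> 'v list \<Rightarrow> nat list \<Rightarrow> 'v list"
  where "walk \<Phi> \<kappa> p = foldl (nb \<Phi>) \<kappa> p"

definition node :: "'v set set \<Rightarrow> 'v list \<Rightarrow> nat list \<Rightarrow> 'v set"
  where "node \<Phi> \<kappa> p = set (walk \<Phi> \<kappa> p)"

text \<open>Slot \<open>j\<close> of a node belongs to the face of the facet spanned by the positions in the \<open>j\<close>-th
  subsequence of \<open>[0..<k]\<close>.\<close>

definition idx :: "nat \<Rightarrow> nat \<Rightarrow> nat set"
  where "idx k j = set (subseqs [0..<k] ! j)"

definition sel :: "nat \<Rightarrow> 'v list \<Rightarrow> nat \<Rightarrow> 'v set"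
  where "sel k \<kappa> j = (!) \<kappa> ` idx k j"

text \<open>The inherited ordering of the complementary face roots the code of the link, so that an
  isomorphism of links obtained from a slot is already aligned with the host node.\<close>

definition rest :: "nat \<Rightarrow> 'v list \<Rightarrow> nat \<Rightarrow> 'v list"
  where "rest k \<kappa> j = map ((!) \<kappa>) (filter (\<lambda>i. i \<notin> idx k j) [0..<k])"

text \<open>The relations \<open>Q\<close> on addresses, read as ``the gluing is deduced'', that contain the tree edges and
  satisfy: if a face has a nonempty slot and its whole star can be reached from the hosting node
  through deduced gluings around that face, then all gluings around it are deduced.  Gluings are
  known if they belong to the least such relation.\<close>

definition closed_rel ::
    "nat \<Rightarrow> 'v set set \<Rightarrow> 'v list \<Rightarrow> rose \<Rightarrow> (nat list \<Rightarrow> nat list \<Rightarrow> bool) \<Rightarrow> bool"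
  where "closed_rel k \<Phi> \<kappa> t Q \<longleftrightarrow>
    (\<forall>p i. p @ [i] \<in> addr k t \<longrightarrow> Q p (p @ [i]) \<and> Q (p @ [i]) p) \<and>
    (\<forall>p\<^sub>0\<in>addr k t. \<forall>j<2 ^ k. slot (subtree t p\<^sub>0) j \<noteq> leaf \<longrightarrow>
      (\<forall>F\<in>\<Phi>. sel k (walk \<Phi> \<kappa> p\<^sub>0) j \<subseteq> F \<longrightarrow>
        (\<exists>p\<in>addr k t. node \<Phi> \<kappa> p = F \<and>
          (\<lambda>x y. y \<in> addr k t \<and> Q x y \<and> adj (node \<Phi> \<kappa> x) (node \<Phi> \<kappa> y) \<and>
             sel k (walk \<Phi> \<kappa> p\<^sub>0) j \<subseteq> node \<Phi> \<kappa> x \<inter> node \<Phi> \<kappa> y)\<^sup>*\<^sup>* p\<^sub>0 p)) \<longrightarrow>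
      (\<forall>p\<in>addr k t. \<forall>p'\<in>addr k t. adj (node \<Phi> \<kappa> p) (node \<Phi> \<kappa> p') \<longrightarrow>
        sel k (walk \<Phi> \<kappa> p\<^sub>0) j \<subseteq> node \<Phi> \<kappa> p \<inter> node \<Phi> \<kappa> p' \<longrightarrow> Q p p'))"

definition known :: "nat \<Rightarrow> 'v set set \<Rightarrow> 'v list \<Rightarrow> rose \<Rightarrow> 'v set \<Rightarrow> 'v set \<Rightarrow> bool"
  where "known k \<Phi> \<kappa> t F G \<longleftrightarrow>
    (\<exists>p\<in>addr k t. \<exists>p'\<in>addr k t. node \<Phi> \<kappa> p = F \<and> node \<Phi> \<kappa> p' = G \<and>
      (\<forall>Q. closed_rel k \<Phi> \<kappa> t Q \<longrightarrow> Q p p'))"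

text \<open>Ports are written in unary, so that a path is itself a plane tree.\<close>

definition path_code :: "nat list \<Rightarrow> rose"
  where "path_code p = Rose (map (\<lambda>i. Rose (replicate i leaf)) p)"

text \<open>The two trees cover the complex and together determine all gluings; the two paths address a
  common facet, with the same ordering, from which all common facets are reached through gluings
  known in both.\<close>

inductive coded :: "nat \<Rightarrow> 'v set set \<Rightarrow> 'v list \<Rightarrow> rose \<Rightarrow> bool" where
  cycle: "coded 2 \<Phi> \<kappa> (Rose (replicate (card \<Phi>) leaf))"
| runs: "3 \<le> k \<Longrightarrow> ordered_facet \<Phi> \<kappa>' \<Longrightarrow>
    inj_on (node \<Phi> \<kappa>) (addr k t) \<Longrightarrow> inj_on (node \<Phi> \<kappa>') (addr k t') \<Longrightarrow>
    (\<And>p j. p \<in> addr k t \<Longrightarrow> j < 2 ^ k \<Longrightarrow> slot (subtree t p) j \<noteq> leaf \<Longrightarrow>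
      coded (k - card (idx k j)) (link \<Phi> (sel k (walk \<Phi> \<kappa> p) j)) (rest k (walk \<Phi> \<kappa> p) j)
        (slot (subtree t p) j)) \<Longrightarrow>
    (\<And>p j. p \<in> addr k t' \<Longrightarrow> j < 2 ^ k \<Longrightarrow> slot (subtree t' p) j \<noteq> leaf \<Longrightarrow>
      coded (k - card (idx k j)) (link \<Phi> (sel k (walk \<Phi> \<kappa>' p) j)) (rest k (walk \<Phi> \<kappa>' p) j)
        (slot (subtree t' p) j)) \<Longrightarrow>
    (\<And>F. F \<in> \<Phi> \<Longrightarrow> F \<in> node \<Phi> \<kappa> ` addr k t \<union> node \<Phi> \<kappa>' ` addr k t') \<Longrightarrow>
    (\<And>F G. F \<in> \<Phi> \<Longrightarrow> G \<in> \<Phi> \<Longrightarrow> adj F G \<Longrightarrow> known k \<Phi> \<kappa> t F G \<or> known k \<Phi> \<kappa>' t' F G) \<Longrightarrow>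
    p \<in> addr k t \<Longrightarrow> p' \<in> addr k t' \<Longrightarrow> walk \<Phi> \<kappa> p = walk \<Phi> \<kappa>' p' \<Longrightarrow>
    (\<And>F. F \<in> node \<Phi> \<kappa> ` addr k t \<Longrightarrow> F \<in> node \<Phi> \<kappa>' ` addr k t' \<Longrightarrow>
      (\<lambda>X Y. adj X Y \<and> known k \<Phi> \<kappa> t X Y \<and> known k \<Phi> \<kappa>' t' X Y)\<^sup>*\<^sup>* (node \<Phi> \<kappa> p) F) \<Longrightarrow>
    coded k \<Phi> \<kappa> (Rose [t, t', path_code p, path_code p'])"

lemma path_code_inj: "path_code p = path_code q \<Longrightarrow> p = q"
proof -
  assume "path_code p = path_code q"
  then have "map (\<lambda>i. Rose (replicate i leaf)) p = map (\<lambda>i. Rose (replicate i leaf)) q"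
    by (simp add: path_code_def)
  moreover have "inj (\<lambda>i. Rose (replicate i leaf))"
    by (rule injI) (metis length_replicate rose.inject)
  ultimately show "p = q" using inj_map_eq_map by blast
qed

lemma subtree_simps [simp]:
  "subtree t [] = t" "subtree t (i # p) = subtree (child t i) p"
  "subtree t (p @ q) = subtree (subtree t p) q"
  by (simp_all add: subtree_def)

lemma subtree_leaf [simp]: "subtree leaf p = leaf"
  by (induction p) simp_all

lemma addr_prefix: "p @ q \<in> addr k t \<Longrightarrow> p \<in> addr k t"
  by (auto simp: addr_def)

lemma addr_Nil: "p \<in> addr k t \<Longrightarrow> [] \<in> addr k t"
  using addr_prefix[of "[]"] by simp

lemma walk_simps [simp]:
  "walk \<Phi> \<kappa> [] = \<kappa>" "walk \<Phi> \<kappa> (p @ [i]) = nb \<Phi> (walk \<Phi> \<kappa> p) i"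
  by (simp_all add: walk_def)

lemma walk_ordered:
  assumes "npm k \<Phi>" "ordered_facet \<Phi> \<kappa>" "set p \<subseteq> {..<k}"
  shows "ordered_facet \<Phi> (walk \<Phi> \<kappa> p)"
  using assms(3)
proof (induction p rule: rev_induct)
  case (snoc i p)
  then show ?case using nb_ordered[OF assms(1), of "walk \<Phi> \<kappa> p" i] by simp
qed (use assms in simp)

lemma idx_subset: "j < 2 ^ k \<Longrightarrow> idx k j \<subseteq> {..<k}"
proof -
  assume "j < 2 ^ k"
  then have "subseqs [0..<k] ! j \<in> set (subseqs [0..<k])"
    by (intro nth_mem) (simp add: length_subseqs)
  then have "idx k j \<in> set ` set (subseqs [0..<k])" by (simp add: idx_def)
  then show ?thesis by (auto simp: subseqs_powset atLeast0LessThan)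
qed

lemma idx_surj: "I \<subseteq> {..<k} \<Longrightarrow> \<exists>j<2 ^ k. idx k j = I"
proof -
  assume "I \<subseteq> {..<k}"
  then have "I \<in> set ` set (subseqs [0..<k])"
    by (simp add: subseqs_powset atLeast0LessThan)
  then obtain xs where "xs \<in> set (subseqs [0..<k])" "set xs = I" by auto
  then obtain j where "j < length (subseqs [0..<k])" "subseqs [0..<k] ! j = xs"
    by (auto simp: in_set_conv_nth)
  then show ?thesis using \<open>set xs = I\<close> by (auto simp: idx_def length_subseqs)
qed

section \<open>Comparing two complexes with the same code\<close>

definition transport :: "'v list \<Rightarrow> 'w list \<Rightarrow> 'v \<Rightarrow> 'w"
  where "transport \<kappa> \<mu> v = the (map_of (zip \<kappa> \<mu>) v)"

lemma transport_nth:
  "length \<kappa> = length \<mu> \<Longrightarrow> distinct \<kappa> \<Longrightarrow> i < length \<kappa> \<Longrightarrow> transport \<kappa> \<mu> (\<kappa> ! i) = \<mu> ! i"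
  by (simp add: transport_def map_of_zip_nth)

lemma transport_map:
  "length \<kappa> = length \<mu> \<Longrightarrow> distinct \<kappa> \<Longrightarrow> map (transport \<kappa> \<mu>) \<kappa> = \<mu>"
  by (rule nth_equalityI) (simp_all add: transport_nth)

lemma transport_image:
  "length \<kappa> = length \<mu> \<Longrightarrow> distinct \<kappa> \<Longrightarrow> transport \<kappa> \<mu> ` set \<kappa> = set \<mu>"
  by (metis transport_map set_map)

lemma transport_inj:
  "length \<kappa> = length \<mu> \<Longrightarrow> distinct \<kappa> \<Longrightarrow> distinct \<mu> \<Longrightarrow> inj_on (transport \<kappa> \<mu>) (set \<kappa>)"
  by (metis transport_map distinct_map)

text \<open>The image of the common ridge lies in exactly two facets of \<open>\<Psi>\<close>. One
  is the image of \<open>X\<close>; since neither \<open>g\<close> nor \<open>h\<close> folds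
  \<open>Y\<close> onto it, both send \<open>Y\<close> to the other one, and the remaining vertex
  has a single possible value.\<close>

lemma mor_propagate:
  assumes Q: "npm k \<Psi>" and a: "adj X Y"
    and fac: "f ` X \<in> \<Psi>" "g ` Y \<in> \<Psi>" "h ` Y \<in> \<Psi>"
    and inj: "inj_on f X" "inj_on g Y" "inj_on h Y"
    and eq: "\<And>v. v \<in> X \<inter> Y \<Longrightarrow> g v = f v" "\<And>v. v \<in> X \<inter> Y \<Longrightarrow> h v = f v"
    and ne: "f ` X \<noteq> g ` Y" "f ` X \<noteq> h ` Y"
    and v: "v \<in> Y"
  shows "g v = h v"
proof -
  obtain x y where xy: "x \<in> X" "y \<notin> X" "y \<in> Y" "x \<notin> Y"
    "X \<inter> Y = X - {x}" "X = insert x (X \<inter> Y)" "Y = insert y (X \<inter> Y)"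
    using adjE[OF a] by metis
  let ?R = "f ` (X \<inter> Y)"
  have fX: "f ` X = insert (f x) ?R" using xy(6) image_insert[of f x "X \<inter> Y"] by simp
  have "g ` (X \<inter> Y) = ?R" by (rule image_cong) (use eq(1) in auto)
  then have gY: "g ` Y = insert (g y) ?R" using xy(7) image_insert[of g y "X \<inter> Y"] by simp
  have "h ` (X \<inter> Y) = ?R" by (rule image_cong) (use eq(2) in auto)
  then have hY: "h ` Y = insert (h y) ?R" using xy(7) image_insert[of h y "X \<inter> Y"] by simp
  have R: "f ` X - {f x} = ?R"
    using inj(1) xy(1,5) by (auto simp: inj_on_def)
  have "g y \<noteq> f x" "h y \<noteq> f x" using ne fX gY hY by auto
  moreover have "insert (g y) (f ` X - {f x}) \<in> \<Psi>" "insert (h y) (f ` X - {f x}) \<in> \<Psi>"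
    unfolding R using fac gY hY by auto
  ultimately have "g y = h y"
    using npm_nb_ex1[OF Q fac(1), of "f x"] xy(1) by blast
  moreover have "v = y \<or> v \<in> X \<inter> Y" using v xy(7) by blast
  ultimately show ?thesis using eq by auto
qed

lemma closed_relI:
  assumes "\<And>p i. p @ [i] \<in> addr k t \<Longrightarrow> Q p (p @ [i])"
    and "\<And>p i. p @ [i] \<in> addr k t \<Longrightarrow> Q (p @ [i]) p"
    and "\<And>p\<^sub>0 j p p'. p\<^sub>0 \<in> addr k t \<Longrightarrow> j < 2 ^ k \<Longrightarrow> slot (subtree t p\<^sub>0) j \<noteq> leaf \<Longrightarrow>
      (\<And>F. F \<in> \<Phi> \<Longrightarrow> sel k (walk \<Phi> \<kappa> p\<^sub>0) j \<subseteq> F \<Longrightarrow> \<exists>p\<in>addr k t. node \<Phi> \<kappa> p = F \<and>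
          (\<lambda>x y. y \<in> addr k t \<and> Q x y \<and> adj (node \<Phi> \<kappa> x) (node \<Phi> \<kappa> y) \<and>
             sel k (walk \<Phi> \<kappa> p\<^sub>0) j \<subseteq> node \<Phi> \<kappa> x \<inter> node \<Phi> \<kappa> y)\<^sup>*\<^sup>* p\<^sub>0 p) \<Longrightarrow>
      p \<in> addr k t \<Longrightarrow> p' \<in> addr k t \<Longrightarrow> adj (node \<Phi> \<kappa> p) (node \<Phi> \<kappa> p') \<Longrightarrow>
      sel k (walk \<Phi> \<kappa> p\<^sub>0) j \<subseteq> node \<Phi> \<kappa> p \<inter> node \<Phi> \<kappa> p' \<Longrightarrow> Q p p'"
  shows "closed_rel k \<Phi> \<kappa> t Q"
  unfolding closed_rel_def
  by (intro conjI allI ballI impI assms(1,2); (assumption | rule assms(3)); (assumption | blast))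

lemma closed_rel_star:
  assumes "closed_rel k \<Phi> \<kappa> t Q"
    and "p\<^sub>0 \<in> addr k t" "j < 2 ^ k" "slot (subtree t p\<^sub>0) j \<noteq> leaf"
    and "\<And>F. F \<in> \<Phi> \<Longrightarrow> sel k (walk \<Phi> \<kappa> p\<^sub>0) j \<subseteq> F \<Longrightarrow> \<exists>p\<in>addr k t. node \<Phi> \<kappa> p = F \<and>
          (\<lambda>x y. y \<in> addr k t \<and> Q x y \<and> adj (node \<Phi> \<kappa> x) (node \<Phi> \<kappa> y) \<and>
             sel k (walk \<Phi> \<kappa> p\<^sub>0) j \<subseteq> node \<Phi> \<kappa> x \<inter> node \<Phi> \<kappa> y)\<^sup>*\<^sup>* p\<^sub>0 p"
    and "p \<in> addr k t" "p' \<in> addr k t" "adj (node \<Phi> \<kappa> p) (node \<Phi> \<kappa> p')"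
      "sel k (walk \<Phi> \<kappa> p\<^sub>0) j \<subseteq> node \<Phi> \<kappa> p \<inter> node \<Phi> \<kappa> p'"
  shows "Q p p'"
proof -
  have "\<forall>F\<in>\<Phi>. sel k (walk \<Phi> \<kappa> p\<^sub>0) j \<subseteq> F \<longrightarrow> (\<exists>p\<in>addr k t. node \<Phi> \<kappa> p = F \<and>
          (\<lambda>x y. y \<in> addr k t \<and> Q x y \<and> adj (node \<Phi> \<kappa> x) (node \<Phi> \<kappa> y) \<and>
             sel k (walk \<Phi> \<kappa> p\<^sub>0) j \<subseteq> node \<Phi> \<kappa> x \<inter> node \<Phi> \<kappa> y)\<^sup>*\<^sup>* p\<^sub>0 p)"
    using assms(5) by simp
  note s = conjunct2[OF assms(1)[unfolded closed_rel_def], THEN bspec, OF assms(2),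
      THEN spec, THEN mp, OF assms(3), THEN mp, OF assms(4), THEN mp, OF this]
  show ?thesis
    by (rule s[THEN bspec, OF assms(6), THEN bspec, OF assms(7), THEN mp, OF assms(8), THEN mp, OF assms(9)])
qed

text \<open>Reading off the deductions from the code alone: in any other complex with the same tree and slots,
  the vertex bijections between corresponding facets agree across every known gluing.\<close>

lemma run_preserved:
  fixes \<Phi> :: "'v set set" and \<Psi> :: "'w set set"
  assumes P: "npm k \<Phi>" and Q: "npm k \<Psi>"
    and o: "ordered_facet \<Phi> \<kappa>" "ordered_facet \<Psi> \<mu>"
    and inj: "inj_on (node \<Phi> \<kappa>) (addr k t)"
    and slots: "\<And>p j. p \<in> addr k t \<Longrightarrow> j < 2 ^ k \<Longrightarrow> slot (subtree t p) j \<noteq> leaf \<Longrightarrow>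
      \<exists>\<psi>. mor (link \<Phi> (sel k (walk \<Phi> \<kappa> p) j)) (link \<Psi> (sel k (walk \<Psi> \<mu> p) j)) \<psi> \<and>
        map \<psi> (rest k (walk \<Phi> \<kappa> p) j) = rest k (walk \<Psi> \<mu> p) j"
  defines "L p \<equiv> transport (walk \<Phi> \<kappa> p) (walk \<Psi> \<mu> p)"
  shows "closed_rel k \<Phi> \<kappa> t (\<lambda>p p'.
    (\<forall>v\<in>node \<Phi> \<kappa> p \<inter> node \<Phi> \<kappa> p'. L p v = L p' v) \<and> node \<Psi> \<mu> p \<noteq> node \<Psi> \<mu> p')"
proof -
  have oP: "ordered_facet \<Phi> (walk \<Phi> \<kappa> p)" and oQ: "ordered_facet \<Psi> (walk \<Psi> \<mu> p)"
    and lP: "length (walk \<Phi> \<kappa> p) = k" and lQ: "length (walk \<Psi> \<mu> p) = k"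
    if "p \<in> addr k t" for p
    using that walk_ordered[OF P o(1)] walk_ordered[OF Q o(2)] ordered_facet_length[OF P]
      ordered_facet_length[OF Q] by (auto simp: addr_def)
  have dP: "distinct (walk \<Phi> \<kappa> p)" "node \<Phi> \<kappa> p \<in> \<Phi>"
    and dQ: "distinct (walk \<Psi> \<mu> p)" "node \<Psi> \<mu> p \<in> \<Psi>" if "p \<in> addr k t" for p
    using oP[OF that] oQ[OF that] by (auto simp: ordered_facet_def node_def)
  have Limg: "L p ` node \<Phi> \<kappa> p = node \<Psi> \<mu> p" and Linj: "inj_on (L p) (node \<Phi> \<kappa> p)"
    and Lnth: "\<And>i. i < k \<Longrightarrow> L p (walk \<Phi> \<kappa> p ! i) = walk \<Psi> \<mu> p ! i"
    if "p \<in> addr k t" for p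
    using transport_image[of "walk \<Phi> \<kappa> p" "walk \<Psi> \<mu> p"]
      transport_inj[of "walk \<Phi> \<kappa> p" "walk \<Psi> \<mu> p"]
      transport_nth[of "walk \<Phi> \<kappa> p" "walk \<Psi> \<mu> p"] lP[OF that] lQ[OF that] dP[OF that] dQ[OF that]
    by (auto simp: L_def node_def)
  \<comment> \<open>A port changes one position, the same in both complexes, so the position-wise
    bijections agree on all others.\<close>
  have tree: "(\<forall>v\<in>node \<Phi> \<kappa> p \<inter> node \<Phi> \<kappa> (p @ [i]). L p v = L (p @ [i]) v) \<and>
      node \<Psi> \<mu> p \<noteq> node \<Psi> \<mu> (p @ [i])" if pi: "p @ [i] \<in> addr k t" for p i
  proof -
    have p: "p \<in> addr k t" and i: "i < k" using pi addr_prefix by (auto simp: addr_def)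
    obtain w where w: "w \<notin> set (walk \<Phi> \<kappa> p)" "walk \<Phi> \<kappa> (p @ [i]) = (walk \<Phi> \<kappa> p)[i := w]"
      using nb_facts[OF P oP[OF p] i] unfolding walk_simps by metis
    obtain u where u: "walk \<Psi> \<mu> (p @ [i]) = (walk \<Psi> \<mu> p)[i := u]"
      using nb_facts[OF Q oQ[OF p] i] unfolding walk_simps by metis
    have "adj (node \<Psi> \<mu> p) (node \<Psi> \<mu> (p @ [i]))"
      using nb_adj[OF Q oQ[OF p] i] by (simp add: node_def)
    then have "node \<Psi> \<mu> p \<noteq> node \<Psi> \<mu> (p @ [i])" by (auto simp: adj_def)
    moreover have "L p v = L (p @ [i]) v" if v: "v \<in> node \<Phi> \<kappa> p \<inter> node \<Phi> \<kappa> (p @ [i])" for v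
    proof -
      obtain l where l: "l < k" "v = walk \<Phi> \<kappa> (p @ [i]) ! l"
        using v lP[OF pi] unfolding node_def Int_iff in_set_conv_nth by metis
      have "l \<noteq> i"
        using v w l lP[OF p] by (auto simp: node_def)
      then have "v = walk \<Phi> \<kappa> p ! l" "walk \<Psi> \<mu> (p @ [i]) ! l = walk \<Psi> \<mu> p ! l"
        using l w u by auto
      then show ?thesis using Lnth[OF p l(1)] Lnth[OF pi l(1)] l by metis
    qed
    ultimately show ?thesis by blast
  qed
  have star: "(\<forall>v\<in>node \<Phi> \<kappa> p \<inter> node \<Phi> \<kappa> p'. L p v = L p' v) \<and> node \<Psi> \<mu> p \<noteq> node \<Psi> \<mu> p'"
    if p0: "p\<^sub>0 \<in> addr k t" and j: "j < 2 ^ k" and sl: "slot (subtree t p\<^sub>0) j \<noteq> leaf"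
      and \<sigma>: "\<sigma> = sel k (walk \<Phi> \<kappa> p\<^sub>0) j"
      and reach: "\<And>F. F \<in> \<Phi> \<Longrightarrow> \<sigma> \<subseteq> F \<Longrightarrow> \<exists>p\<in>addr k t. node \<Phi> \<kappa> p = F \<and>
          (\<lambda>x y. y \<in> addr k t \<and> ((\<forall>v\<in>node \<Phi> \<kappa> x \<inter> node \<Phi> \<kappa> y. L x v = L y v) \<and>
             node \<Psi> \<mu> x \<noteq> node \<Psi> \<mu> y) \<and> adj (node \<Phi> \<kappa> x) (node \<Phi> \<kappa> y) \<and>
             \<sigma> \<subseteq> node \<Phi> \<kappa> x \<inter> node \<Phi> \<kappa> y)\<^sup>*\<^sup>* p\<^sub>0 p"
      and pp: "p \<in> addr k t" "p' \<in> addr k t" "adj (node \<Phi> \<kappa> p) (node \<Phi> \<kappa> p')"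
        "\<sigma> \<subseteq> node \<Phi> \<kappa> p \<inter> node \<Phi> \<kappa> p'"
    for p\<^sub>0 j \<sigma> p p'
  proof -
    let ?a = "walk \<Phi> \<kappa> p\<^sub>0" and ?b = "walk \<Psi> \<mu> p\<^sub>0"
    define \<sigma>' where "\<sigma>' = sel k ?b j"
    obtain \<psi> where \<psi>: "mor (link \<Phi> \<sigma>) (link \<Psi> \<sigma>') \<psi>" "map \<psi> (rest k ?a j) = rest k ?b j"
      using slots[OF p0 j sl] \<sigma> \<sigma>'_def by blast
    \<comment> \<open>The link morphism knows nothing of \<open>\<sigma>\<close>, so there the
      bijection of the host node is used. The result lives on the whole star and agrees with the
      host everywhere (\<open>h0\<close>), because \<open>\<psi>\<close> respects the orderings
      \<open>rest\<close>.\<close>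
    define h where "h v = (if v \<in> \<sigma> then L p\<^sub>0 v else \<psi> v)" for v
    have I: "idx k j \<subseteq> {..<k}" by (rule idx_subset[OF j])
    have \<sigma>sub: "\<sigma> \<subseteq> node \<Phi> \<kappa> p\<^sub>0"
      using I lP[OF p0] unfolding \<sigma> sel_def node_def by auto
    have h\<sigma>: "h ` \<sigma> = \<sigma>'"
    proof -
      have "h ` \<sigma> = L p\<^sub>0 ` \<sigma>" by (auto simp: h_def)
      also have "\<dots> = (\<lambda>i. L p\<^sub>0 (?a ! i)) ` idx k j" by (simp add: \<sigma> sel_def image_image)
      also have "\<dots> = \<sigma>'" unfolding \<sigma>'_def sel_def
        by (rule image_cong) (use I Lnth[OF p0] in auto)
      finally show ?thesis .
    qed
    have h0: "h v = L p\<^sub>0 v" if vn: "v \<in> node \<Phi> \<kappa> p\<^sub>0" for v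
    proof (cases "v \<in> \<sigma>")
      case False
      obtain i where i: "i < k" "v = ?a ! i"
        using vn lP[OF p0] unfolding node_def in_set_conv_nth by metis
      then have "i \<notin> idx k j" using False \<sigma> by (auto simp: sel_def)
      then have "i \<in> set (filter (\<lambda>i. i \<notin> idx k j) [0..<k])" using i by simp
      then have "\<psi> (?a ! i) = ?b ! i"
        using \<psi>(2) unfolding rest_def map_map map_eq_conv by simp
      then show ?thesis using False i Lnth[OF p0] by (simp add: h_def)
    qed (simp add: h_def)
    have hstar: "h ` F \<in> \<Psi>" "inj_on h F" "h ` F = \<sigma>' \<union> \<psi> ` (F - \<sigma>)" "\<sigma>' \<inter> \<psi> ` (F - \<sigma>) = {}"
      if F: "F \<in> \<Phi>" "\<sigma> \<subseteq> F" for F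
    proof -
      have "F - \<sigma> \<in> link \<Phi> \<sigma>" using F by (auto simp: link_def)
      then have "\<psi> ` (F - \<sigma>) \<in> link \<Psi> \<sigma>'" and i: "inj_on \<psi> (F - \<sigma>)"
        using \<psi>(1) by (auto simp: mor_def)
      then obtain G where G: "G \<in> \<Psi>" "\<sigma>' \<subseteq> G" "\<psi> ` (F - \<sigma>) = G - \<sigma>'"
        by (auto simp: link_def)
      have "h ` F = h ` \<sigma> \<union> h ` (F - \<sigma>)" using F by (metis Diff_partition image_Un)
      moreover have "h ` (F - \<sigma>) = \<psi> ` (F - \<sigma>)" by (auto simp: h_def)
      ultimately show e: "h ` F = \<sigma>' \<union> \<psi> ` (F - \<sigma>)" using h\<sigma> by simp
      then have "h ` F = G" using G by auto
      then show "h ` F \<in> \<Psi>" using G by simp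
      show d: "\<sigma>' \<inter> \<psi> ` (F - \<sigma>) = {}" using G by auto
      have "inj_on h \<sigma>"
        using inj_on_subset[OF Linj[OF p0] \<sigma>sub] by (auto simp: h_def inj_on_def)
      moreover have "inj_on h (F - \<sigma>)" using i by (auto simp: h_def inj_on_def)
      moreover have "h ` \<sigma> \<inter> h ` (F - \<sigma>) = {}"
        using d h\<sigma> \<open>h ` (F - \<sigma>) = \<psi> ` (F - \<sigma>)\<close> by simp
      ultimately have "inj_on h (\<sigma> \<union> (F - \<sigma>))"
        by (subst inj_on_Un) (auto simp: Diff_triv Int_commute)
      then show "inj_on h F" using F by (simp add: Un_absorb1)
    qed
    \<comment> \<open>Adjacent facets around \<open>\<sigma>\<close> stay adjacent in the link,
      where \<open>\<psi>\<close> does not fold; removing \<open>\<sigma>'\<close> recovers the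
      images under \<open>\<psi>\<close>.\<close>
    have hadj: "h ` F \<noteq> h ` G" if "F \<in> \<Phi>" "G \<in> \<Phi>" "\<sigma> \<subseteq> F" "\<sigma> \<subseteq> G" and FG: "adj F G" for F G
    proof
      assume "h ` F = h ` G"
      moreover have "\<psi> ` (F - \<sigma>) = h ` F - \<sigma>'"
        using hstar(3,4)[OF that(1,3)] by auto
      moreover have "\<psi> ` (G - \<sigma>) = h ` G - \<sigma>'"
        using hstar(3,4)[OF that(2,4)] by auto
      ultimately have "\<psi> ` (F - \<sigma>) = \<psi> ` (G - \<sigma>)" by simp
      moreover have "adj (F - \<sigma>) (G - \<sigma>)"
      proof -
        obtain v w where "v \<in> F" "w \<notin> F" "w \<in> G" "v \<notin> G" "G = insert w (F - {v})"
          using adjE[OF FG] by metis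
        moreover from this have "G - \<sigma> = insert w (F - \<sigma> - {v})" "v \<in> F - \<sigma>" "w \<notin> F - \<sigma>"
          using that by auto
        ultimately show ?thesis using adjI[of v "F - \<sigma>" w] by simp
      qed
      moreover have "F - \<sigma> \<in> link \<Phi> \<sigma>" "G - \<sigma> \<in> link \<Phi> \<sigma>"
        using that by (auto simp: link_def)
      ultimately show False using \<psi>(1) by (auto simp: mor_def)
    qed
    have agree: "p \<in> addr k t \<and> (\<forall>v\<in>node \<Phi> \<kappa> p. L p v = h v)"
      if "(\<lambda>x y. y \<in> addr k t \<and> ((\<forall>v\<in>node \<Phi> \<kappa> x \<inter> node \<Phi> \<kappa> y. L x v = L y v) \<and>
             node \<Psi> \<mu> x \<noteq> node \<Psi> \<mu> y) \<and> adj (node \<Phi> \<kappa> x) (node \<Phi> \<kappa> y) \<and>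
             \<sigma> \<subseteq> node \<Phi> \<kappa> x \<inter> node \<Phi> \<kappa> y)\<^sup>*\<^sup>* p\<^sub>0 p" for p
      using that
    proof (induction rule: rtranclp_induct)
      case base
      then show ?case using p0 h0 by simp
    next
      case (step x y)
      then have x: "x \<in> addr k t" and hx: "\<And>v. v \<in> node \<Phi> \<kappa> x \<Longrightarrow> L x v = h v"
        and y: "y \<in> addr k t" and Lxy: "\<forall>v\<in>node \<Phi> \<kappa> x \<inter> node \<Phi> \<kappa> y. L x v = L y v"
        and ne: "node \<Psi> \<mu> x \<noteq> node \<Psi> \<mu> y" and ad: "adj (node \<Phi> \<kappa> x) (node \<Phi> \<kappa> y)"
        and sub: "\<sigma> \<subseteq> node \<Phi> \<kappa> x" "\<sigma> \<subseteq> node \<Phi> \<kappa> y" by auto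
      have "L y v = h v" if v: "v \<in> node \<Phi> \<kappa> y" for v
      proof (rule mor_propagate[OF Q ad, where f = "L x"])
        have "h ` node \<Phi> \<kappa> x = L x ` node \<Phi> \<kappa> x" using hx by auto
        then show "L x ` node \<Phi> \<kappa> x \<noteq> h ` node \<Phi> \<kappa> y"
          using hadj[OF dP(2)[OF x] dP(2)[OF y] sub ad] by simp
        show "L x ` node \<Phi> \<kappa> x \<in> \<Psi>" "L y ` node \<Phi> \<kappa> y \<in> \<Psi>"
          "L x ` node \<Phi> \<kappa> x \<noteq> L y ` node \<Phi> \<kappa> y"
          unfolding Limg[OF x] Limg[OF y] using dQ(2)[OF x] dQ(2)[OF y] ne by auto
        show "h u = L x u" if "u \<in> node \<Phi> \<kappa> x \<inter> node \<Phi> \<kappa> y" for u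
          using hx that by simp
        show "L y u = L x u" if "u \<in> node \<Phi> \<kappa> x \<inter> node \<Phi> \<kappa> y" for u
          using Lxy that by simp
      qed (use Linj[OF x] Linj[OF y] hstar(1,2)[OF dP(2)[OF y] sub(2)] v in auto)
      then show ?case using y by blast
    qed
    \<comment> \<open>The star condition only promises some address for the facet; injectivity of
      \<open>node\<close> makes it the given one.\<close>
    have fin: "\<forall>v\<in>node \<Phi> \<kappa> q. L q v = h v" if q: "q \<in> addr k t" "\<sigma> \<subseteq> node \<Phi> \<kappa> q" for q
    proof -
      obtain q' where "q' \<in> addr k t" "node \<Phi> \<kappa> q' = node \<Phi> \<kappa> q" "\<forall>v\<in>node \<Phi> \<kappa> q'. L q' v = h v"
        using reach[OF dP(2)[OF q(1)] q(2)] agree by blast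
      moreover from this have "q' = q" using inj q by (simp add: inj_on_def)
      ultimately show ?thesis by simp
    qed
    have e: "\<forall>v\<in>node \<Phi> \<kappa> p. L p v = h v" "\<forall>v\<in>node \<Phi> \<kappa> p'. L p' v = h v"
      using fin pp by auto
    then have "h ` node \<Phi> \<kappa> p = node \<Psi> \<mu> p" "h ` node \<Phi> \<kappa> p' = node \<Psi> \<mu> p'"
      using Limg[OF pp(1)] Limg[OF pp(2)] by (metis image_cong)+
    then have "node \<Psi> \<mu> p \<noteq> node \<Psi> \<mu> p'"
      using hadj[OF dP(2)[OF pp(1)] dP(2)[OF pp(2)] _ _ pp(3)] pp(4) by simp
    then show ?thesis using e by simp
  qed
  show ?thesis
  proof (rule closed_relI, goal_cases)
    case (1 p i)
    then show ?case by (rule tree)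
  next
    case (2 p i)
    from tree[OF this] show ?case by auto
  next
    case (3 p\<^sub>0 j p p')
    show ?case by (rule star[OF 3(1-3) refl 3(4) 3(5-8)])
  qed
qed

section \<open>Equal codes give isomorphic complexes\<close>

text \<open>A known gluing belongs to every closed relation, in particular to the agreement relation
  of \<open>run_preserved\<close>. As each facet has one address, the bijections can be indexed by
  facets instead.\<close>

lemma run_maps:
  fixes \<Phi> :: "'v set set" and \<Psi> :: "'w set set"
  assumes P: "npm k \<Phi>" and Q: "npm k \<Psi>"
    and o: "ordered_facet \<Phi> \<kappa>" "ordered_facet \<Psi> \<mu>"
    and inj: "inj_on (node \<Phi> \<kappa>) (addr k t)"
    and slots: "\<And>p j. p \<in> addr k t \<Longrightarrow> j < 2 ^ k \<Longrightarrow> slot (subtree t p) j \<noteq> leaf \<Longrightarrow>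
      \<exists>\<psi>. mor (link \<Phi> (sel k (walk \<Phi> \<kappa> p) j)) (link \<Psi> (sel k (walk \<Psi> \<mu> p) j)) \<psi> \<and>
        map \<psi> (rest k (walk \<Phi> \<kappa> p) j) = rest k (walk \<Psi> \<mu> p) j"
  obtains L where
    "\<And>p. p \<in> addr k t \<Longrightarrow> map (L (node \<Phi> \<kappa> p)) (walk \<Phi> \<kappa> p) = walk \<Psi> \<mu> p"
    "\<And>F. F \<in> node \<Phi> \<kappa> ` addr k t \<Longrightarrow> inj_on (L F) F \<and> L F ` F \<in> \<Psi>"
    "\<And>F G. known k \<Phi> \<kappa> t F G \<Longrightarrow> F \<in> node \<Phi> \<kappa> ` addr k t \<and> G \<in> node \<Phi> \<kappa> ` addr k t \<and>
       (\<forall>v\<in>F \<inter> G. L F v = L G v) \<and> L F ` F \<noteq> L G ` G"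
proof -
  define T where "T p = transport (walk \<Phi> \<kappa> p) (walk \<Psi> \<mu> p)" for p
  define L where "L F = T (inv_into (addr k t) (node \<Phi> \<kappa>) F)" for F
  have L: "L (node \<Phi> \<kappa> p) = T p" if "p \<in> addr k t" for p
    using inv_into_f_f[OF inj that] by (simp add: L_def)
  have facts: "map (T p) (walk \<Phi> \<kappa> p) = walk \<Psi> \<mu> p" "inj_on (T p) (node \<Phi> \<kappa> p)"
      "T p ` node \<Phi> \<kappa> p = node \<Psi> \<mu> p" "node \<Psi> \<mu> p \<in> \<Psi>" if "p \<in> addr k t" for p
  proof -
    have oP: "ordered_facet \<Phi> (walk \<Phi> \<kappa> p)" and oQ: "ordered_facet \<Psi> (walk \<Psi> \<mu> p)"
      using that walk_ordered[OF P o(1)] walk_ordered[OF Q o(2)] by (auto simp: addr_def)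
    have "length (walk \<Phi> \<kappa> p) = length (walk \<Psi> \<mu> p)"
      using oP oQ ordered_facet_length[OF P] ordered_facet_length[OF Q] by simp
    then show "map (T p) (walk \<Phi> \<kappa> p) = walk \<Psi> \<mu> p" "inj_on (T p) (node \<Phi> \<kappa> p)"
      "T p ` node \<Phi> \<kappa> p = node \<Psi> \<mu> p" "node \<Psi> \<mu> p \<in> \<Psi>"
      unfolding T_def node_def using oP oQ
      by (simp_all add: ordered_facet_def transport_map transport_inj transport_image)
  qed
  note pres = run_preserved[OF P Q o inj slots, folded T_def]
  show thesis
  proof (rule that[of L])
    show "map (L (node \<Phi> \<kappa> p)) (walk \<Phi> \<kappa> p) = walk \<Psi> \<mu> p" if "p \<in> addr k t" for p
      using facts(1)[OF that] L[OF that] by simp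
    show "inj_on (L F) F \<and> L F ` F \<in> \<Psi>" if "F \<in> node \<Phi> \<kappa> ` addr k t" for F
      using that facts L by force
    fix F G assume "known k \<Phi> \<kappa> t F G"
    then obtain p p' where p: "p \<in> addr k t" "p' \<in> addr k t" "node \<Phi> \<kappa> p = F" "node \<Phi> \<kappa> p' = G"
      and *: "\<And>Q. closed_rel k \<Phi> \<kappa> t Q \<Longrightarrow> Q p p'"
      by (auto simp: known_def)
    from *[OF pres] show "F \<in> node \<Phi> \<kappa> ` addr k t \<and> G \<in> node \<Phi> \<kappa> ` addr k t \<and>
       (\<forall>v\<in>F \<inter> G. L F v = L G v) \<and> L F ` F \<noteq> L G ` G"
      using facts(3)[OF p(1)] facts(3)[OF p(2)] L[OF p(1)] L[OF p(2)] p by auto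
  qed
qed

lemma sel_subset:
  assumes "npm k \<Phi>" "ordered_facet \<Phi> \<kappa>" "j < 2 ^ k"
  shows "sel k \<kappa> j \<subseteq> set \<kappa>" "card (sel k \<kappa> j) = card (idx k j)"
    "ordered_facet (link \<Phi> (sel k \<kappa> j)) (rest k \<kappa> j)" "set (rest k \<kappa> j) = set \<kappa> - sel k \<kappa> j"
proof -
  have len: "length \<kappa> = k" and d: "distinct \<kappa>" and F: "set \<kappa> \<in> \<Phi>"
    using ordered_facet_length[OF assms(1,2)] assms(2) by (auto simp: ordered_facet_def)
  have I: "idx k j \<subseteq> {..<k}" using idx_subset[OF assms(3)] .
  have inj: "inj_on ((!) \<kappa>) {..<k}" using d len by (simp add: inj_on_nth)
  show sub: "sel k \<kappa> j \<subseteq> set \<kappa>" using I len by (auto simp: sel_def)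
  show "card (sel k \<kappa> j) = card (idx k j)"
    unfolding sel_def by (rule card_image[OF inj_on_subset[OF inj I]])
  have "set \<kappa> = (!) \<kappa> ` {..<k}" using len by (auto simp: in_set_conv_nth image_iff)
  moreover have "set (rest k \<kappa> j) = (!) \<kappa> ` ({..<k} - idx k j)"
    by (auto simp: rest_def)
  ultimately show s: "set (rest k \<kappa> j) = set \<kappa> - sel k \<kappa> j"
    using inj_on_image_set_diff[OF inj, of "{..<k}" "idx k j"] I by (simp add: sel_def)
  have "distinct (rest k \<kappa> j)"
    unfolding rest_def distinct_map
    by (intro conjI inj_on_subset[OF inj]) auto
  moreover have "set (rest k \<kappa> j) \<in> link \<Phi> (sel k \<kappa> j)"
    unfolding s link_def using F sub by auto
  ultimately show "ordered_facet (link \<Phi> (sel k \<kappa> j)) (rest k \<kappa> j)"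
    by (simp add: ordered_facet_def)
qed

text \<open>Two facets containing \<open>v\<close> are joined by a path of facets all containing
  \<open>v\<close>, because the star of their intersection is strongly connected; along it the value
  at \<open>v\<close> cannot change.\<close>

lemma mor_glue:
  fixes \<Phi> :: "'v set set"
  assumes P: "npm k \<Phi>" "1 \<le> k"
    and L: "\<And>F. F \<in> \<Phi> \<Longrightarrow> inj_on (L F) F \<and> L F ` F \<in> \<Psi>"
    and adj: "\<And>F G. F \<in> \<Phi> \<Longrightarrow> G \<in> \<Phi> \<Longrightarrow> adj F G \<Longrightarrow>
      (\<forall>v\<in>F \<inter> G. L F v = L G v) \<and> L F ` F \<noteq> L G ` G"
  obtains f where "mor \<Phi> \<Psi> f" "\<And>F v. F \<in> \<Phi> \<Longrightarrow> v \<in> F \<Longrightarrow> f v = L F v"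
proof -
  have eq: "L F v = L G v" if FG: "F \<in> \<Phi>" "G \<in> \<Phi>" and v: "v \<in> F" "v \<in> G" for F G v
  proof -
    have "(\<lambda>X Y. adj X Y \<and> Y \<in> \<Phi> \<and> F \<inter> G \<subseteq> Y)\<^sup>*\<^sup>* F H \<Longrightarrow> H \<in> \<Phi> \<and> v \<in> H \<and> L F v = L H v" for H
    proof (induction rule: rtranclp_induct)
      case base
      then show ?case using that by simp
    next
      case (step X Y)
      then have "v \<in> Y" using v by auto
      moreover have "L X v = L Y v" using adj[of X Y] step \<open>v \<in> Y\<close> by auto
      ultimately show ?case using step by simp
    qed
    from this[OF npm_connected[OF P(1) FG]] show ?thesis by simp
  qed
  define f where "f v = L (SOME F. F \<in> \<Phi> \<and> v \<in> F) v" for v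
  have f: "f v = L F v" if "F \<in> \<Phi>" "v \<in> F" for F v
  proof -
    have "(SOME F. F \<in> \<Phi> \<and> v \<in> F) \<in> \<Phi> \<and> v \<in> (SOME F. F \<in> \<Phi> \<and> v \<in> F)"
      using someI[of "\<lambda>F. F \<in> \<Phi> \<and> v \<in> F" F] that by blast
    then show ?thesis using eq that unfolding f_def by blast
  qed
  have fF: "f ` F = L F ` F" if "F \<in> \<Phi>" for F
    using f[OF that] by (rule image_cong[OF refl])
  have "mor \<Phi> \<Psi> f"
    unfolding mor_def
  proof (intro conjI ballI impI)
    fix F assume F: "F \<in> \<Phi>"
    show "inj_on f F" using L[OF F] f[OF F] by (simp add: inj_on_def)
    show "f ` F \<in> \<Psi>" using L[OF F] fF[OF F] by simp
    fix G assume "G \<in> \<Phi>" "adj F G"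
    then show "f ` F \<noteq> f ` G" using adj[OF F] fF F by simp
  qed
  then show thesis using that f by blast
qed

text \<open>Induction on the derivation of the first code with inversion of the second; the
  induction hypotheses turn equal slots into morphisms of links.\<close>

lemma coded_mor:
  fixes \<Phi> :: "'v set set" and \<Psi> :: "'w set set"
  assumes "coded k \<Phi> \<kappa> t" "npm k \<Phi>" "npm k \<Psi>" "ordered_facet \<Phi> \<kappa>" "ordered_facet \<Psi> \<mu>"
    "coded k \<Psi> \<mu> t"
  shows "\<exists>f. mor \<Phi> \<Psi> f \<and> map f \<kappa> = \<mu>"
  using assms
proof (induction arbitrary: \<Psi> \<mu> rule: coded.induct)
  case (cycle \<Phi> \<kappa>)
  from cycle.prems(5) have "card \<Phi> = card \<Psi>"
  proof cases
    case cycle then show ?thesis by (metis length_replicate)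
  qed auto
  then show ?case
    using cycle_mor[OF cycle.prems(1,2) _ cycle.prems(3,4)] by metis
next
  case (runs k \<Phi> \<kappa>' \<kappa> t t' p p')
  note P = runs.prems(1) and Q = runs.prems(2) and o = runs.prems(3,4)
  obtain \<mu>' where \<mu>': "ordered_facet \<Psi> \<mu>'"
    and cod: "\<And>p j. p \<in> addr k t \<Longrightarrow> j < 2 ^ k \<Longrightarrow> slot (subtree t p) j \<noteq> leaf \<Longrightarrow>
      coded (k - card (idx k j)) (link \<Psi> (sel k (walk \<Psi> \<mu> p) j)) (rest k (walk \<Psi> \<mu> p) j)
        (slot (subtree t p) j)"
    and cod': "\<And>p j. p \<in> addr k t' \<Longrightarrow> j < 2 ^ k \<Longrightarrow> slot (subtree t' p) j \<noteq> leaf \<Longrightarrow>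
      coded (k - card (idx k j)) (link \<Psi> (sel k (walk \<Psi> \<mu>' p) j)) (rest k (walk \<Psi> \<mu>' p) j)
        (slot (subtree t' p) j)"
    and w: "walk \<Psi> \<mu> p = walk \<Psi> \<mu>' p'"
    using runs.prems(5)
  proof cases
    case cycle
    then show ?thesis using \<open>3 \<le> k\<close> by simp
  next
    case (runs \<mu>' q q')
    \<comment> \<open>Inversion brings its own paths; they coincide with the given ones because they
      are written into the code.\<close>
    have "q = p" "q' = p'" using runs(1,2) path_code_inj by auto
    then show ?thesis using that[of \<mu>'] runs by simp
  qed
  have ow: "ordered_facet \<Phi> (walk \<Phi> \<nu> q)" if "ordered_facet \<Phi> \<nu>" "q \<in> addr k u" for \<nu> q u
    using walk_ordered[OF P that(1)] that(2) by (auto simp: addr_def)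
  have ow': "ordered_facet \<Psi> (walk \<Psi> \<nu> q)" if "ordered_facet \<Psi> \<nu>" "q \<in> addr k u" for \<nu> q u
    using walk_ordered[OF Q that(1)] that(2) by (auto simp: addr_def)
  have slots: "\<exists>\<psi>. mor (link \<Phi> (sel k (walk \<Phi> \<kappa> q) j)) (link \<Psi> (sel k (walk \<Psi> \<mu> q) j)) \<psi> \<and>
      map \<psi> (rest k (walk \<Phi> \<kappa> q) j) = rest k (walk \<Psi> \<mu> q) j"
    if q: "q \<in> addr k t" "j < 2 ^ k" "slot (subtree t q) j \<noteq> leaf" for q j
  proof -
    note a = sel_subset[OF P ow[OF o(1) q(1)] q(2)] and b = sel_subset[OF Q ow'[OF o(2) q(1)] q(2)]
    show ?thesis
      by (rule runs.IH(1)[OF q]) (use npm_link[OF P] npm_link[OF Q] a b cod[OF q] in metis)+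
  qed
  have slots': "\<exists>\<psi>. mor (link \<Phi> (sel k (walk \<Phi> \<kappa>' q) j)) (link \<Psi> (sel k (walk \<Psi> \<mu>' q) j)) \<psi> \<and>
      map \<psi> (rest k (walk \<Phi> \<kappa>' q) j) = rest k (walk \<Psi> \<mu>' q) j"
    if q: "q \<in> addr k t'" "j < 2 ^ k" "slot (subtree t' q) j \<noteq> leaf" for q j
  proof -
    note a = sel_subset[OF P ow[OF runs.hyps(2) q(1)] q(2)] and b = sel_subset[OF Q ow'[OF \<mu>' q(1)] q(2)]
    show ?thesis
      by (rule runs.IH(2)[OF q]) (use npm_link[OF P] npm_link[OF Q] a b cod'[OF q] in metis)+
  qed
  let ?U = "node \<Phi> \<kappa> ` addr k t" and ?U' = "node \<Phi> \<kappa>' ` addr k t'"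
  obtain L where L1: "\<And>p. p \<in> addr k t \<Longrightarrow> map (L (node \<Phi> \<kappa> p)) (walk \<Phi> \<kappa> p) = walk \<Psi> \<mu> p"
    and L2: "\<And>F. F \<in> ?U \<Longrightarrow> inj_on (L F) F \<and> L F ` F \<in> \<Psi>"
    and L3: "\<And>F G. known k \<Phi> \<kappa> t F G \<Longrightarrow> F \<in> ?U \<and> G \<in> ?U \<and>
       (\<forall>v\<in>F \<inter> G. L F v = L G v) \<and> L F ` F \<noteq> L G ` G"
    by (rule run_maps[OF P Q o runs.hyps(3) slots]) (assumption+, rule that, assumption+)
  obtain L' where L1': "\<And>p. p \<in> addr k t' \<Longrightarrow> map (L' (node \<Phi> \<kappa>' p)) (walk \<Phi> \<kappa>' p) = walk \<Psi> \<mu>' p"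
    and L2': "\<And>F. F \<in> ?U' \<Longrightarrow> inj_on (L' F) F \<and> L' F ` F \<in> \<Psi>"
    and L3': "\<And>F G. known k \<Phi> \<kappa>' t' F G \<Longrightarrow> F \<in> ?U' \<and> G \<in> ?U' \<and>
       (\<forall>v\<in>F \<inter> G. L' F v = L' G v) \<and> L' F ` F \<noteq> L' G ` G"
    by (rule run_maps[OF P Q runs.hyps(2) \<mu>' runs.hyps(4) slots']) (assumption+, rule that, assumption+)
  have pp': "p \<in> addr k t" "p' \<in> addr k t'" "walk \<Phi> \<kappa> p = walk \<Phi> \<kappa>' p'"
    using runs.hyps by auto
  \<comment> \<open>A facet shared by both runs must receive the same bijection from each. At the
    recorded facet this holds since, in either complex, it carries the same ordering in both runs;
    from there agreement spreads over the gluings known to both.\<close>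
  have agree: "\<forall>v\<in>F. L F v = L' F v" if F: "F \<in> ?U" "F \<in> ?U'" for F
  proof -
    have "(\<lambda>X Y. adj X Y \<and> known k \<Phi> \<kappa> t X Y \<and> known k \<Phi> \<kappa>' t' X Y)\<^sup>*\<^sup>* (node \<Phi> \<kappa> p) G \<Longrightarrow>
      \<forall>v\<in>G. L G v = L' G v" for G
    proof (induction rule: rtranclp_induct)
      case base
      have "node \<Phi> \<kappa> p = node \<Phi> \<kappa>' p'" using pp' by (simp add: node_def)
      then have "map (L (node \<Phi> \<kappa> p)) (walk \<Phi> \<kappa> p) = map (L' (node \<Phi> \<kappa> p)) (walk \<Phi> \<kappa> p)"
        using L1[OF pp'(1)] L1'[OF pp'(2)] w pp'(3) by simp
      then show ?case by (simp add: node_def)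
    next
      case (step X Y)
      then have XY: "adj X Y" and k1: "known k \<Phi> \<kappa> t X Y" and k2: "known k \<Phi> \<kappa>' t' X Y" by auto
      note l = L3[OF k1] and l' = L3'[OF k2]
      have "L' X ` X = L X ` X" using step.IH by (auto intro!: image_cong)
      have XU: "X \<in> ?U" "Y \<in> ?U" "Y \<in> ?U'" using l l' by auto
      show ?case
      proof
        fix v assume v: "v \<in> Y"
        show "L Y v = L' Y v"
        proof (rule mor_propagate[OF Q XY, where f = "L X" and g = "L Y" and h = "L' Y"])
          show "L X ` X \<noteq> L' Y ` Y" using l' \<open>L' X ` X = L X ` X\<close> by simp
          show "L' Y u = L X u" if "u \<in> X \<inter> Y" for u
            using l' step.IH that by simp
          show "L Y u = L X u" if "u \<in> X \<inter> Y" for u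
            using l that by simp
        qed (use L2[OF XU(1)] L2[OF XU(2)] L2'[OF XU(3)] l v in simp_all)
      qed
    qed
    then show ?thesis using runs.hyps(12)[OF F] by blast
  qed
  define M where "M F = (if F \<in> ?U then L F else L' F)" for F
  have M: "\<forall>v\<in>F. M F v = L F v" if "F \<in> ?U" for F using that by (simp add: M_def)
  have M': "\<forall>v\<in>F. M F v = L' F v" if "F \<in> ?U'" for F
    using that agree[of F] by (auto simp: M_def)
  have img: "M F ` F = L F ` F" if "F \<in> ?U" for F using M[OF that] by (auto intro: image_cong)
  have img': "M F ` F = L' F ` F" if "F \<in> ?U'" for F using M'[OF that] by (auto intro: image_cong)
  have MF: "inj_on (M F) F \<and> M F ` F \<in> \<Psi>" if "F \<in> \<Phi>" for F
  proof (cases "F \<in> ?U")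
    case True
    then show ?thesis using L2[OF True] M[OF True] img[OF True] by (simp add: inj_on_def)
  next
    case False
    then have "F \<in> ?U'" using runs.hyps(7)[OF that] by blast
    then show ?thesis using L2'[of F] M'[of F] img'[of F] by (simp add: inj_on_def)
  qed
  have adj: "(\<forall>v\<in>F \<inter> G. M F v = M G v) \<and> M F ` F \<noteq> M G ` G"
    if "F \<in> \<Phi>" "G \<in> \<Phi>" "adj F G" for F G
    using runs.hyps(8)[OF that]
  proof
    assume "known k \<Phi> \<kappa> t F G"
    note l = L3[OF this]
    then show ?thesis using M[of F] M[of G] img[of F] img[of G] by simp
  next
    assume "known k \<Phi> \<kappa>' t' F G"
    note l = L3'[OF this]
    then show ?thesis using M'[of F] M'[of G] img'[of F] img'[of G] by simp
  qed
  have "1 \<le> k" using runs.hyps(1) by simp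
  obtain f where f: "mor \<Phi> \<Psi> f" "\<And>F v. F \<in> \<Phi> \<Longrightarrow> v \<in> F \<Longrightarrow> f v = M F v"
    by (rule mor_glue[OF P \<open>1 \<le> k\<close> MF adj]) (assumption+, rule that, assumption+)
  have nil: "[] \<in> addr k t" using addr_Nil[OF pp'(1)] .
  then have "set \<kappa> \<in> ?U" by (force simp: node_def)
  moreover have "map (L (set \<kappa>)) \<kappa> = \<mu>" using L1[OF nil] by (simp add: node_def)
  moreover have "map f \<kappa> = map (M (set \<kappa>)) \<kappa>"
    using f(2)[of "set \<kappa>"] o(1) by (simp add: ordered_facet_def)
  ultimately have "map f \<kappa> = \<mu>" using M[of "set \<kappa>"] by (metis map_cong)
  then show ?case using f(1) by blast
qed

section \<open>Rigidity of morphisms\<close>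

text \<open>\<open>mor_propagate\<close> compares the endomorphism with the identity across each
  ridge of a path from \<open>F\<close> to \<open>G\<close>.\<close>

lemma mor_rigid:
  assumes P: "npm k \<Phi>" and h: "mor \<Phi> \<Phi> h" and F: "F \<in> \<Phi>" "\<And>v. v \<in> F \<Longrightarrow> h v = v"
    and G: "G \<in> \<Phi>" "v \<in> G"
  shows "h v = v"
proof -
  have "(\<lambda>X Y. adj X Y \<and> Y \<in> \<Phi> \<and> F \<inter> G \<subseteq> Y)\<^sup>*\<^sup>* F H \<Longrightarrow> H \<in> \<Phi> \<and> (\<forall>v\<in>H. h v = v)" for H
  proof (induction rule: rtranclp_induct)
    case base
    then show ?case using F by simp
  next
    case (step X Y)
    then have XY: "X \<in> \<Phi>" "Y \<in> \<Phi>" "adj X Y" and hX: "\<And>v. v \<in> X \<Longrightarrow> h v = v" by auto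
    have "h ` X = X" using hX by force
    have "h ` X \<noteq> h ` Y" using h XY by (auto simp: mor_def)
    have "X \<noteq> Y" using XY(3) by (auto simp: adj_def)
    have "h v = id v" if "v \<in> Y" for v
    proof (rule mor_propagate[OF P XY(3), where f = id and g = h and h = id])
      show "h ` Y \<in> \<Phi>" "inj_on h Y" using h XY by (auto simp: mor_def)
      show "id ` X \<noteq> h ` Y" using \<open>h ` X \<noteq> h ` Y\<close> unfolding \<open>h ` X = X\<close> by simp
      show "h u = id u" if "u \<in> X \<inter> Y" for u using hX that by simp
    qed (use XY \<open>X \<noteq> Y\<close> that in simp_all)
    then show ?case using XY by simp
  qed
  from this[OF npm_connected[OF P F(1) G(1)]] G show ?thesis by blast
qed

text \<open>The non-folding condition of \<open>g\<close> speaks of adjacent facets only. The point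
  is therefore that \<open>f\<close> sends adjacent facets to adjacent ones: their images are
  distinct, of equal size, and share the image of the ridge.\<close>

lemma mor_comp:
  assumes P: "npm k \<Phi>" and Q: "npm k \<Psi>" and f: "mor \<Phi> \<Psi> f" and g: "mor \<Psi> X g"
  shows "mor \<Phi> X (g \<circ> f)"
  unfolding mor_def
proof (intro conjI ballI impI)
  fix F assume F: "F \<in> \<Phi>"
  then have fF: "f ` F \<in> \<Psi>" "inj_on f F" using f by (auto simp: mor_def)
  then show "(g \<circ> f) ` F \<in> X" "inj_on (g \<circ> f) F"
    using g unfolding image_comp[symmetric] by (auto simp: mor_def intro: comp_inj_on)
  fix G assume G: "G \<in> \<Phi>" "adj F G"
  then have fG: "f ` G \<in> \<Psi>" "inj_on f G" "f ` F \<noteq> f ` G" using f F by (auto simp: mor_def)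
  obtain v w where vw: "v \<in> F" "w \<notin> F" "w \<in> G" "G = insert w (F \<inter> G)" "F = insert v (F \<inter> G)" "v \<notin> G"
    using adjE[OF G(2)] by metis
  have fGe: "f ` G = insert (f w) (f ` (F \<inter> G))"
    using vw(4) image_insert by metis
  have "F \<inter> G = F - {v}" using vw by blast
  then have fI: "f ` (F \<inter> G) = f ` F - {f v}"
    using inj_on_image_set_diff[OF fF(2), of F "{v}"] vw(1) by simp
  have "f w \<notin> f ` F"
  proof
    assume "f w \<in> f ` F"
    then have "f ` G \<subseteq> f ` F" unfolding fGe by auto
    moreover have "card (f ` G) = card (f ` F)" "finite (f ` F)"
      using npm_facet[OF Q fG(1)] npm_facet[OF Q fF(1)] by auto
    ultimately show False using fG(3) card_subset_eq by metis
  qed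
  then have "adj (f ` F) (f ` G)" unfolding fGe fI using vw(1) by (intro adjI) auto
  then show "(g \<circ> f) ` F \<noteq> (g \<circ> f) ` G"
    using g fF fG unfolding image_comp[symmetric] by (auto simp: mor_def)
qed

text \<open>The composites of the morphisms in the two directions fix the root facets pointwise,
  hence are identities by rigidity.\<close>

lemma coded_iso:
  fixes \<Phi> :: "'v set set" and \<Psi> :: "'w set set"
  assumes P: "npm k \<Phi>" and Q: "npm k \<Psi>"
    and o: "ordered_facet \<Phi> \<kappa>" "ordered_facet \<Psi> \<mu>" and c: "coded k \<Phi> \<kappa> t" "coded k \<Psi> \<mu> t"
  obtains f where "bij_betw f (\<Union>\<Phi>) (\<Union>\<Psi>)" "\<Psi> = (`) f ` \<Phi>"
proof -
  obtain f where f: "mor \<Phi> \<Psi> f" "map f \<kappa> = \<mu>"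
    using coded_mor[OF c(1) P Q o c(2)] by blast
  obtain g where g: "mor \<Psi> \<Phi> g" "map g \<mu> = \<kappa>"
    using coded_mor[OF c(2) Q P o(2,1) c(1)] by blast
  have "map (g \<circ> f) \<kappa> = map id \<kappa>" "map (f \<circ> g) \<mu> = map id \<mu>"
    using f(2) g(2) by (auto simp flip: map_map)
  then have gf0: "\<And>v. v \<in> set \<kappa> \<Longrightarrow> (g \<circ> f) v = v" and fg0: "\<And>v. v \<in> set \<mu> \<Longrightarrow> (f \<circ> g) v = v"
    by (auto simp only: map_eq_conv id_apply)
  have gf: "g (f v) = v" if "v \<in> F" "F \<in> \<Phi>" for v F
    using mor_rigid[OF P mor_comp[OF P Q f(1) g(1)], of "set \<kappa>" F v] gf0 that o
    by (simp add: ordered_facet_def)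
  have fg: "f (g v) = v" if "v \<in> F" "F \<in> \<Psi>" for v F
    using mor_rigid[OF Q mor_comp[OF Q P g(1) f(1)], of "set \<mu>" F v] fg0 that o
    by (simp add: ordered_facet_def)
  have fF: "f ` F \<in> \<Psi>" if "F \<in> \<Phi>" for F using f(1) that by (auto simp: mor_def)
  have gF: "g ` F \<in> \<Phi>" if "F \<in> \<Psi>" for F using g(1) that by (auto simp: mor_def)
  have "bij_betw f (\<Union>\<Phi>) (\<Union>\<Psi>)"
    by (rule bij_betw_byWitness[where f' = g]) (use gf fg fF gF in blast)+
  moreover have "\<Psi> = (`) f ` \<Phi>"
  proof (intro subset_antisym subsetI)
    fix G assume G: "G \<in> \<Psi>"
    have "G = f ` g ` G" using fg[OF _ G] by force
    then show "G \<in> (`) f ` \<Phi>" using gF[OF G] by blast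
  qed (use fF in blast)
  ultimately show thesis by (rule that)
qed

section \<open>Complete simplicial fans\<close>

text \<open>Rays are indexed by abstract vertices: in a link the rays are replaced by projections,
  while the vertices and with them the combinatorics stay.\<close>

definition pc :: "('v \<Rightarrow> 'a::real_vector) \<Rightarrow> 'v set \<Rightarrow> 'a set"
  where "pc r A = {x. \<exists>c. (\<forall>v\<in>A. 0 \<le> c v) \<and> x = (\<Sum>v\<in>A. c v *\<^sub>R r v)}"

text \<open>A complete simplicial fan in the subspace \<open>L\<close> with rays \<open>r v\<close>; \<open>\<Phi>\<close> is the set of vertex sets of
  its maximal cones.\<close>

definition fan :: "nat \<Rightarrow> 'a::euclidean_space set \<Rightarrow> 'v set set \<Rightarrow> ('v \<Rightarrow> 'a) \<Rightarrow> bool"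
  where "fan k L \<Phi> r \<longleftrightarrow> subspace L \<and> dim L = k \<and> finite \<Phi> \<and>
    (\<forall>F\<in>\<Phi>. finite F \<and> card F = k \<and> r ` F \<subseteq> L \<and>
      (\<forall>c. (\<Sum>v\<in>F. c v *\<^sub>R r v) = 0 \<longrightarrow> (\<forall>v\<in>F. c v = 0))) \<and>
    L \<subseteq> (\<Union>F\<in>\<Phi>. pc r F) \<and>
    (\<forall>F\<in>\<Phi>. \<forall>G\<in>\<Phi>. pc r F \<inter> pc r G \<subseteq> pc r (F \<inter> G))"

lemma pcI: "(\<And>v. v \<in> A \<Longrightarrow> 0 \<le> c v) \<Longrightarrow> (\<Sum>v\<in>A. c v *\<^sub>R r v) \<in> pc r A"
  unfolding pc_def by blast

lemma pcE:
  assumes "x \<in> pc r A"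
  obtains c where "\<And>v. v \<in> A \<Longrightarrow> 0 \<le> c v" "x = (\<Sum>v\<in>A. c v *\<^sub>R r v)"
  using assms unfolding pc_def by blast

lemma pc_0: "0 \<in> pc r A"
  using pcI[of A "\<lambda>_. 0" r] by simp

lemma pc_add: "x \<in> pc r A \<Longrightarrow> y \<in> pc r A \<Longrightarrow> x + y \<in> pc r A"
proof (elim pcE)
  fix c d assume *: "\<And>v. v \<in> A \<Longrightarrow> 0 \<le> c v" "x = (\<Sum>v\<in>A. c v *\<^sub>R r v)"
    "\<And>v. v \<in> A \<Longrightarrow> 0 \<le> d v" "y = (\<Sum>v\<in>A. d v *\<^sub>R r v)"
  then have "x + y = (\<Sum>v\<in>A. (c v + d v) *\<^sub>R r v)" by (simp add: scaleR_add_left sum.distrib)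
  also have "\<dots> \<in> pc r A" by (rule pcI) (use * in auto)
  finally show ?thesis .
qed

lemma pc_scale: "x \<in> pc r A \<Longrightarrow> 0 \<le> a \<Longrightarrow> a *\<^sub>R x \<in> pc r A"
proof (elim pcE)
  fix c assume *: "0 \<le> a" "\<And>v. v \<in> A \<Longrightarrow> 0 \<le> c v" "x = (\<Sum>v\<in>A. c v *\<^sub>R r v)"
  then have "a *\<^sub>R x = (\<Sum>v\<in>A. (a * c v) *\<^sub>R r v)" by (simp add: scaleR_sum_right)
  also have "\<dots> \<in> pc r A" by (rule pcI) (use * in auto)
  finally show ?thesis .
qed

lemma pc_mono: "finite B \<Longrightarrow> A \<subseteq> B \<Longrightarrow> pc r A \<subseteq> pc r B"
proof
  fix x assume *: "finite B" "A \<subseteq> B" and "x \<in> pc r A"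
  then obtain c where c: "\<And>v. v \<in> A \<Longrightarrow> 0 \<le> c v" "x = (\<Sum>v\<in>A. c v *\<^sub>R r v)" unfolding pc_def by blast
  have "x = (\<Sum>v\<in>B. (if v \<in> A then c v else 0) *\<^sub>R r v)"
    unfolding c(2) using * by (intro sum.mono_neutral_cong_left) auto
  also have "\<dots> \<in> pc r B" by (rule pcI) (use c in auto)
  finally show "x \<in> pc r B" .
qed

lemma pc_gen: "finite A \<Longrightarrow> v \<in> A \<Longrightarrow> r v \<in> pc r A"
proof -
  assume *: "finite A" "v \<in> A"
  have "r v = (\<Sum>u\<in>{v}. 1 *\<^sub>R r u)" by simp
  then have "r v \<in> pc r {v}" using pcI[of "{v}" "\<lambda>_. 1" r] by simp
  then show ?thesis using pc_mono[of A "{v}" r] * by auto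
qed

text \<open>Gives access to the closedness and convexity of finitely generated cones.\<close>

lemma pc_eq_hull:
  fixes r :: "'v \<Rightarrow> 'a::euclidean_space"
  assumes "finite A"
  shows "pc r A = convex_cone hull (r ` A)"
proof
  have "(\<Sum>v\<in>B. c v *\<^sub>R r v) \<in> convex_cone hull (r ` A)"
    if "finite B" "B \<subseteq> A" "\<And>v. v \<in> A \<Longrightarrow> 0 \<le> c v" for c B
    using that
  proof (induction B rule: finite_induct)
    case empty
    then show ?case by (simp add: convex_cone_hull_contains_0)
  next
    case (insert v B)
    then have "c v *\<^sub>R r v \<in> convex_cone hull (r ` A)"
      by (intro convex_cone_hull_mul hull_inc) auto
    then show ?case using insert by (simp add: convex_cone_hull_add)
  qed
  then show "pc r A \<subseteq> convex_cone hull (r ` A)"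
    using assms by (auto simp: pc_def)
  have "convex_cone (pc r A)"
    unfolding convex_cone_iff using pc_0 pc_add pc_scale by blast
  then show "convex_cone hull (r ` A) \<subseteq> pc r A"
    using pc_gen[OF assms] by (intro hull_minimal) auto
qed

lemma pc_closed: "finite A \<Longrightarrow> closed (pc (r :: 'v \<Rightarrow> 'a::euclidean_space) A)"
  by (simp add: pc_eq_hull closed_convex_cone_hull)

lemma pc_convex: "finite A \<Longrightarrow> convex (pc (r :: 'v \<Rightarrow> 'a::euclidean_space) A)"
  by (simp add: pc_eq_hull convex_convex_cone_hull)

context
  fixes k :: nat and L :: "'a::euclidean_space set" and \<Phi> :: "'v set set" and r :: "'v \<Rightarrow> 'a"
  assumes fan: "fan k L \<Phi> r"
begin

lemma fan_subspace: "subspace L" and fan_dim: "dim L = k" and fan_finite: "finite \<Phi>"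
  using fan by (auto simp: fan_def)

lemma fan_facet: "F \<in> \<Phi> \<Longrightarrow> finite F \<and> card F = k"
  using fan by (auto simp: fan_def)

lemma fan_mem: "F \<in> \<Phi> \<Longrightarrow> v \<in> F \<Longrightarrow> r v \<in> L"
  using fan by (auto simp: fan_def)

lemma fan_indep: "F \<in> \<Phi> \<Longrightarrow> (\<Sum>v\<in>F. c v *\<^sub>R r v) = 0 \<Longrightarrow> v \<in> F \<Longrightarrow> c v = 0"
  using fan unfolding fan_def by blast

lemma fan_cover: "x \<in> L \<Longrightarrow> \<exists>F\<in>\<Phi>. x \<in> pc r F"
proof -
  assume "x \<in> L"
  moreover have "L \<subseteq> (\<Union>F\<in>\<Phi>. pc r F)" using fan by (simp add: fan_def)
  ultimately show ?thesis by blast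
qed

lemma fan_Int: "F \<in> \<Phi> \<Longrightarrow> G \<in> \<Phi> \<Longrightarrow> x \<in> pc r F \<Longrightarrow> x \<in> pc r G \<Longrightarrow> x \<in> pc r (F \<inter> G)"
proof -
  assume *: "F \<in> \<Phi>" "G \<in> \<Phi>" "x \<in> pc r F" "x \<in> pc r G"
  have "\<forall>F\<in>\<Phi>. \<forall>G\<in>\<Phi>. pc r F \<inter> pc r G \<subseteq> pc r (F \<inter> G)" using fan by (simp add: fan_def)
  then have "pc r F \<inter> pc r G \<subseteq> pc r (F \<inter> G)" using * by simp
  from subsetD[OF this, of x] show ?thesis using * by simp
qed

lemma fan_nonempty: "\<Phi> \<noteq> {}"
  using fan_cover[OF subspace_0[OF fan_subspace]] by blast

lemma fan_coef_eq:
  assumes "F \<in> \<Phi>" "(\<Sum>v\<in>F. c v *\<^sub>R r v) = (\<Sum>v\<in>F. d v *\<^sub>R r v)" "v \<in> F"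
  shows "c v = d v"
proof -
  have "(\<Sum>v\<in>F. (c v - d v) *\<^sub>R r v) = 0"
    using assms(2) by (simp add: scaleR_diff_left sum_subtractf)
  from fan_indep[OF assms(1) this assms(3)] show ?thesis by simp
qed

lemma pc_subset_L: "F \<in> \<Phi> \<Longrightarrow> A \<subseteq> F \<Longrightarrow> pc r A \<subseteq> L"
  using fan_mem fan_subspace by (auto elim!: pcE intro!: subspace_sum subspace_scale)

text \<open>Coefficients over a facet are unique. The point also has a representation over the
  common face of \<open>F\<close> and \<open>G\<close>, and comparing it inside \<open>F\<close> and
  inside \<open>G\<close> forces the support into \<open>B\<close>. In particular, a cone with a
  relative interior point in another cone is a face of that cone.\<close>

lemma fan_support:
  assumes F: "F \<in> \<Phi>" "A \<subseteq> F" and G: "G \<in> \<Phi>" "B \<subseteq> G"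
    and c: "\<And>v. v \<in> A \<Longrightarrow> 0 \<le> c v" and x: "(\<Sum>v\<in>A. c v *\<^sub>R r v) \<in> pc r B"
    and v: "v \<in> A" "0 < c v"
  shows "v \<in> B"
proof -
  have fin: "finite F" "finite G" using fan_facet F G by auto
  let ?x = "\<Sum>v\<in>A. c v *\<^sub>R r v"
  have "?x \<in> pc r F" using pc_mono[OF fin(1) F(2)] pcI[of A c r] c by blast
  moreover have "?x \<in> pc r G" using pc_mono[OF fin(2) G(2)] x by blast
  ultimately have "?x \<in> pc r (F \<inter> G)" using fan_Int F G by blast
  then obtain e where e: "?x = (\<Sum>v\<in>F \<inter> G. e v *\<^sub>R r v)" unfolding pc_def by blast
  obtain d where d: "?x = (\<Sum>v\<in>B. d v *\<^sub>R r v)" using x unfolding pc_def by blast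
  have 1: "?x = (\<Sum>v\<in>F. (if v \<in> A then c v else 0) *\<^sub>R r v)"
    using F fin by (intro sum.mono_neutral_cong_left) auto
  have 2: "?x = (\<Sum>v\<in>F. (if v \<in> F \<inter> G then e v else 0) *\<^sub>R r v)"
    unfolding e using fin by (intro sum.mono_neutral_cong_left) auto
  have 3: "?x = (\<Sum>v\<in>G. (if v \<in> F \<inter> G then e v else 0) *\<^sub>R r v)"
    unfolding e using fin by (intro sum.mono_neutral_cong_left) auto
  have 4: "?x = (\<Sum>v\<in>G. (if v \<in> B then d v else 0) *\<^sub>R r v)"
    unfolding d using G fin by (intro sum.mono_neutral_cong_left) auto
  have vF: "v \<in> F" using v F by blast
  have "(if v \<in> A then c v else 0) = (if v \<in> F \<inter> G then e v else 0)"
    by (rule fan_coef_eq[OF F(1) trans[OF 1[symmetric] 2] vF])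
  then have "v \<in> G" "e v = c v" using v by (auto split: if_splits)
  moreover have "(if v \<in> F \<inter> G then e v else 0) = (if v \<in> B then d v else 0)"
    by (rule fan_coef_eq[OF G(1) trans[OF 3[symmetric] 4] \<open>v \<in> G\<close>])
  ultimately show ?thesis using v vF by (auto split: if_splits)
qed

text \<open>The cones of the facets not containing \<open>A\<close> are finitely many closed sets,
  and they miss the given relative interior point.\<close>

lemma fan_near:
  assumes F: "F \<in> \<Phi>" "A \<subseteq> F" and c: "\<And>v. v \<in> A \<Longrightarrow> 0 < c v"
  obtains e where "0 < e"
    "\<And>y. y \<in> L \<Longrightarrow> dist (\<Sum>v\<in>A. c v *\<^sub>R r v) y < e \<Longrightarrow> \<exists>G\<in>\<Phi>. A \<subseteq> G \<and> y \<in> pc r G"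
proof -
  let ?x = "\<Sum>v\<in>A. c v *\<^sub>R r v" and ?N = "\<Union>G\<in>{G \<in> \<Phi>. \<not> A \<subseteq> G}. pc r G"
  have "closed ?N"
    using fan_facet fan_finite pc_closed by (intro closed_UN) auto
  then have "open (- ?N)" by (rule open_Compl)
  moreover have "?x \<in> - ?N"
    using fan_support[OF F, where c = c] c by (fastforce simp: less_imp_le)
  ultimately obtain e where e: "0 < e" "ball ?x e \<subseteq> - ?N"
    by (rule openE)
  show thesis
  proof (rule that[OF e(1)])
    fix y assume "y \<in> L" "dist ?x y < e"
    moreover obtain G where "G \<in> \<Phi>" "y \<in> pc r G" using fan_cover[OF \<open>y \<in> L\<close>] by blast
    ultimately show "\<exists>G\<in>\<Phi>. A \<subseteq> G \<and> y \<in> pc r G" using e(2) by (auto simp: subset_iff)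
  qed
qed

lemma fan_dim_span: "F \<in> \<Phi> \<Longrightarrow> A \<subseteq> F \<Longrightarrow> dim (span (r ` A)) = card A"
proof -
  assume F: "F \<in> \<Phi>" "A \<subseteq> F"
  then have fin: "finite F" "finite A" using fan_facet finite_subset by blast+
  have inj: "inj_on r A"
  proof (rule inj_onI, rule ccontr)
    fix u v assume uv: "u \<in> A" "v \<in> A" "r u = r v" "u \<noteq> v"
    define c where "c w = (if w = u then 1 else if w = v then -1 else 0 :: real)" for w
    have "(\<Sum>w\<in>F. c w *\<^sub>R r w) = (\<Sum>w\<in>{u, v}. c w *\<^sub>R r w)"
      using uv F fin by (intro sum.mono_neutral_right) (auto simp: c_def)
    also have "\<dots> = 0" using uv by (simp add: c_def)
    finally have "c u = 0" using fan_indep[OF F(1)] uv F by blast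
    then show False by (simp add: c_def)
  qed
  have "independent (r ` A)"
  proof (rule independent_if_scalars_zero)
    show "finite (r ` A)" using fin by simp
    fix f x assume *: "(\<Sum>x\<in>r ` A. f x *\<^sub>R x) = 0" "x \<in> r ` A"
    have "(\<Sum>v\<in>F. (if v \<in> A then f (r v) else 0) *\<^sub>R r v) = (\<Sum>v\<in>A. f (r v) *\<^sub>R r v)"
      using F fin by (intro sum.mono_neutral_cong_right) auto
    also have "\<dots> = 0" using *(1) sum.reindex[OF inj, of "\<lambda>x. f x *\<^sub>R x"] by (simp add: comp_def)
    finally have "(\<Sum>v\<in>F. (if v \<in> A then f (r v) else 0) *\<^sub>R r v) = 0" .
    moreover obtain v where v: "v \<in> A" "x = r v" using *(2) by blast
    ultimately show "f x = 0" using fan_indep[OF F(1), of "\<lambda>v. if v \<in> A then f (r v) else 0" v] F by auto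
  qed
  then show ?thesis using dim_span_eq_card_independent card_image[OF inj] by metis
qed

end

section \<open>Paths in general position\<close>

text \<open>The conditions are met one at a time: along the line through \<open>y\<close> in
  direction \<open>b\<close> each of the linear forms vanishes for at most one parameter, so some
  small parameter avoids all zeros.\<close>

lemma generic_vector:
  fixes W :: "'a::euclidean_space set"
  assumes "finite U" "subspace W" "\<And>u. u \<in> U \<Longrightarrow> \<exists>b\<in>W. u \<bullet> b \<noteq> 0" "x \<in> W" "0 < e"
  shows "\<exists>y\<in>W. dist x y < e \<and> (\<forall>u\<in>U. u \<bullet> y \<noteq> 0)"
  using assms(1,3,5)
proof (induction U arbitrary: e rule: finite_induct)
  case empty
  then show ?case using assms(4) by (auto intro: bexI[of _ x])
next
  case (insert u U)
  obtain y where y: "y \<in> W" "dist x y < e / 2" "\<forall>u\<in>U. u \<bullet> y \<noteq> 0"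
    using insert.IH[of "e / 2"] insert.prems by auto
  obtain b where b: "b \<in> W" "u \<bullet> b \<noteq> 0" using insert.prems(1)[of u] by auto
  have fin: "finite {t. w \<bullet> (y + t *\<^sub>R b) = 0}" if "w \<in> insert u U" for w
  proof (cases "w \<bullet> b = 0")
    case True
    then have "w \<in> U" using that b by auto
    then show ?thesis using True y(3) by (simp add: inner_add_right)
  next
    case False
    have "{t. w \<bullet> (y + t *\<^sub>R b) = 0} \<subseteq> {- (w \<bullet> y) / (w \<bullet> b)}"
      using False by (auto simp: inner_add_right field_simps)
    then show ?thesis using finite_subset by blast
  qed
  have "norm b \<noteq> 0" using b by auto
  then have pos: "0 < e / (2 * norm b)" using insert.prems(2) by simp
  have "finite (\<Union>w\<in>insert u U. {t. w \<bullet> (y + t *\<^sub>R b) = 0})"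
    using fin insert.hyps by (intro finite_UN_I) auto
  moreover have "infinite {0<..<e / (2 * norm b)}"
    using pos by (simp add: infinite_Ioo)
  ultimately obtain t where t: "t \<in> {0<..<e / (2 * norm b)}"
    "t \<notin> (\<Union>w\<in>insert u U. {t. w \<bullet> (y + t *\<^sub>R b) = 0})"
    by (meson finite_subset subsetI)
  have "norm (t *\<^sub>R b) < e / 2"
    using t(1) \<open>norm b \<noteq> 0\<close> by (simp add: field_simps)
  then have "dist x (y + t *\<^sub>R b) < e"
    using y(2) dist_triangle[of x "y + t *\<^sub>R b" y] by (simp add: dist_norm)
  moreover have "y + t *\<^sub>R b \<in> W"
    using y b assms(2) by (simp add: subspace_add subspace_scale)
  ultimately show ?case using t(2) by auto
qed

text \<open>Two points of a convex set are joined by a segment which, after a small perturbation of its end,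
  avoids the cones of codimension at least two and therefore crosses from facet to facet.\<close>

lemma facet_path:
  fixes L :: "'a::euclidean_space set" and r :: "'v \<Rightarrow> 'a"
  assumes fan: "fan k L \<Phi> r" and k: "2 \<le> k" and W: "subspace W" "W \<subseteq> L" and C: "C \<subseteq> W" "convex C"
    and F: "F \<in> \<Phi>" "\<And>v. v \<in> F \<Longrightarrow> 0 < c v" "(\<Sum>v\<in>F. c v *\<^sub>R r v) \<in> C"
    and G: "G \<in> \<Phi>" "\<And>v. v \<in> G \<Longrightarrow> 0 < d v" "(\<Sum>v\<in>G. d v *\<^sub>R r v) \<in> C"
    and nbh: "0 < e" "\<And>y. y \<in> W \<Longrightarrow> dist (\<Sum>v\<in>G. d v *\<^sub>R r v) y < e \<Longrightarrow> y \<in> C"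
    and thin: "\<And>H \<tau>. H \<in> \<Phi> \<Longrightarrow> \<tau> \<subseteq> H \<Longrightarrow> card \<tau> + 2 \<le> k \<Longrightarrow>
      \<exists>u\<in>W. u \<noteq> 0 \<and> u \<bullet> (\<Sum>v\<in>F. c v *\<^sub>R r v) = 0 \<and> (\<forall>z\<in>W \<inter> pc r \<tau>. u \<bullet> z = 0)"
  shows "(\<lambda>X Y. adj X Y \<and> Y \<in> \<Phi> \<and> (\<exists>z\<in>C. z \<noteq> 0 \<and> z \<in> pc r (X \<inter> Y)))\<^sup>*\<^sup>* F G"
proof -
  define x where "x = (\<Sum>v\<in>F. c v *\<^sub>R r v)"
  define x' where "x' = (\<Sum>v\<in>G. d v *\<^sub>R r v)"
  let ?R = "\<lambda>X Y. adj X Y \<and> Y \<in> \<Phi> \<and> (\<exists>z\<in>C. z \<noteq> 0 \<and> z \<in> pc r (X \<inter> Y))"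
  define T where "T = {\<tau>. card \<tau> + 2 \<le> k \<and> (\<exists>H\<in>\<Phi>. \<tau> \<subseteq> H)}"
  have "T \<subseteq> (\<Union>H\<in>\<Phi>. Pow H)" by (auto simp: T_def)
  then have finT: "finite T"
    by (rule finite_subset) (use fan_finite[OF fan] fan_facet[OF fan] in auto)
  \<comment> \<open>For each cone of codimension at least two, some hyperplane of \<open>W\<close>
    contains the starting point \<open>x\<close> and the part of the cone in \<open>W\<close>. An
    endpoint off all these hyperplanes makes the segment meet them in \<open>x\<close> only.\<close>
  have "\<forall>\<tau>\<in>T. \<exists>u. u \<in> W \<and> u \<noteq> 0 \<and> u \<bullet> x = 0 \<and> (\<forall>z\<in>W \<inter> pc r \<tau>. u \<bullet> z = 0)"
    using thin unfolding T_def x_def by blast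
  then obtain u where u: "\<And>\<tau>. \<tau> \<in> T \<Longrightarrow> u \<tau> \<in> W \<and> u \<tau> \<noteq> 0 \<and> u \<tau> \<bullet> x = 0 \<and> (\<forall>z\<in>W \<inter> pc r \<tau>. u \<tau> \<bullet> z = 0)"
    by metis
  obtain e' where e': "0 < e'" "\<And>y. y \<in> L \<Longrightarrow> dist x' y < e' \<Longrightarrow> \<exists>H\<in>\<Phi>. G \<subseteq> H \<and> y \<in> pc r H"
    unfolding x'_def by (rule fan_near[OF fan G(1) subset_refl, of d]) (use G(2) in auto)
  have "x' \<in> W" using G(3) C by (auto simp: x'_def)
  moreover have "\<exists>b\<in>W. w \<bullet> b \<noteq> 0" if "w \<in> u ` T" for w using that u by force
  ultimately obtain y where y: "y \<in> W" "dist x' y < min e e'" "\<forall>w\<in>u ` T. w \<bullet> y \<noteq> 0"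
    using generic_vector[of "u ` T" W x' "min e e'"] finT W(1) nbh(1) e'(1) by auto
  have yC: "y \<in> C" using nbh(2) y by (simp add: x'_def)
  obtain H where "H \<in> \<Phi>" "G \<subseteq> H" "y \<in> pc r H" using e'(2)[of y] y W by auto
  then have yG: "y \<in> pc r G"
    using fan_facet[OF fan] G(1) card_subset_eq[of H G] by auto
  have xC: "x \<in> C" using F(3) by (simp add: x_def)
  have xF: "x \<in> pc r F" unfolding x_def by (rule pcI) (use F(2) in \<open>auto intro: less_imp_le\<close>)
  have seg: "closed_segment x y \<subseteq> C" using xC yC C(2) by (simp add: closed_segment_subset)
  have avoid: False if z: "z \<in> closed_segment x y" "z \<in> pc r \<tau>" and \<tau>: "\<tau> \<in> T" for z \<tau>
  proof -
    obtain t where t: "0 \<le> t" "z = (1 - t) *\<^sub>R x + t *\<^sub>R y" using z(1) by (auto simp: in_segment)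
    have "z \<in> W" using z(1) seg C by blast
    then have "u \<tau> \<bullet> z = 0" using u[OF \<tau>] z(2) by blast
    then have "t * (u \<tau> \<bullet> y) = 0" using u[OF \<tau>] t(2) by (simp add: inner_add_right)
    then have "t = 0" using y(3) \<tau> by auto
    then have "x \<in> pc r \<tau>" using t z(2) by simp
    moreover obtain H where H: "H \<in> \<Phi>" "\<tau> \<subseteq> H" "card \<tau> + 2 \<le> k" using \<tau> by (auto simp: T_def)
    ultimately have "F \<subseteq> \<tau>"
      using fan_support[OF fan F(1) subset_refl H(1,2), where c = c] F(2) unfolding x_def
      by (meson less_imp_le subsetI)
    moreover have "finite \<tau>" using H fan_facet[OF fan] finite_subset by blast
    ultimately have "k \<le> card \<tau>" using card_mono fan_facet[OF fan F(1)] by metis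
    then show False using H(3) by simp
  qed
  \<comment> \<open>The origin is the cone of the empty face, which is among the avoided
    ones.\<close>
  have nz: "0 \<notin> closed_segment x y"
    using avoid[of 0 "{}"] pc_0 k F(1) by (auto simp: T_def)
  \<comment> \<open>Were \<open>G\<close> unreachable, the closed unions over reachable and over
    unreachable facets would cover the connected segment and hence meet on it. The face common to
    the two facets at that point is not avoided, so it is a ridge and can be crossed.\<close>
  define A where "A = {H \<in> \<Phi>. ?R\<^sup>*\<^sup>* F H}"
  let ?a = "\<Union>H\<in>A. pc r H" and ?b = "\<Union>H\<in>\<Phi> - A. pc r H"
  show "?R\<^sup>*\<^sup>* F G"
  proof (rule ccontr)
    assume "\<not> ?R\<^sup>*\<^sup>* F G"
    then have "G \<in> \<Phi> - A" using G(1) by (simp add: A_def)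
    have "closed ?a" "closed ?b"
      using fan_facet[OF fan] fan_finite[OF fan] pc_closed by (auto simp: A_def intro!: closed_UN)
    moreover have "closed_segment x y \<subseteq> ?a \<union> ?b"
    proof
      fix z assume "z \<in> closed_segment x y"
      then have "z \<in> L" using seg C W by blast
      then show "z \<in> ?a \<union> ?b" using fan_cover[OF fan] by blast
    qed
    moreover have "?a \<inter> closed_segment x y \<noteq> {}"
      using xF F(1) by (auto simp: A_def)
    moreover have "?b \<inter> closed_segment x y \<noteq> {}"
      using yG \<open>G \<in> \<Phi> - A\<close> by auto
    ultimately have "?a \<inter> ?b \<inter> closed_segment x y \<noteq> {}"
      using connected_closedD[OF connected_segment(1)[of x y], of ?a ?b] by meson
    then obtain z H H' where z: "z \<in> closed_segment x y" "H \<in> A" "H' \<in> \<Phi> - A" "z \<in> pc r H" "z \<in> pc r H'"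
      by blast
    have H: "H \<in> \<Phi>" "H' \<in> \<Phi>" "?R\<^sup>*\<^sup>* F H" "H \<noteq> H'" using z by (auto simp: A_def)
    have zI: "z \<in> pc r (H \<inter> H')" by (rule fan_Int[OF fan H(1,2) z(4,5)])
    have "H \<inter> H' \<notin> T" using avoid[OF z(1) zI] by blast
    then have "k < card (H \<inter> H') + 2" using H(1) by (auto simp: T_def)
    moreover have fH: "finite H" "card H = k" "finite H'" "card H' = k"
      using fan_facet[OF fan] H by auto
    moreover have "card (H \<inter> H') < k"
    proof -
      have "H \<inter> H' \<noteq> H" using H(4) fH card_subset_eq[of H' H] by auto
      then show ?thesis using psubset_card_mono[of H "H \<inter> H'"] fH by auto
    qed
    ultimately have "adj H H'" by (intro adj_card_Int[of H H' k]) auto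
    moreover have "z \<in> C" "z \<noteq> 0" using z(1) seg nz by auto
    ultimately have "?R H H'" using H zI by blast
    then have "?R\<^sup>*\<^sup>* F H'" using H(3) by (rule rtranclp.rtrancl_into_rtrancl[rotated])
    then show False using z(3) by (simp add: A_def)
  qed
qed

section \<open>Links of fans\<close>

lemma orth_projection:
  fixes S :: "'a::euclidean_space set"
  assumes "subspace S"
  obtains p where "linear p" "\<And>x. x - p x \<in> S" "\<And>x s. s \<in> S \<Longrightarrow> p x \<bullet> s = 0"
    "\<And>x. \<forall>s\<in>S. x \<bullet> s = 0 \<Longrightarrow> p x = x" "\<And>s. s \<in> S \<Longrightarrow> p s = 0"
proof -
  obtain B where B: "B \<subseteq> S" "pairwise orthogonal B" "\<And>x. x \<in> B \<Longrightarrow> norm x = 1"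
    "independent B" "span B = S"
    using orthonormal_basis_subspace[OF assms] by metis
  have fin: "finite B" using B(4) by (rule independent_imp_finite)
  define p where "p x = x - (\<Sum>b\<in>B. (b \<bullet> x) *\<^sub>R b)" for x
  have lin: "linear p"
    by (rule linearI)
      (simp_all add: p_def inner_add_right scaleR_add_left sum.distrib scaleR_sum_right scaleR_diff_right)
  have diff: "x - p x \<in> S" for x
    using B(1) assms by (auto simp: p_def intro!: subspace_sum subspace_scale)
  have orthB: "b \<bullet> p x = 0" if "b \<in> B" for b x
  proof -
    have "(\<Sum>c\<in>B. (c \<bullet> x) * (b \<bullet> c)) = (\<Sum>c\<in>B. if c = b then b \<bullet> x else 0)"
      using B(2,3) that
      by (intro sum.cong) (auto simp: pairwise_def orthogonal_def dot_square_norm)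
    also have "\<dots> = b \<bullet> x" using fin that by simp
    finally show ?thesis by (simp add: p_def inner_diff_right inner_sum_right)
  qed
  have orth: "p x \<bullet> s = 0" if s: "s \<in> S" for x s
  proof -
    have "orthogonal (p x) s"
      by (rule orthogonal_to_span[of s B])
        (use s B(5) orthB in \<open>auto simp: orthogonal_def inner_commute\<close>)
    then show ?thesis by (simp add: orthogonal_def)
  qed
  have fixp: "p x = x" if "\<forall>s\<in>S. x \<bullet> s = 0" for x
    using that B(1) by (auto simp: p_def inner_commute intro!: sum.neutral)
  have zero: "p s = 0" if "s \<in> S" for s
  proof -
    have "p s = s - (s - p s)" by simp
    also have "\<dots> \<in> S" by (rule subspace_diff[OF assms that diff])
    finally have "p s \<bullet> p s = 0" by (rule orth)
    then show ?thesis by simp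
  qed
  show thesis by (rule that[OF lin diff orth fixp zero])
qed

lemma link_memE:
  assumes "G' \<in> link \<Phi> \<sigma>"
  obtains G where "G \<in> \<Phi>" "\<sigma> \<subseteq> G" "G' = G - \<sigma>"
  using assms unfolding link_def by blast

text \<open>The rays are projected along the span of \<open>\<sigma>\<close> onto its orthogonal
  complement. By the last conclusion a linear form vanishing on \<open>\<sigma>\<close> can be
  evaluated on the original rays, which is how half-spaces of a link are read off.\<close>

lemma fan_link:
  fixes L :: "'a::euclidean_space set" and r :: "'v \<Rightarrow> 'a"
  assumes fan: "fan k L \<Phi> r" and F: "F \<in> \<Phi>" "\<sigma> \<subseteq> F"
  obtains L' r' where "fan (k - card \<sigma>) L' (link \<Phi> \<sigma>) r'" "L' = {y \<in> L. \<forall>u\<in>\<sigma>. y \<bullet> r u = 0}"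
    "\<And>v c. (\<And>u. u \<in> \<sigma> \<Longrightarrow> c \<bullet> r u = 0) \<Longrightarrow> c \<bullet> r' v = c \<bullet> r v"
proof -
  define S where "S = span (r ` \<sigma>)"
  have subS: "subspace S" by (simp add: S_def)
  have SL: "S \<subseteq> L"
    unfolding S_def using fan_mem[OF fan F(1)] F(2) fan_subspace[OF fan] by (intro span_minimal) auto
  obtain p where p: "linear p" "\<And>x. x - p x \<in> S" "\<And>x s. s \<in> S \<Longrightarrow> p x \<bullet> s = 0"
    "\<And>x. \<forall>s\<in>S. x \<bullet> s = 0 \<Longrightarrow> p x = x" "\<And>s. s \<in> S \<Longrightarrow> p s = 0"
    by (rule orth_projection[OF subS]) (rule that)
  define r' where "r' v = p (r v)" for v
  define L' where "L' = {y \<in> L. \<forall>u\<in>\<sigma>. y \<bullet> r u = 0}"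
  have fin: "finite G" "card G = k" if "G \<in> \<Phi>" for G using fan_facet[OF fan that] by auto
  have fin\<sigma>: "finite \<sigma>" using F fin finite_subset by blast
  have psum: "p (\<Sum>v\<in>A. c v *\<^sub>R r v) = (\<Sum>v\<in>A. c v *\<^sub>R r' v)" for A and c :: "'v \<Rightarrow> real"
    by (simp add: linear_sum[OF p(1)] linear_scale[OF p(1)] r'_def)
  have r'0: "r' u = 0" if "u \<in> \<sigma>" for u
    unfolding r'_def by (rule p(5)) (use that in \<open>auto simp: S_def span_base\<close>)
  have orthS: "y \<bullet> s = 0" if "\<And>u. u \<in> \<sigma> \<Longrightarrow> y \<bullet> r u = 0" "s \<in> S" for y s
  proof -
    have "orthogonal y s"
      by (rule orthogonal_to_span[of s "r ` \<sigma>"]) (use that in \<open>auto simp: S_def orthogonal_def\<close>)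
    then show ?thesis by (simp add: orthogonal_def)
  qed
  have pr: "c \<bullet> r' v = c \<bullet> r v" if "\<And>u. u \<in> \<sigma> \<Longrightarrow> c \<bullet> r u = 0" for v c
  proof -
    have "c \<bullet> (r v - p (r v)) = 0" by (rule orthS[OF that p(2)])
    then show ?thesis by (simp add: r'_def inner_diff_right)
  qed
  have subL': "subspace L'"
    using fan_subspace[OF fan]
    by (auto simp: L'_def subspace_def inner_add_left)
  have Sspan: "\<exists>e. s = (\<Sum>u\<in>\<sigma>. e u *\<^sub>R r u)" if "s \<in> S" for s
    using that fin\<sigma>
  proof -
    have "s \<in> range (\<lambda>e. \<Sum>u\<in>\<sigma>. e u *\<^sub>R r u)"
      using that unfolding S_def
    proof (induction rule: span_induct_alt)
      case base
      show ?case by (rule range_eqI[of _ _ "\<lambda>_. 0"]) simp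
    next
      case (step c x y)
      then obtain e u where "y = (\<Sum>u\<in>\<sigma>. e u *\<^sub>R r u)" "u \<in> \<sigma>" "x = r u" by blast
      then have "c *\<^sub>R x + y = (\<Sum>w\<in>\<sigma>. (e w + (if w = u then c else 0)) *\<^sub>R r w)"
        using fin\<sigma> by (simp add: scaleR_add_left sum.distrib if_distrib[of "\<lambda>t. t *\<^sub>R _"] cong: if_cong)
      then show ?case
        by (intro range_eqI[of _ _ "\<lambda>w. e w + (if w = u then c else 0)"]) simp
    qed
    then show ?thesis by blast
  qed
  have "fan (k - card \<sigma>) L' (link \<Phi> \<sigma>) r'"
    unfolding fan_def
  proof (intro conjI ballI allI impI)
    show "subspace L'" by (rule subL')
    show "finite (link \<Phi> \<sigma>)" using fan_finite[OF fan] by (auto simp: link_def)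
    have "L' = {y \<in> L. \<forall>x\<in>S. orthogonal x y}"
      unfolding L'_def using orthS
      by (auto simp: orthogonal_def inner_commute S_def span_base)
    then have "dim L' + dim S = dim L"
      using dim_subspace_orthogonal_to_vectors[OF subS fan_subspace[OF fan] SL] by simp
    then show "dim L' = k - card \<sigma>"
      using fan_dim_span[OF fan F] fan_dim[OF fan] by (simp add: S_def)
  next
    fix G' assume "G' \<in> link \<Phi> \<sigma>"
    then obtain G where G: "G \<in> \<Phi>" "\<sigma> \<subseteq> G" "G' = G - \<sigma>" by (rule link_memE)
    show "finite G'" "card G' = k - card \<sigma>"
      using G fin[OF G(1)] fin\<sigma> by (simp_all add: card_Diff_subset)
    show "r' ` G' \<subseteq> L'"
    proof
      fix y assume "y \<in> r' ` G'"
      then obtain v where v: "v \<in> G" "y = p (r v)" using G by (auto simp: r'_def)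
      have "y = r v - (r v - p (r v))" using v by simp
      moreover have "r v \<in> L" "r v - p (r v) \<in> L" using fan_mem[OF fan G(1) v(1)] p(2) SL by auto
      ultimately have "y \<in> L" using fan_subspace[OF fan] by (metis subspace_diff)
      moreover have "y \<bullet> r u = 0" if "u \<in> \<sigma>" for u
        unfolding v(2) by (rule p(3)) (use that in \<open>auto simp: S_def span_base\<close>)
      ultimately show "y \<in> L'" by (simp add: L'_def)
    qed
    fix c v assume c: "(\<Sum>v\<in>G'. c v *\<^sub>R r' v) = 0" and v: "v \<in> G'"
    let ?x = "\<Sum>v\<in>G'. c v *\<^sub>R r v"
    have "?x - p ?x \<in> S" by (rule p(2))
    then have "?x \<in> S" unfolding psum c by simp
    then obtain e where e: "?x = (\<Sum>u\<in>\<sigma>. e u *\<^sub>R r u)" using Sspan by blast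
    have "(\<Sum>v\<in>G. (if v \<in> \<sigma> then - e v else c v) *\<^sub>R r v)
        = (\<Sum>v\<in>\<sigma>. (- e v) *\<^sub>R r v) + (\<Sum>v\<in>G'. c v *\<^sub>R r v)"
      unfolding G(3) using G(2) fin(1)[OF G(1)]
      by (subst sum.subset_diff[of \<sigma> G]) (auto intro!: arg_cong2[of _ _ _ _ "(+)"] sum.cong)
    also have "\<dots> = 0" unfolding e by (simp add: sum_negf)
    finally have "(if v \<in> \<sigma> then - e v else c v) = 0"
      by (rule fan_indep[OF fan G(1)]) (use v G in auto)
    then show "c v = 0" using v G by simp
  next
    show "L' \<subseteq> (\<Union>G\<in>link \<Phi> \<sigma>. pc r' G)"
    proof
      fix y assume y: "y \<in> L'"
      \<comment> \<open>A small step from the relative interior of \<open>\<sigma>\<close> in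
        direction \<open>y\<close> stays in the facets around \<open>\<sigma>\<close>, and the
        projection kills the contribution of \<open>\<sigma>\<close>.\<close>
      let ?x = "\<Sum>v\<in>\<sigma>. 1 *\<^sub>R r v"
      obtain e where e: "0 < e" "\<And>y. y \<in> L \<Longrightarrow> dist ?x y < e \<Longrightarrow> \<exists>G\<in>\<Phi>. \<sigma> \<subseteq> G \<and> y \<in> pc r G"
        by (rule fan_near[OF fan F, of "\<lambda>_. 1"]) auto
      define t where "t = e / (norm y + 1)"
      have t: "0 < t" using e(1) by (simp add: t_def add_nonneg_pos)
      have "norm (t *\<^sub>R y) < e"
      proof -
        have "t * norm y < t * (norm y + 1)" using t by simp
        also have "\<dots> = e" unfolding t_def by (simp add: add_nonneg_pos less_imp_neq[symmetric])
        finally show ?thesis using t by simp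
      qed
      moreover have "?x \<in> S" unfolding S_def by (intro span_sum span_scale span_base) auto
      then have "?x + t *\<^sub>R y \<in> L"
        using y SL fan_subspace[OF fan] by (auto simp: L'_def intro!: subspace_add subspace_scale)
      ultimately obtain G where G: "G \<in> \<Phi>" "\<sigma> \<subseteq> G" "?x + t *\<^sub>R y \<in> pc r G"
        using e(2)[of "?x + t *\<^sub>R y"] by (auto simp: dist_norm)
      obtain c where c: "\<And>v. v \<in> G \<Longrightarrow> 0 \<le> c v" "?x + t *\<^sub>R y = (\<Sum>v\<in>G. c v *\<^sub>R r v)"
        using pcE[OF G(3)] by metis
      have py: "p y = y"
        by (rule p(4)) (use orthS y in \<open>auto simp: L'_def\<close>)
      have "p (?x + t *\<^sub>R y) = t *\<^sub>R y"
        using p(5)[OF \<open>?x \<in> S\<close>] py by (simp add: linear_add[OF p(1)] linear_scale[OF p(1)])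
      then have "t *\<^sub>R y = (\<Sum>v\<in>G. c v *\<^sub>R r' v)" unfolding c(2) psum by simp
      also have "\<dots> = (\<Sum>v\<in>G - \<sigma>. c v *\<^sub>R r' v)"
        using fin(1)[OF G(1)] r'0 by (intro sum.mono_neutral_right) auto
      also have "\<dots> \<in> pc r' (G - \<sigma>)" using c by (intro pcI) auto
      finally have "(1 / t) *\<^sub>R t *\<^sub>R y \<in> pc r' (G - \<sigma>)" by (rule pc_scale) (use t in simp)
      then show "y \<in> (\<Union>G\<in>link \<Phi> \<sigma>. pc r' G)"
        using t G by (auto simp: link_def)
    qed
  next
    fix A' B' assume "A' \<in> link \<Phi> \<sigma>" "B' \<in> link \<Phi> \<sigma>"
    then obtain A B where A: "A \<in> \<Phi>" "\<sigma> \<subseteq> A" "A' = A - \<sigma>" and B: "B \<in> \<Phi>" "\<sigma> \<subseteq> B" "B' = B - \<sigma>"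
      by (metis link_memE)
    show "pc r' A' \<inter> pc r' B' \<subseteq> pc r' (A' \<inter> B')"
    proof
      fix x assume "x \<in> pc r' A' \<inter> pc r' B'"
      then obtain a b where a: "\<And>v. v \<in> A' \<Longrightarrow> 0 \<le> a v" "x = (\<Sum>v\<in>A'. a v *\<^sub>R r' v)"
        and b: "\<And>v. v \<in> B' \<Longrightarrow> 0 \<le> b v" "x = (\<Sum>v\<in>B'. b v *\<^sub>R r' v)"
        unfolding pc_def by blast
      let ?a = "\<Sum>v\<in>A'. a v *\<^sub>R r v" and ?b = "\<Sum>v\<in>B'. b v *\<^sub>R r v"
      have "(?a - p ?a) - (?b - p ?b) \<in> S" using p(2) subS by (blast intro: subspace_diff)
      then have "?a - ?b \<in> S" unfolding psum a(2)[symmetric] b(2)[symmetric] by simp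
      then obtain e where e: "?a - ?b = (\<Sum>u\<in>\<sigma>. e u *\<^sub>R r u)" using Sspan by blast
      \<comment> \<open>Two lifts of the same projected point differ by a combination of the rays of
        \<open>\<sigma>\<close> with coefficients \<open>e\<close>. Adding |e| to one and |e| + e to
        the other makes them equal and keeps coefficients nonnegative, so that
        \<open>fan_support\<close> of the large fan applies.\<close>
      define cA where "cA v = (if v \<in> \<sigma> then \<bar>e v\<bar> else a v)" for v
      define cB where "cB v = (if v \<in> \<sigma> then \<bar>e v\<bar> + e v else b v)" for v
      have sA: "(\<Sum>v\<in>A. cA v *\<^sub>R r v) = (\<Sum>u\<in>\<sigma>. \<bar>e u\<bar> *\<^sub>R r u) + ?a"
        unfolding A(3) using A(2) fin(1)[OF A(1)]
        by (subst sum.subset_diff[of \<sigma> A]) (auto simp: cA_def intro!: arg_cong2[of _ _ _ _ "(+)"] sum.cong)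
      have sB: "(\<Sum>v\<in>B. cB v *\<^sub>R r v) = (\<Sum>u\<in>\<sigma>. (\<bar>e u\<bar> + e u) *\<^sub>R r u) + ?b"
        unfolding B(3) using B(2) fin(1)[OF B(1)]
        by (subst sum.subset_diff[of \<sigma> B]) (auto simp: cB_def intro!: arg_cong2[of _ _ _ _ "(+)"] sum.cong)
      have "(\<Sum>v\<in>A. cA v *\<^sub>R r v) = (\<Sum>v\<in>B. cB v *\<^sub>R r v)"
        unfolding sA sB scaleR_add_left sum.distrib using e by (simp add: algebra_simps)
      moreover have "(\<Sum>v\<in>B. cB v *\<^sub>R r v) \<in> pc r B"
        by (rule pcI) (use b B in \<open>auto simp: cB_def\<close>)
      ultimately have "(\<Sum>v\<in>A. cA v *\<^sub>R r v) \<in> pc r B" by simp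
      moreover have "\<And>v. v \<in> A \<Longrightarrow> 0 \<le> cA v" using a A by (auto simp: cA_def)
      ultimately have supp: "v \<in> B" if "v \<in> A" "0 < cA v" for v
        using fan_support[OF fan A(1) subset_refl B(1) subset_refl, where c = cA] that by blast
      have "a v = 0" if "v \<in> A' - (A' \<inter> B')" for v
      proof (rule ccontr)
        assume "a v \<noteq> 0"
        then have "0 < cA v" using that a(1)[of v] A by (auto simp: cA_def)
        then show False using supp[of v] that A B by auto
      qed
      then have "x = (\<Sum>v\<in>A' \<inter> B'. a v *\<^sub>R r' v)"
        unfolding a(2) using fin(1)[OF A(1)] A(3)
        by (intro sum.mono_neutral_right) auto
      also have "\<dots> \<in> pc r' (A' \<inter> B')" using a by (intro pcI) auto
      finally show "x \<in> pc r' (A' \<inter> B')" .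
    qed
  qed
  then show thesis using that L'_def pr by blast
qed

lemma subspace_thin:
  fixes W :: "'a::euclidean_space set"
  assumes "subspace W" "S \<subseteq> W" "dim S < dim W"
  shows "\<exists>u\<in>W. u \<noteq> 0 \<and> (\<forall>y\<in>S. u \<bullet> y = 0)"
proof -
  have "span S \<subseteq> span W" using assms(2) by (rule span_mono)
  moreover have "span S \<noteq> span W" using assms(3) by (metis dim_span less_irrefl)
  ultimately have "span S \<subset> span W" by blast
  then obtain u where "u \<noteq> 0" "u \<in> span W" "\<And>y. y \<in> span S \<Longrightarrow> orthogonal u y"
    using orthogonal_to_subspace_exists_gen by metis
  then show ?thesis
    using assms(1) by (metis orthogonal_def span_base span_eq_iff)
qed

lemma pc_subset_span: "pc r A \<subseteq> span (r ` A)"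
  by (auto simp: pc_def intro: span_sum span_scale span_base)

text \<open>The cone and \<open>x\<close> together span at most k - 1 dimensions. This supplies the
  last assumption of \<open>facet_path\<close> when \<open>W\<close> is all of
  \<open>L\<close>.\<close>

lemma fan_thin:
  fixes L :: "'a::euclidean_space set" and r :: "'v \<Rightarrow> 'a"
  assumes fan: "fan k L \<Phi> r" and x: "x \<in> L" and H: "H \<in> \<Phi>" "\<tau> \<subseteq> H" "card \<tau> + 2 \<le> k"
  shows "\<exists>u\<in>L. u \<noteq> 0 \<and> u \<bullet> x = 0 \<and> (\<forall>z\<in>L \<inter> pc r \<tau>. u \<bullet> z = 0)"
proof -
  have "dim (insert x (span (r ` \<tau>))) \<le> Suc (dim (span (r ` \<tau>)))"
    by (simp add: dim_insert)
  also have "\<dots> < dim L" using fan_dim_span[OF fan H(1,2)] H(3) fan_dim[OF fan] by simp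
  finally have "dim (insert x (span (r ` \<tau>))) < dim L" .
  moreover have "span (r ` \<tau>) \<subseteq> L"
    using fan_mem[OF fan H(1)] H(2) fan_subspace[OF fan] by (intro span_minimal) auto
  then have "insert x (span (r ` \<tau>)) \<subseteq> L" using x by simp
  ultimately obtain u where "u \<in> L" "u \<noteq> 0" "\<forall>y\<in>insert x (span (r ` \<tau>)). u \<bullet> y = 0"
    using subspace_thin[OF fan_subspace[OF fan]] by blast
  then show ?thesis using pc_subset_span[of r \<tau>] by blast
qed

section \<open>Connectivity of half-spaces\<close>

text \<open>On a line two rays of a fan cannot point the same way, so only one can lie opposite to
  \<open>r v\<close>; covering the vector opposite to \<open>r v\<close> makes it exist.\<close>

lemma fan1_ex1:
  fixes L :: "'a::euclidean_space set" and r :: "'v \<Rightarrow> 'a"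
  assumes fan: "fan 1 L \<Phi> r" and v: "{v} \<in> \<Phi>"
  shows "\<exists>!w. w \<noteq> v \<and> {w} \<in> \<Phi>"
proof -
  have nz: "r w \<noteq> 0" if "{w} \<in> \<Phi>" for w
    using fan_indep[OF fan that, of "\<lambda>_. 1" w] by auto
  have "dim (span {r v}) = 1" using nz[OF v] by simp
  moreover have "span {r v} \<subseteq> L"
    using fan_mem[OF fan v] fan_subspace[OF fan] by (intro span_minimal) auto
  ultimately have L: "L = span {r v}"
    using subspace_dim_equal[of "span {r v}" L] fan_subspace[OF fan] fan_dim[OF fan] by simp
  have single: "r u \<notin> pc r {w}" if "{u} \<in> \<Phi>" "{w} \<in> \<Phi>" "u \<noteq> w" for u w
    using fan_support[OF fan that(1) subset_refl that(2) subset_refl, of "\<lambda>_. 1" u] that(3) by auto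
  have scaled: "t *\<^sub>R r w \<in> pc r {w}" if "0 \<le> t" for t w
    using pc_scale[OF pc_gen[of "{w}" w r] that] by simp
  have neg: "\<exists>t<0. r w = t *\<^sub>R r v" if w: "{w} \<in> \<Phi>" "w \<noteq> v" for w
  proof -
    have "r w \<in> span {r v}" using fan_mem[OF fan w(1)] L by simp
    then obtain t where t: "r w = t *\<^sub>R r v" by (auto simp: span_singleton)
    have "\<not> 0 \<le> t" using single[OF w(1) v w(2)] scaled[of t v] t by auto
    then show ?thesis using t by (intro exI[of _ t]) auto
  qed
  have "- r v \<in> L" using L by (simp add: span_neg span_base)
  then obtain F where F: "F \<in> \<Phi>" "- r v \<in> pc r F" using fan_cover[OF fan] by blast
  then obtain w where w: "F = {w}" using fan_facet[OF fan F(1)] by (auto simp: card_1_singleton_iff)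
  obtain c where c: "0 \<le> c" "- r v = c *\<^sub>R r w"
    using F(2) unfolding w pc_def by auto
  have "w \<noteq> v"
  proof
    assume "w = v"
    then have "(1 + c) *\<^sub>R r v = 0" using c(2) by (simp add: scaleR_add_left) (metis add.right_inverse)
    then show False using c(1) nz[OF v] by simp
  qed
  moreover have "w = w'" if w': "w' \<noteq> v" "{w'} \<in> \<Phi>" for w'
  proof (rule ccontr)
    assume "w \<noteq> w'"
    obtain t where t: "t < 0" "r w = t *\<^sub>R r v" using neg[of w] F w \<open>w \<noteq> v\<close> by auto
    obtain t' where t': "t' < 0" "r w' = t' *\<^sub>R r v" using neg[of w'] w' by auto
    have "r w = (t / t') *\<^sub>R r w'" using t t' by simp
    moreover have "0 \<le> t / t'" using t t' by (simp add: divide_nonpos_neg)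
    ultimately have "r w \<in> pc r {w'}" using scaled[of "t / t'" w'] by simp
    then show False using single[of w w'] F w w' \<open>w \<noteq> w'\<close> by simp
  qed
  ultimately show ?thesis using F w by blast
qed

lemma fan_singleton_adj: "F \<noteq> G \<Longrightarrow> card F = 1 \<Longrightarrow> card G = 1 \<Longrightarrow> adj F G"
  by (auto simp: card_1_singleton_iff adj_def)

text \<open>For \<open>k = 1\<close> the positive half contains a single ray. Otherwise the
  half-space is convex, so \<open>facet_path\<close> runs inside it, and a crossing point with
  positive product needs a ray with positive product in the shared ridge.\<close>

lemma fan_halfspace_connected:
  fixes L :: "'a::euclidean_space set" and r :: "'v \<Rightarrow> 'a"
  assumes fan: "fan k L \<Phi> r" and F: "F \<in> \<Phi>" "f \<in> F" "0 < c \<bullet> r f" and G: "G \<in> \<Phi>" "g \<in> G" "0 < c \<bullet> r g"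
  shows "(\<lambda>X Y. adj X Y \<and> Y \<in> \<Phi> \<and> (\<exists>v\<in>X \<inter> Y. 0 < c \<bullet> r v))\<^sup>*\<^sup>* F G"
proof -
  have kF: "finite F" "card F = k" "finite G" "card G = k" using fan_facet[OF fan] F G by auto
  have "k \<noteq> 0" using kF(1,2) F(2) by (metis card_0_eq empty_iff)
  then consider "k = 1" | "2 \<le> k" by linarith
  then show ?thesis
  proof cases
    case 1
    then have Fe: "F = {f}" and Ge: "G = {g}"
      using kF F(2) G(2) by (auto simp: card_1_singleton_iff)
    have nz: "r f \<noteq> 0" using F(3) by auto
    have "dim (span {r f}) = 1" using nz by simp
    moreover have "span {r f} \<subseteq> L"
      using fan_mem[OF fan F(1,2)] fan_subspace[OF fan] by (intro span_minimal) auto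
    ultimately have L: "L = span {r f}"
      using subspace_dim_equal[of "span {r f}" L] fan_subspace[OF fan] fan_dim[OF fan] 1 by simp
    then obtain t where t: "r g = t *\<^sub>R r f" using fan_mem[OF fan G(1,2)] by (auto simp: span_singleton)
    then have "0 < t" using F(3) G(3) by (simp add: zero_less_mult_iff)
    then have "r g \<in> pc r F"
      unfolding Fe t by (intro pc_scale pc_gen) auto
    then have "g \<in> F"
      using fan_support[OF fan G(1) subset_refl F(1) subset_refl, of "\<lambda>_. 1" g] G(2) Ge by auto
    then have "F = G" using Fe Ge by simp
    then show ?thesis by simp
  next
    case 2
    have ex: "\<exists>d. (\<forall>v\<in>H. 0 < d v) \<and> 0 < c \<bullet> (\<Sum>v\<in>H. d v *\<^sub>R r v)"
      if H: "finite H" "h \<in> H" "0 < c \<bullet> r h" for H h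
    proof -
      \<comment> \<open>Extra weight on \<open>r h\<close> outweighs all other contributions and
        moves an interior point of the cone into the half-space.\<close>
      define M where "M = 1 + \<bar>\<Sum>v\<in>H. c \<bullet> r v\<bar> / (c \<bullet> r h)"
      define d where "d v = (if v = h then 1 + M else 1)" for v
      have M: "0 < M" using H(3) by (simp add: M_def add_pos_nonneg)
      have "(\<Sum>v\<in>H. d v *\<^sub>R r v) = (\<Sum>v\<in>H. r v) + M *\<^sub>R r h"
        using H(1,2) by (simp add: d_def sum.remove[of H h] scaleR_add_left)
      then have "c \<bullet> (\<Sum>v\<in>H. d v *\<^sub>R r v) = (\<Sum>v\<in>H. c \<bullet> r v) + M * (c \<bullet> r h)"
        by (simp add: inner_add_right inner_sum_right)
      also have "M * (c \<bullet> r h) = c \<bullet> r h + \<bar>\<Sum>v\<in>H. c \<bullet> r v\<bar>"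
        using H(3) by (simp add: M_def distrib_right)
      also have "0 < (\<Sum>v\<in>H. c \<bullet> r v) + (c \<bullet> r h + \<bar>\<Sum>v\<in>H. c \<bullet> r v\<bar>)"
        using H(3) by linarith
      finally have "0 < c \<bullet> (\<Sum>v\<in>H. d v *\<^sub>R r v)" .
      moreover have "\<forall>v\<in>H. 0 < d v" using M by (simp add: d_def)
      ultimately show ?thesis by blast
    qed
    obtain d where d: "\<And>v. v \<in> F \<Longrightarrow> 0 < d v" "0 < c \<bullet> (\<Sum>v\<in>F. d v *\<^sub>R r v)"
      using ex[OF kF(1) F(2,3)] by blast
    obtain d' where d': "\<And>v. v \<in> G \<Longrightarrow> 0 < d' v" "0 < c \<bullet> (\<Sum>v\<in>G. d' v *\<^sub>R r v)"
      using ex[OF kF(3) G(2,3)] by blast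
    let ?x = "\<Sum>v\<in>F. d v *\<^sub>R r v" and ?y = "\<Sum>v\<in>G. d' v *\<^sub>R r v"
    define C where "C = {z \<in> L. 0 < c \<bullet> z}"
    have xL: "?x \<in> L" "?y \<in> L"
      using fan_mem[OF fan F(1)] fan_mem[OF fan G(1)] fan_subspace[OF fan]
      by (auto intro!: subspace_sum subspace_scale)
    have "convex C"
      using subspace_imp_convex[OF fan_subspace[OF fan]] convex_halfspace_gt[of 0 c]
      unfolding C_def by (metis Collect_conj_eq Collect_mem_eq convex_Int)
    have "open {z. 0 < c \<bullet> z}" by (rule open_halfspace_gt)
    then obtain e where e: "0 < e" "ball ?y e \<subseteq> {z. 0 < c \<bullet> z}"
      by (rule openE[of _ ?y]) (use d' in auto)
    have "(\<lambda>X Y. adj X Y \<and> Y \<in> \<Phi> \<and> (\<exists>z\<in>C. z \<noteq> 0 \<and> z \<in> pc r (X \<inter> Y)))\<^sup>*\<^sup>* F G"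
    proof (rule facet_path[OF fan 2 fan_subspace[OF fan] subset_refl _ \<open>convex C\<close> F(1) d(1) _ G(1) d'(1) _ e(1)])
      show "C \<subseteq> L" by (auto simp: C_def)
      show "?x \<in> C" "?y \<in> C" using xL d d' by (auto simp: C_def)
      show "y \<in> C" if "y \<in> L" "dist ?y y < e" for y
        using that e(2) by (auto simp: C_def)
      show "\<exists>u\<in>L. u \<noteq> 0 \<and> u \<bullet> ?x = 0 \<and> (\<forall>z\<in>L \<inter> pc r \<tau>. u \<bullet> z = 0)"
        if "H \<in> \<Phi>" "\<tau> \<subseteq> H" "card \<tau> + 2 \<le> k" for H \<tau>
        by (rule fan_thin[OF fan xL(1) that])
    qed
    then show ?thesis
    proof (rule rtranclp_mono[THEN predicate2D, rotated], intro predicate2I)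
      fix X Y assume *: "adj X Y \<and> Y \<in> \<Phi> \<and> (\<exists>z\<in>C. z \<noteq> 0 \<and> z \<in> pc r (X \<inter> Y))"
      then obtain z where z: "0 < c \<bullet> z" "z \<in> pc r (X \<inter> Y)" by (auto simp: C_def)
      then obtain a where a: "\<And>v. v \<in> X \<inter> Y \<Longrightarrow> 0 \<le> a v" "z = (\<Sum>v\<in>X \<inter> Y. a v *\<^sub>R r v)"
        unfolding pc_def by blast
      have "\<exists>v\<in>X \<inter> Y. 0 < c \<bullet> r v"
      proof (rule ccontr)
        assume "\<not> (\<exists>v\<in>X \<inter> Y. 0 < c \<bullet> r v)"
        then have "c \<bullet> z \<le> 0"
          unfolding a(2) inner_sum_right using a(1)
          by (intro sum_nonpos) (auto simp: mult_nonneg_nonpos not_less)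
        then show False using z(1) by simp
      qed
      then show "adj X Y \<and> Y \<in> \<Phi> \<and> (\<exists>v\<in>X \<inter> Y. 0 < c \<bullet> r v)" using * by blast
    qed
  qed
qed

lemma fan_connected:
  fixes L :: "'a::euclidean_space set" and r :: "'v \<Rightarrow> 'a"
  assumes fan: "fan k L \<Phi> r" and F: "F \<in> \<Phi>" and G: "G \<in> \<Phi>"
  shows "(\<lambda>X Y. adj X Y \<and> Y \<in> \<Phi>)\<^sup>*\<^sup>* F G"
proof -
  have kF: "finite F" "card F = k" "finite G" "card G = k" using fan_facet[OF fan] F G by auto
  consider "k = 0" | "k = 1" | "2 \<le> k" by linarith
  then show ?thesis
  proof cases
    case 1 then show ?thesis using kF by simp
  next
    case 2
    show ?thesis
    proof (cases "F = G")
      case False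
      then show ?thesis using fan_singleton_adj[of F G] kF 2 G by auto
    qed simp
  next
    case 3
    have xL: "(\<Sum>v\<in>H. 1 *\<^sub>R r v) \<in> L" if "H \<in> \<Phi>" for H
      using fan_mem[OF fan that] fan_subspace[OF fan] by (auto intro!: subspace_sum)
    have "(\<lambda>X Y. adj X Y \<and> Y \<in> \<Phi> \<and> (\<exists>z\<in>L. z \<noteq> 0 \<and> z \<in> pc r (X \<inter> Y)))\<^sup>*\<^sup>* F G"
    proof (rule facet_path[OF fan 3 fan_subspace[OF fan] subset_refl subset_refl
          subspace_imp_convex[OF fan_subspace[OF fan]] F _ xL[OF F] G _ xL[OF G] zero_less_one])
      show "\<exists>u\<in>L. u \<noteq> 0 \<and> u \<bullet> (\<Sum>v\<in>F. 1 *\<^sub>R r v) = 0 \<and> (\<forall>z\<in>L \<inter> pc r \<tau>. u \<bullet> z = 0)"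
        if "H \<in> \<Phi>" "\<tau> \<subseteq> H" "card \<tau> + 2 \<le> k" for H \<tau>
        by (rule fan_thin[OF fan xL[OF F] that])
    qed auto
    then show ?thesis
      by (rule rtranclp_mono[THEN predicate2D, rotated]) auto
  qed
qed

lemma rtranclp_link:
  assumes "(\<lambda>X Y. adj X Y \<and> Y \<in> link \<Phi> \<sigma> \<and> P X Y)\<^sup>*\<^sup>* (F - \<sigma>) (G - \<sigma>)"
    and F: "F \<in> \<Phi>" "\<sigma> \<subseteq> F" and G: "\<sigma> \<subseteq> G"
  shows "(\<lambda>X Y. adj X Y \<and> Y \<in> \<Phi> \<and> \<sigma> \<subseteq> Y \<and> \<sigma> \<subseteq> X \<and> P (X - \<sigma>) (Y - \<sigma>))\<^sup>*\<^sup>* F G"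
proof -
  have "(\<lambda>X Y. adj X Y \<and> Y \<in> link \<Phi> \<sigma> \<and> P X Y)\<^sup>*\<^sup>* (F - \<sigma>) H \<Longrightarrow> H \<inter> \<sigma> = {} \<and>
    (\<lambda>X Y. adj X Y \<and> Y \<in> \<Phi> \<and> \<sigma> \<subseteq> Y \<and> \<sigma> \<subseteq> X \<and> P (X - \<sigma>) (Y - \<sigma>))\<^sup>*\<^sup>* F (H \<union> \<sigma>)" for H
  proof (induction rule: rtranclp_induct)
    case base
    then show ?case using F by (auto simp: Un_absorb2)
  next
    case (step X Y)
    then obtain Z where Z: "Z \<in> \<Phi>" "\<sigma> \<subseteq> Z" "Y = Z - \<sigma>" by (auto elim: link_memE)
    obtain v w where vw: "v \<in> X" "w \<notin> X" "w \<in> Y" "Y = insert w (X - {v})"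
      using step.hyps(2) adjE[of X Y] by metis
    have "v \<notin> \<sigma>" "w \<notin> \<sigma>" using vw Z step.IH by auto
    then have "Y \<union> \<sigma> = insert w (X \<union> \<sigma> - {v})" using vw(4) by auto
    then have "adj (X \<union> \<sigma>) (Y \<union> \<sigma>)"
      using adjI[of v "X \<union> \<sigma>" w] vw \<open>w \<notin> \<sigma>\<close> by simp
    moreover have "Y \<union> \<sigma> = Z" using Z by auto
    moreover have "X \<union> \<sigma> - \<sigma> = X" "Y \<union> \<sigma> - \<sigma> = Y" using step.IH Z by auto
    ultimately have "adj (X \<union> \<sigma>) (Y \<union> \<sigma>) \<and> Y \<union> \<sigma> \<in> \<Phi> \<and> \<sigma> \<subseteq> Y \<union> \<sigma> \<and> \<sigma> \<subseteq> X \<union> \<sigma> \<and>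
        P (X \<union> \<sigma> - \<sigma>) (Y \<union> \<sigma> - \<sigma>)"
      using step.hyps(2) Z by simp
    moreover have "Y \<inter> \<sigma> = {}" using Z by auto
    ultimately show ?case
      using step.IH by (auto intro: rtranclp.rtrancl_into_rtrancl)
  qed
  from this[OF assms(1)] show ?thesis using G by (simp add: Un_absorb2)
qed

lemma fan_star_connected:
  fixes L :: "'a::euclidean_space set" and r :: "'v \<Rightarrow> 'a"
  assumes fan: "fan k L \<Phi> r" and F: "F \<in> \<Phi>" "\<sigma> \<subseteq> F" and G: "G \<in> \<Phi>" "\<sigma> \<subseteq> G"
  shows "(\<lambda>X Y. adj X Y \<and> Y \<in> \<Phi> \<and> \<sigma> \<subseteq> Y \<and> \<sigma> \<subseteq> X)\<^sup>*\<^sup>* F G"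
proof -
  obtain L' :: "'a set" and r' where "fan (k - card \<sigma>) L' (link \<Phi> \<sigma>) r'"
    by (rule fan_link[OF fan F]) (rule that)
  moreover have "F - \<sigma> \<in> link \<Phi> \<sigma>" "G - \<sigma> \<in> link \<Phi> \<sigma>" using F G by (auto simp: link_def)
  ultimately have "(\<lambda>X Y. adj X Y \<and> Y \<in> link \<Phi> \<sigma>)\<^sup>*\<^sup>* (F - \<sigma>) (G - \<sigma>)"
    by (rule fan_connected)
  then show ?thesis
    using rtranclp_link[of \<Phi> \<sigma> "\<lambda>_ _. True" F G] F G by simp
qed

text \<open>This is the connectivity of an open half of a link. As \<open>c\<close> vanishes on
  \<open>\<sigma>\<close>, the projection does not change its values on rays, and \<open>f\<close>
  and \<open>g\<close> lie outside \<open>\<sigma>\<close>.\<close>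

lemma fan_star_halfspace_connected:
  fixes L :: "'a::euclidean_space set" and r :: "'v \<Rightarrow> 'a"
  assumes fan: "fan k L \<Phi> r" and c: "\<And>u. u \<in> \<sigma> \<Longrightarrow> c \<bullet> r u = 0"
    and F: "F \<in> \<Phi>" "\<sigma> \<subseteq> F" "f \<in> F" "0 < c \<bullet> r f" and G: "G \<in> \<Phi>" "\<sigma> \<subseteq> G" "g \<in> G" "0 < c \<bullet> r g"
  shows "(\<lambda>X Y. adj X Y \<and> Y \<in> \<Phi> \<and> \<sigma> \<subseteq> Y \<and> \<sigma> \<subseteq> X \<and> (\<exists>v\<in>X \<inter> Y. 0 < c \<bullet> r v))\<^sup>*\<^sup>* F G"
proof -
  obtain L' :: "'a set" and r' where fan': "fan (k - card \<sigma>) L' (link \<Phi> \<sigma>) r'"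
    and r': "\<And>v c. (\<And>u. u \<in> \<sigma> \<Longrightarrow> c \<bullet> r u = 0) \<Longrightarrow> c \<bullet> r' v = c \<bullet> r v"
    by (rule fan_link[OF fan F(1,2)]) blast
  have cr: "c \<bullet> r' v = c \<bullet> r v" for v by (rule r') (rule c)
  have m: "F - \<sigma> \<in> link \<Phi> \<sigma>" "G - \<sigma> \<in> link \<Phi> \<sigma>" using F G by (auto simp: link_def)
  have n: "f \<in> F - \<sigma>" "g \<in> G - \<sigma>" using F G c by force+
  have "(\<lambda>X Y. adj X Y \<and> Y \<in> link \<Phi> \<sigma> \<and> (\<exists>v\<in>X \<inter> Y. 0 < c \<bullet> r' v))\<^sup>*\<^sup>* (F - \<sigma>) (G - \<sigma>)"
    by (rule fan_halfspace_connected[OF fan' m(1) n(1) _ m(2) n(2)]) (use F G cr in auto)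
  then have "(\<lambda>X Y. adj X Y \<and> Y \<in> \<Phi> \<and> \<sigma> \<subseteq> Y \<and> \<sigma> \<subseteq> X \<and>
      (\<exists>v\<in>(X - \<sigma>) \<inter> (Y - \<sigma>). 0 < c \<bullet> r' v))\<^sup>*\<^sup>* F G"
    by (rule rtranclp_link) (use F G in auto)
  then show ?thesis
    by (rule rtranclp_mono[THEN predicate2D, rotated]) (auto simp: cr)
qed

text \<open>The link of a ridge is a fan on a line, which has two rays; strong connectivity of a
  star is connectivity of a link.\<close>

lemma fan_npm:
  fixes L :: "'a::euclidean_space set" and r :: "'v \<Rightarrow> 'a"
  assumes fan: "fan k L \<Phi> r"
  shows "npm k \<Phi>"
  unfolding npm_def
proof (intro conjI ballI)
  show "finite \<Phi>" by (rule fan_finite[OF fan])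
  fix F assume F: "F \<in> \<Phi>"
  show fin: "finite F" "card F = k" using fan_facet[OF fan F] by auto
  {
    fix v assume v: "v \<in> F"
    define \<sigma> where "\<sigma> = F - {v}"
    have sub: "\<sigma> \<subseteq> F" by (auto simp: \<sigma>_def)
    have "k - card \<sigma> = 1" using fin v card_gt_0_iff[of F] by (auto simp: \<sigma>_def)
    moreover obtain L' :: "'a set" and r' where "fan (k - card \<sigma>) L' (link \<Phi> \<sigma>) r'"
      by (rule fan_link[OF fan F sub]) (rule that)
    ultimately have fan': "fan 1 L' (link \<Phi> \<sigma>) r'" by simp
    have memI: "G - \<sigma> \<in> link \<Phi> \<sigma>" if "G \<in> \<Phi>" "\<sigma> \<subseteq> G" for G
      using that by (auto simp: link_def)
    have "F - \<sigma> = {v}" using v by (auto simp: \<sigma>_def)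
    then have vl: "{v} \<in> link \<Phi> \<sigma>" using memI[OF F sub] by simp
    have eq: "w \<noteq> v \<and> {w} \<in> link \<Phi> \<sigma> \<longleftrightarrow> w \<noteq> v \<and> insert w (F - {v}) \<in> \<Phi>" for w
    proof
      assume *: "w \<noteq> v \<and> {w} \<in> link \<Phi> \<sigma>"
      then obtain G where "G \<in> \<Phi>" "\<sigma> \<subseteq> G" "{w} = G - \<sigma>" by (auto elim: link_memE)
      moreover from this have "G = insert w \<sigma>" by auto
      ultimately show "w \<noteq> v \<and> insert w (F - {v}) \<in> \<Phi>" using * by (simp add: \<sigma>_def)
    next
      assume *: "w \<noteq> v \<and> insert w (F - {v}) \<in> \<Phi>"
      have "w \<notin> \<sigma>"
      proof
        assume "w \<in> \<sigma>"
        then have "insert w (F - {v}) = F - {v}" by (auto simp: \<sigma>_def)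
        then show False
          using * fan_facet[OF fan, of "F - {v}"] fin v by (metis card_Diff1_less less_irrefl)
      qed
      then have "{w} = insert w \<sigma> - \<sigma>" by auto
      moreover have "insert w \<sigma> - \<sigma> \<in> link \<Phi> \<sigma>" by (rule memI) (use * in \<open>auto simp: \<sigma>_def\<close>)
      ultimately show "w \<noteq> v \<and> {w} \<in> link \<Phi> \<sigma>" using * by simp
    qed
    show "\<exists>!w. w \<noteq> v \<and> insert w (F - {v}) \<in> \<Phi>"
      using fan1_ex1[OF fan' vl] unfolding eq .
  }
  fix G assume G: "G \<in> \<Phi>"
  have "(\<lambda>X Y. adj X Y \<and> Y \<in> \<Phi> \<and> F \<inter> G \<subseteq> Y \<and> F \<inter> G \<subseteq> X)\<^sup>*\<^sup>* F G"
    by (rule fan_star_connected[OF fan F _ G]) auto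
  then show "(\<lambda>X Y. adj X Y \<and> Y \<in> \<Phi> \<and> F \<inter> G \<subseteq> Y)\<^sup>*\<^sup>* F G"
    by (rule rtranclp_mono[THEN predicate2D, rotated]) auto
qed

text \<open>A sum of terms of one sign, at least one of them nonzero, cannot vanish.\<close>

lemma pc_both_signs:
  fixes r :: "'v \<Rightarrow> 'a::euclidean_space"
  assumes fin: "finite A" and z: "z \<in> pc r A" "z \<noteq> 0" "a \<bullet> z = 0"
    and anz: "\<And>v. v \<in> A \<Longrightarrow> a \<bullet> r v \<noteq> 0"
  shows "(\<exists>v\<in>A. 0 < a \<bullet> r v) \<and> (\<exists>v\<in>A. a \<bullet> r v < 0)"
proof -
  obtain b where b: "\<And>v. v \<in> A \<Longrightarrow> 0 \<le> b v" "z = (\<Sum>v\<in>A. b v *\<^sub>R r v)"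
    using pcE[OF z(1)] by metis
  have "\<exists>v\<in>A. b v \<noteq> 0"
  proof (rule ccontr)
    assume "\<not> (\<exists>v\<in>A. b v \<noteq> 0)"
    then have "z = 0" unfolding b(2) by (intro sum.neutral) simp
    then show False using z(2) by simp
  qed
  then obtain v where v: "v \<in> A" "b v \<noteq> 0" by blast
  then have bv: "0 < b v" using b(1)[of v] by simp
  have sum0: "(\<Sum>v\<in>A. b v * (a \<bullet> r v)) = 0" using z(3) unfolding b(2) inner_sum_right by simp
  have "\<exists>v\<in>A. 0 < a \<bullet> r v"
  proof (rule ccontr)
    assume no: "\<not> (\<exists>v\<in>A. 0 < a \<bullet> r v)"
    then have "a \<bullet> r v < 0" using anz v(1) by (meson linorder_neqE_linordered_idom)
    then have "(\<Sum>v\<in>A. b v * (a \<bullet> r v)) < (\<Sum>v\<in>A. 0)"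
      using no b(1) bv v(1) fin
      by (intro sum_strict_mono_ex1) (auto simp: mult_nonneg_nonpos not_less mult_pos_neg intro!: bexI[of _ v])
    then show False using sum0 by simp
  qed
  moreover have "\<exists>v\<in>A. a \<bullet> r v < 0"
  proof (rule ccontr)
    assume no: "\<not> (\<exists>v\<in>A. a \<bullet> r v < 0)"
    then have "0 < a \<bullet> r v" using anz v(1) by (meson linorder_neqE_linordered_idom)
    then have "(\<Sum>v\<in>A. 0) < (\<Sum>v\<in>A. b v * (a \<bullet> r v))"
      using no b(1) bv v(1) fin
      by (intro sum_strict_mono_ex1) (auto simp: not_less intro!: bexI[of _ v])
    then show False using sum0 by simp
  qed
  ultimately show ?thesis by blast
qed

text \<open>\<open>facet_path\<close> is run inside the hyperplane orthogonal to \<open>a\<close>,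
  where a nonzero crossing point needs rays of both signs in the shared ridge.\<close>

lemma fan_equator_connected:
  fixes L :: "'a::euclidean_space set" and r :: "'v \<Rightarrow> 'a"
  assumes fan: "fan k L \<Phi> r" and k: "3 \<le> k" and a: "a \<in> L" "\<And>F v. F \<in> \<Phi> \<Longrightarrow> v \<in> F \<Longrightarrow> a \<bullet> r v \<noteq> 0"
    and F: "F \<in> \<Phi>" "f \<in> F" "0 < a \<bullet> r f" "f' \<in> F" "a \<bullet> r f' < 0"
    and G: "G \<in> \<Phi>" "g \<in> G" "0 < a \<bullet> r g" "g' \<in> G" "a \<bullet> r g' < 0"
  shows "(\<lambda>X Y. adj X Y \<and> Y \<in> \<Phi> \<and> (\<exists>v\<in>X \<inter> Y. 0 < a \<bullet> r v) \<and> (\<exists>v\<in>X \<inter> Y. a \<bullet> r v < 0))\<^sup>*\<^sup>* F G"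
proof -
  define W where "W = {z \<in> L. a \<bullet> z = 0}"
  have finF: "finite F" "finite G" using fan_facet[OF fan] F G by auto
  have subW: "subspace W" "W \<subseteq> L"
    using fan_subspace[OF fan] by (auto simp: W_def subspace_def inner_add_right)
  have "a \<noteq> 0" using F(3) by auto
  have dimW: "dim W + 1 = k"
  proof -
    have "W = {y \<in> L. \<forall>x\<in>span {a}. orthogonal x y}"
      by (auto simp: W_def span_singleton orthogonal_def)
    moreover have "span {a} \<subseteq> L" using a(1) fan_subspace[OF fan] by (intro span_minimal) auto
    ultimately show ?thesis
      using dim_subspace_orthogonal_to_vectors[of "span {a}" L] fan_subspace[OF fan]
        fan_dim[OF fan] \<open>a \<noteq> 0\<close> by simp
  qed
  have ex: "\<exists>d. (\<forall>v\<in>H. 0 < d v) \<and> a \<bullet> (\<Sum>v\<in>H. d v *\<^sub>R r v) = 0"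
    if H: "finite H" "h \<in> H" "0 < a \<bullet> r h" "h' \<in> H" "a \<bullet> r h' < 0" for H h h'
  proof -
    define s where "s = (\<Sum>v\<in>H. a \<bullet> r v)"
    \<comment> \<open>Raising the coefficient of one ray whose sign is opposite to that of the total
      \<open>s\<close> brings the sum into the hyperplane and keeps all coefficients
      positive.\<close>
    obtain u where u: "u \<in> H" "a \<bullet> r u \<noteq> 0" "0 \<le> - s / (a \<bullet> r u)"
    proof (cases "0 \<le> s")
      case True
      show thesis by (rule that[of h']) (use True H in \<open>auto simp: divide_nonneg_neg\<close>)
    next
      case False
      show thesis by (rule that[of h]) (use False H in \<open>auto simp: divide_nonpos_pos\<close>)
    qed
    define d where "d v = (if v = u then 1 + - s / (a \<bullet> r u) else 1)" for v
    have "(\<Sum>v\<in>H. d v *\<^sub>R r v) = (\<Sum>v\<in>H. r v) + (- s / (a \<bullet> r u)) *\<^sub>R r u"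
      unfolding d_def sum.remove[OF H(1) u(1)] by (simp add: scaleR_diff_left)
    then have "a \<bullet> (\<Sum>v\<in>H. d v *\<^sub>R r v) = 0"
      using u(2) by (simp add: inner_diff_right inner_sum_right s_def)
    moreover have "\<forall>v\<in>H. 0 < d v" using u(3) by (auto simp: d_def)
    ultimately show ?thesis by blast
  qed
  obtain d where d: "\<And>v. v \<in> F \<Longrightarrow> 0 < d v" "a \<bullet> (\<Sum>v\<in>F. d v *\<^sub>R r v) = 0"
    using ex[OF finF(1) F(2-5)] by blast
  obtain d' where d': "\<And>v. v \<in> G \<Longrightarrow> 0 < d' v" "a \<bullet> (\<Sum>v\<in>G. d' v *\<^sub>R r v) = 0"
    using ex[OF finF(2) G(2-5)] by blast
  let ?x = "\<Sum>v\<in>F. d v *\<^sub>R r v" and ?y = "\<Sum>v\<in>G. d' v *\<^sub>R r v"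
  have xW: "?x \<in> W" "?y \<in> W"
    using fan_mem[OF fan F(1)] fan_mem[OF fan G(1)] fan_subspace[OF fan] d d'
    by (auto simp: W_def intro!: subspace_sum subspace_scale)
  have thin: "\<exists>u\<in>W. u \<noteq> 0 \<and> u \<bullet> ?x = 0 \<and> (\<forall>z\<in>W \<inter> pc r \<tau>. u \<bullet> z = 0)"
    if H: "H \<in> \<Phi>" "\<tau> \<subseteq> H" "card \<tau> + 2 \<le> k" for H \<tau>
  proof -
    let ?S = "span (r ` \<tau>)"
    \<comment> \<open>No ray lies in \<open>W\<close>, so the hyperplane cuts the span of a nonempty
      \<open>\<tau>\<close> down by one dimension, which makes up for the dimension lost in passing
      to \<open>W\<close>. For empty \<open>\<tau>\<close> the claim is 1 < k - 1, and this is where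
      \<open>3 \<le> k\<close> enters.\<close>
    have "dim (W \<inter> ?S) + 1 < dim W"
    proof (cases "\<tau> = {}")
      case True
      then have "W \<inter> ?S \<subseteq> {0}" by auto
      then have "dim (W \<inter> ?S) = 0" by (simp only: dim_eq_0)
      then show ?thesis using k dimW by linarith
    next
      case False
      then obtain v where v: "v \<in> \<tau>" by blast
      have "r v \<notin> W" using a(2)[of H v] H v by (auto simp: W_def)
      then have "W \<inter> ?S \<noteq> ?S" using v span_base[of "r v" "r ` \<tau>"] by blast
      moreover have "span (W \<inter> ?S) = W \<inter> ?S"
        using subW by (simp add: subspace_inter span_eq_iff)
      ultimately have "span (W \<inter> ?S) \<subset> span ?S" by (metis inf_le2 psubsetI span_span)
      then have "dim (W \<inter> ?S) < dim ?S" by (rule dim_psubset)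
      then show ?thesis using fan_dim_span[OF fan H(1,2)] H(3) dimW by linarith
    qed
    then have "dim (insert ?x (W \<inter> ?S)) < dim W" by (simp add: dim_insert)
    moreover have "insert ?x (W \<inter> ?S) \<subseteq> W" using xW by auto
    ultimately obtain u where "u \<in> W" "u \<noteq> 0" "\<forall>y\<in>insert ?x (W \<inter> ?S). u \<bullet> y = 0"
      using subspace_thin[OF subW(1)] by blast
    then show ?thesis using pc_subset_span[of r \<tau>] by blast
  qed
  have "(\<lambda>X Y. adj X Y \<and> Y \<in> \<Phi> \<and> (\<exists>z\<in>W. z \<noteq> 0 \<and> z \<in> pc r (X \<inter> Y)))\<^sup>*\<^sup>* F G"
    by (rule facet_path[OF fan _ subW subset_refl subspace_imp_convex[OF subW(1)] F(1) d(1) xW(1) G(1) d'(1) xW(2)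
          zero_less_one]) (use k thin in auto)
  then show ?thesis
  proof (rule rtranclp_mono[THEN predicate2D, rotated], intro predicate2I)
    fix X Y assume *: "adj X Y \<and> Y \<in> \<Phi> \<and> (\<exists>z\<in>W. z \<noteq> 0 \<and> z \<in> pc r (X \<inter> Y))"
    then obtain z where z: "a \<bullet> z = 0" "z \<noteq> 0" "z \<in> pc r (X \<inter> Y)" by (auto simp: W_def)
    have "finite (X \<inter> Y)" using * fan_facet[OF fan] by blast
    then have "(\<exists>v\<in>X \<inter> Y. 0 < a \<bullet> r v) \<and> (\<exists>v\<in>X \<inter> Y. a \<bullet> r v < 0)"
      by (rule pc_both_signs[OF _ z(3,2,1)]) (use a(2) * in blast)
    then show "adj X Y \<and> Y \<in> \<Phi> \<and> (\<exists>v\<in>X \<inter> Y. 0 < a \<bullet> r v) \<and> (\<exists>v\<in>X \<inter> Y. a \<bullet> r v < 0)"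
      using * by blast
  qed
qed

section \<open>Nearest points\<close>

definition near_pt :: "('v \<Rightarrow> 'a::euclidean_space) \<Rightarrow> 'a \<Rightarrow> 'v set \<Rightarrow> 'a"
  where "near_pt r a A = closest_point (pc r A) a"

text \<open>The face of \<open>pc r A\<close> whose relative interior contains the point of \<open>pc r A\<close> nearest to \<open>a\<close>.
  The norm of this point is the cosine of the angular distance when \<open>norm a = 1\<close>, so a larger
  norm means that a growing cap around \<open>a\<close> meets \<open>A\<close> earlier.\<close>

definition carrier :: "('v \<Rightarrow> 'a::euclidean_space) \<Rightarrow> 'a \<Rightarrow> 'v set \<Rightarrow> 'v set"
  where "carrier r a A = (SOME \<sigma>. \<sigma> \<subseteq> A \<and>
    (\<exists>c. (\<forall>v\<in>\<sigma>. 0 < c v) \<and> near_pt r a A = (\<Sum>v\<in>\<sigma>. c v *\<^sub>R r v)))"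

text \<open>The optimality inequality for convex sets, tested at 0 and at twice the nearest point,
  gives orthogonality; it then reduces to a sign condition on the whole cone.\<close>

lemma near_pt:
  fixes r :: "'v \<Rightarrow> 'a::euclidean_space"
  assumes A: "finite A"
  shows "near_pt r a A \<in> pc r A" "(a - near_pt r a A) \<bullet> near_pt r a A = 0"
    "y \<in> pc r A \<Longrightarrow> (a - near_pt r a A) \<bullet> y \<le> 0"
proof -
  let ?q = "near_pt r a A"
  have cl: "closed (pc r A)" and cv: "convex (pc r A)"
    using A by (auto simp: pc_closed pc_convex)
  show q: "?q \<in> pc r A"
    unfolding near_pt_def using closest_point_in_set[OF cl] pc_0[of r A] by blast
  have dot: "(a - ?q) \<bullet> (y - ?q) \<le> 0" if "y \<in> pc r A" for y
    unfolding near_pt_def using closest_point_dot[OF cv cl that] .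
  have "2 *\<^sub>R ?q \<in> pc r A" using pc_scale[OF q] by simp
  from dot[OF this] dot[OF pc_0] show z: "(a - ?q) \<bullet> ?q = 0"
    by (simp add: inner_diff_right scaleR_2)
  show "y \<in> pc r A \<Longrightarrow> (a - ?q) \<bullet> y \<le> 0"
    using dot[of y] z by (simp add: inner_diff_right)
qed

lemma near_pt_unique:
  fixes r :: "'v \<Rightarrow> 'a::euclidean_space"
  assumes A: "finite A" and q: "q \<in> pc r A" "(a - q) \<bullet> q = 0" "\<And>v. v \<in> A \<Longrightarrow> (a - q) \<bullet> r v \<le> 0"
  shows "near_pt r a A = q"
proof -
  have "dist a q \<le> dist a z" if z: "z \<in> pc r A" for z
  proof -
    obtain c where c: "\<And>v. v \<in> A \<Longrightarrow> 0 \<le> c v" "z = (\<Sum>v\<in>A. c v *\<^sub>R r v)"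
      using pcE[OF z] by metis
    have "(a - q) \<bullet> z \<le> 0"
      unfolding c(2) inner_sum_right using c(1) q(3)
      by (intro sum_nonpos) (auto simp: mult_nonneg_nonpos)
    then have "(a - q) \<bullet> (z - q) \<le> 0" using q(2) by (simp add: inner_diff_right)
    moreover have "(a - z) \<bullet> (a - z) = (a - q) \<bullet> (a - q) - 2 * ((a - q) \<bullet> (z - q)) + (z - q) \<bullet> (z - q)"
      by (simp add: inner_diff_left inner_diff_right inner_commute)
    ultimately have "(a - q) \<bullet> (a - q) \<le> (a - z) \<bullet> (a - z)"
      using inner_ge_zero[of "z - q"] by linarith
    then show ?thesis by (simp add: dist_norm norm_le)
  qed
  then show ?thesis
    unfolding near_pt_def
    using closest_point_unique[OF pc_convex[OF A] pc_closed[OF A] q(1)] by metis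
qed

text \<open>When a - q is orthogonal to q, the squared distance from a to q is |a|^2 - |q|^2, so
  nearer means longer. The ray \<open>r w\<close> shows that \<open>q\<close> is not the nearest
  point.\<close>

lemma near_pt_farther:
  fixes r :: "'v \<Rightarrow> 'a::euclidean_space"
  assumes A: "finite A" and q: "q \<in> pc r A" "(a - q) \<bullet> q = 0" and w: "w \<in> A" "0 < (a - q) \<bullet> r w"
  shows "norm q < norm (near_pt r a A)"
proof -
  let ?p = "near_pt r a A"
  have "?p \<noteq> q" using near_pt(3)[OF A pc_gen[OF A w(1), of r], of a] w(2) by auto
  then have "dist a ?p < dist a q"
    using closest_point_lt[OF pc_convex[OF A] pc_closed[OF A] q(1)] unfolding near_pt_def by metis
  then have "(a - ?p) \<bullet> (a - ?p) < (a - q) \<bullet> (a - q)"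
    by (simp add: dist_norm norm_lt)
  moreover have "(a - q) \<bullet> (a - q) = a \<bullet> a - q \<bullet> q"
    using q(2) by (simp add: inner_diff_left inner_diff_right inner_commute)
  moreover have "(a - ?p) \<bullet> (a - ?p) = a \<bullet> a - ?p \<bullet> ?p"
    using near_pt(2)[OF A, where a = a and r = r] by (simp add: inner_diff_left inner_diff_right inner_commute)
  ultimately show ?thesis by (simp add: norm_lt)
qed

lemma near_pt_pos:
  fixes r :: "'v \<Rightarrow> 'a::euclidean_space"
  assumes "finite A" "v \<in> A" "0 < a \<bullet> r v"
  shows "near_pt r a A \<noteq> 0"
  using near_pt_farther[OF assms(1) pc_0, of a v r] assms by auto

lemma carrier:
  fixes r :: "'v \<Rightarrow> 'a::euclidean_space"
  assumes A: "finite A"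
  obtains c where "carrier r a A \<subseteq> A" "\<And>v. v \<in> carrier r a A \<Longrightarrow> 0 < c v"
    "near_pt r a A = (\<Sum>v\<in>carrier r a A. c v *\<^sub>R r v)"
proof -
  obtain c where c: "\<And>v. v \<in> A \<Longrightarrow> 0 \<le> c v" "near_pt r a A = (\<Sum>v\<in>A. c v *\<^sub>R r v)"
    using pcE[OF near_pt(1)[OF A]] by metis
  have "near_pt r a A = (\<Sum>v\<in>{v \<in> A. 0 < c v}. c v *\<^sub>R r v)"
    unfolding c(2) using A c(1) by (intro sum.mono_neutral_right) (auto simp: less_le)
  then have "\<exists>\<sigma>. \<sigma> \<subseteq> A \<and> (\<exists>c. (\<forall>v\<in>\<sigma>. 0 < c v) \<and> near_pt r a A = (\<Sum>v\<in>\<sigma>. c v *\<^sub>R r v))"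
    by (intro exI[of _ "{v \<in> A. 0 < c v}"] conjI exI[of _ c]) auto
  from someI_ex[OF this, folded carrier_def] show thesis using that by blast
qed

lemma carrier_subset: "finite A \<Longrightarrow> carrier r a A \<subseteq> A"
  by (rule carrier)

lemma near_pt_carrier:
  assumes "finite A" shows "near_pt r a A \<in> pc r (carrier r a A)"
proof -
  obtain c where "carrier r a A \<subseteq> A" "\<And>v. v \<in> carrier r a A \<Longrightarrow> 0 < c v"
    "near_pt r a A = (\<Sum>v\<in>carrier r a A. c v *\<^sub>R r v)"
    by (rule carrier[OF assms, of r a]) (rule that)
  then show ?thesis unfolding pc_def by (auto intro: less_imp_le)
qed

text \<open>Complementary slackness: the products with the rays of the carrier are nonpositive, and
  their sum with positive weights is 0.\<close>

lemma carrier_orth: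
  fixes r :: "'v \<Rightarrow> 'a::euclidean_space"
  assumes A: "finite A" and u: "u \<in> carrier r a A"
  shows "(a - near_pt r a A) \<bullet> r u = 0"
proof -
  let ?q = "near_pt r a A"
  obtain c where c: "carrier r a A \<subseteq> A" "\<And>v. v \<in> carrier r a A \<Longrightarrow> 0 < c v"
    "?q = (\<Sum>v\<in>carrier r a A. c v *\<^sub>R r v)"
    by (rule carrier[OF A, of r a]) (rule that)
  have fin: "finite (carrier r a A)" using c(1) A finite_subset by blast
  have le: "(a - ?q) \<bullet> r v \<le> 0" if "v \<in> carrier r a A" for v
    using near_pt(3)[OF A pc_gen[OF A]] that c(1) by blast
  have "(\<Sum>v\<in>carrier r a A. c v * ((a - ?q) \<bullet> r v)) = (a - ?q) \<bullet> (\<Sum>v\<in>carrier r a A. c v *\<^sub>R r v)"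
    by (simp add: inner_sum_right)
  also have "\<dots> = 0" unfolding c(3)[symmetric] by (rule near_pt(2)[OF A])
  finally have "(\<Sum>v\<in>carrier r a A. - (c v * ((a - ?q) \<bullet> r v))) = 0" by (simp add: sum_negf)
  then have "- (c u * ((a - ?q) \<bullet> r u)) = 0"
    using sum_nonneg_eq_0_iff[OF fin, of "\<lambda>v. - (c v * ((a - ?q) \<bullet> r v))"] le c(2) u
    by (auto simp: mult_nonneg_nonpos less_imp_le)
  then show ?thesis using c(2)[OF u] by simp
qed

text \<open>The nearest point q satisfies a \<bullet> q = q \<bullet> q > 0. Consequently every
  facet around the carrier meets the open half-space.\<close>

lemma carrier_positive:
  fixes r :: "'v \<Rightarrow> 'a::euclidean_space"
  assumes A: "finite A" and nz: "near_pt r a A \<noteq> 0"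
  shows "\<exists>u\<in>carrier r a A. 0 < a \<bullet> r u"
proof (rule ccontr)
  assume no: "\<not> (\<exists>u\<in>carrier r a A. 0 < a \<bullet> r u)"
  let ?q = "near_pt r a A"
  obtain c where "carrier r a A \<subseteq> A" and
    c: "\<And>v. v \<in> carrier r a A \<Longrightarrow> 0 < c v" "?q = (\<Sum>v\<in>carrier r a A. c v *\<^sub>R r v)"
    by (rule carrier[OF A, of r a]) (rule that)
  have "(\<Sum>v\<in>carrier r a A. c v * (a \<bullet> r v)) \<le> 0"
    using no c(1) by (intro sum_nonpos) (auto simp: mult_nonneg_nonpos not_less less_imp_le)
  then have "a \<bullet> (\<Sum>v\<in>carrier r a A. c v *\<^sub>R r v) \<le> 0" by (simp add: inner_sum_right)
  then have "a \<bullet> ?q \<le> 0" unfolding c(2)[symmetric] .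
  moreover have "a \<bullet> ?q = ?q \<bullet> ?q" using near_pt(2)[OF A] by (simp add: inner_diff_left)
  moreover have "0 < ?q \<bullet> ?q" using nz by simp
  ultimately show False by linarith
qed

context
  fixes k :: nat and L :: "'a::euclidean_space set" and \<Phi> :: "'v set set" and r :: "'v \<Rightarrow> 'a" and a :: 'a
  assumes fan: "fan k L \<Phi> r" and aL: "a \<in> L"
begin

text \<open>Together with \<open>star_near\<close> this is a dichotomy for the facets around the
  carrier of \<open>A\<close>, with q the nearest point of \<open>A\<close>: either some vertex is
  on the positive side of a - q and the cap meets the facet strictly earlier, or the cap first meets
  it at q, with the same carrier.\<close>

lemma star_far:
  assumes A: "finite A" and G: "finite G" "carrier r a A \<subseteq> G" "w \<in> G" "0 < (a - near_pt r a A) \<bullet> r w"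
  shows "norm (near_pt r a A) < norm (near_pt r a G)"
proof (rule near_pt_farther[where q = "near_pt r a A" and a = a and w = w])
  show "(a - near_pt r a A) \<bullet> near_pt r a A = 0" by (rule near_pt(2)[OF A])
  show "near_pt r a A \<in> pc r G"
    using near_pt_carrier[OF A] pc_mono[OF G(1,2)] by blast
qed (use G in auto)

text \<open>Both carriers have the common nearest point in their relative interior, so
  \<open>fan_support\<close> gives the two inclusions.\<close>

lemma star_near:
  assumes A: "A \<subseteq> F" "F \<in> \<Phi>" and G: "G \<in> \<Phi>" "carrier r a A \<subseteq> G"
    and no: "\<And>w. w \<in> G \<Longrightarrow> (a - near_pt r a A) \<bullet> r w \<le> 0"
  shows "near_pt r a G = near_pt r a A" "carrier r a G = carrier r a A"
proof -
  have fin: "finite F" "finite A" "finite G" using A G fan_facet[OF fan] finite_subset by blast+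
  have "near_pt r a A \<in> pc r G"
    using near_pt_carrier[OF fin(2)] pc_mono[OF fin(3) G(2)] by blast
  then show eq: "near_pt r a G = near_pt r a A"
    by (rule near_pt_unique[OF fin(3) _ near_pt(2)[OF fin(2)] no])
  have sub: "carrier r a A \<subseteq> F" "carrier r a G \<subseteq> G"
    using carrier_subset[OF fin(2), of r a] carrier_subset[OF fin(3), of r a] A by auto
  obtain c where "carrier r a A \<subseteq> A" and c: "\<And>v. v \<in> carrier r a A \<Longrightarrow> 0 < c v"
    "near_pt r a A = (\<Sum>v\<in>carrier r a A. c v *\<^sub>R r v)"
    by (rule carrier[OF fin(2), of r a]) (rule that)
  obtain d where "carrier r a G \<subseteq> G" and d: "\<And>v. v \<in> carrier r a G \<Longrightarrow> 0 < d v"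
    "near_pt r a G = (\<Sum>v\<in>carrier r a G. d v *\<^sub>R r v)"
    by (rule carrier[OF fin(3), of r a]) (rule that)
  have 1: "(\<Sum>v\<in>carrier r a A. c v *\<^sub>R r v) \<in> pc r (carrier r a G)"
    unfolding c(2)[symmetric] eq[symmetric] by (rule near_pt_carrier[OF fin(3)])
  have 2: "(\<Sum>v\<in>carrier r a G. d v *\<^sub>R r v) \<in> pc r (carrier r a A)"
    unfolding d(2)[symmetric] eq by (rule near_pt_carrier[OF fin(2)])
  show "carrier r a G = carrier r a A"
  proof (intro subset_antisym subsetI)
    fix v assume v: "v \<in> carrier r a G"
    show "v \<in> carrier r a A"
      by (rule fan_support[OF fan G(1) sub(2) A(2) sub(1) _ 2 v d(1)[OF v]]) (use d in \<open>auto intro: less_imp_le\<close>)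
  next
    fix v assume v: "v \<in> carrier r a A"
    show "v \<in> carrier r a G"
      by (rule fan_support[OF fan A(2) sub(1) G(1) sub(2) _ 1 v c(1)[OF v]]) (use c in \<open>auto intro: less_imp_le\<close>)
  qed
qed

text \<open>A cone meets the open half-space exactly when one of its rays lies in it, so testing
  vertices suffices.\<close>

definition upper :: "'v set set"
  where "upper = {F \<in> \<Phi>. \<exists>v\<in>F. 0 < a \<bullet> r v}"

lemma star_upper:
  assumes "finite A" "near_pt r a A \<noteq> 0" "G \<in> \<Phi>" "carrier r a A \<subseteq> G"
  shows "G \<in> upper"
  using carrier_positive[OF assms(1,2)] assms(3,4) by (auto simp: upper_def)

lemma apex_near_pt:
  assumes "F \<in> \<Phi>" "a \<in> pc r F"
  shows "near_pt r a F = a"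
  by (rule near_pt_unique) (use fan_facet[OF fan assms(1)] assms in auto)

text \<open>One step in growing the tree. Looking at a missing facet \<open>G\<close> that the cap
  meets first guarantees that some facet around its carrier is already present.\<close>

lemma upper_extend:
  assumes F0: "F\<^sub>0 \<in> \<Phi>" "a \<in> pc r F\<^sub>0" and A: "A \<subseteq> upper" "F\<^sub>0 \<in> A" "A \<noteq> upper"
  shows "\<exists>X\<in>A. \<exists>Y\<in>upper - A. adj X Y \<and> carrier r a Y \<subseteq> X"
proof -
  have finU: "finite (upper - A)" using fan_finite[OF fan] by (auto simp: upper_def)
  have "upper - A \<noteq> {}" using A by auto
  define M where "M = Max ((\<lambda>H. norm (near_pt r a H)) ` (upper - A))"
  have "M \<in> (\<lambda>H. norm (near_pt r a H)) ` (upper - A)"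
    unfolding M_def using finU \<open>upper - A \<noteq> {}\<close> by (intro Max_in) auto
  then obtain G where G: "G \<in> upper - A" "norm (near_pt r a G) = M" by auto
  have max: "norm (near_pt r a H) \<le> norm (near_pt r a G)" if "H \<in> upper - A" for H
    unfolding G(2) M_def using finU that by (intro Max_ge) auto
  let ?q = "near_pt r a G" and ?\<sigma> = "carrier r a G"
  have G\<Phi>: "G \<in> \<Phi>" using G(1) by (auto simp: upper_def)
  then have finG: "finite G" using fan_facet[OF fan] by blast
  have qnz: "?q \<noteq> 0" using G(1) near_pt_pos[OF finG] by (auto simp: upper_def)
  have \<sigma>G: "?\<sigma> \<subseteq> G" by (rule carrier_subset[OF finG])
  \<comment> \<open>Either the nearest point is \<open>a\<close> itself, and the root contains its
    carrier, or the direction from the nearest point to \<open>a\<close> lies in the cone of a facet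
    of the link; the corresponding facet is met strictly earlier, so by maximality it is
    present.\<close>
  have "\<exists>X\<in>A. ?\<sigma> \<subseteq> X"
  proof (cases "?q = a")
    case True
    obtain c where "?\<sigma> \<subseteq> G" and c: "\<And>v. v \<in> ?\<sigma> \<Longrightarrow> 0 < c v" "?q = (\<Sum>v\<in>?\<sigma>. c v *\<^sub>R r v)"
      by (rule carrier[OF finG, of r a]) (rule that)
    have "(\<Sum>v\<in>?\<sigma>. c v *\<^sub>R r v) \<in> pc r F\<^sub>0" unfolding c(2)[symmetric] True by (rule F0(2))
    then have "?\<sigma> \<subseteq> F\<^sub>0"
      using fan_support[OF fan G\<Phi> \<sigma>G F0(1) subset_refl, where c = c] c(1) by (meson less_imp_le subsetI)
    then show ?thesis using A(2) by blast
  next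
    case False
    obtain L' :: "'a set" and r' where f': "fan (k - card ?\<sigma>) L' (link \<Phi> ?\<sigma>) r'"
      and L': "L' = {y \<in> L. \<forall>u\<in>?\<sigma>. y \<bullet> r u = 0}"
      and r': "\<And>v c. (\<And>u. u \<in> ?\<sigma> \<Longrightarrow> c \<bullet> r u = 0) \<Longrightarrow> c \<bullet> r' v = c \<bullet> r v"
      by (rule fan_link[OF fan G\<Phi> \<sigma>G]) blast
    have orth: "(a - ?q) \<bullet> r u = 0" if "u \<in> ?\<sigma>" for u by (rule carrier_orth[OF finG that])
    have "?q \<in> L" using near_pt(1)[OF finG] pc_subset_L[OF fan G\<Phi> subset_refl] by blast
    then have "a - ?q \<in> L'" using aL orth fan_subspace[OF fan] by (simp add: L' subspace_diff)
    then obtain X' where X': "X' \<in> link \<Phi> ?\<sigma>" "a - ?q \<in> pc r' X'"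
      using fan_cover[OF f'] by blast
    then obtain X where X: "X \<in> \<Phi>" "?\<sigma> \<subseteq> X" "X' = X - ?\<sigma>" by (metis link_memE)
    obtain c where c: "\<And>v. v \<in> X' \<Longrightarrow> 0 \<le> c v" "a - ?q = (\<Sum>v\<in>X'. c v *\<^sub>R r' v)"
      using pcE[OF X'(2)] by metis
    have "\<exists>w\<in>X'. 0 < (a - ?q) \<bullet> r' w"
    proof (rule ccontr)
      assume "\<not> (\<exists>w\<in>X'. 0 < (a - ?q) \<bullet> r' w)"
      then have "(\<Sum>v\<in>X'. c v * ((a - ?q) \<bullet> r' v)) \<le> 0"
        using c(1) by (intro sum_nonpos) (auto simp: mult_nonneg_nonpos not_less)
      then have "(a - ?q) \<bullet> (\<Sum>v\<in>X'. c v *\<^sub>R r' v) \<le> 0" by (simp add: inner_sum_right)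
      then have "(a - ?q) \<bullet> (a - ?q) \<le> 0" unfolding c(2)[symmetric] .
      then have "a - ?q = 0" by (meson inner_eq_zero_iff inner_ge_zero order_antisym)
      then show False using False by simp
    qed
    then obtain w where w: "w \<in> X" "0 < (a - ?q) \<bullet> r w"
      using r'[OF orth] X(3) by auto
    have finX: "finite X" using fan_facet[OF fan X(1)] by blast
    have "norm ?q < norm (near_pt r a X)" by (rule star_far[OF finG finX X(2) w])
    then have "X \<notin> upper - A" using max[of X] by linarith
    moreover have "X \<in> upper" by (rule star_upper[OF finG qnz X(1,2)])
    ultimately show ?thesis using X(2) by blast
  qed
  then obtain X where X: "X \<in> A" "?\<sigma> \<subseteq> X" by blast
  then have X\<Phi>: "X \<in> \<Phi>" using A by (auto simp: upper_def)
  have path: "(\<lambda>X Y. adj X Y \<and> Y \<in> \<Phi> \<and> ?\<sigma> \<subseteq> Y \<and> ?\<sigma> \<subseteq> X)\<^sup>*\<^sup>* X G"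
    by (rule fan_star_connected[OF fan X\<Phi> X(2) G\<Phi> \<sigma>G])
  \<comment> \<open>Some edge of the path leaves \<open>A\<close>. Its end \<open>Z\<close> is not
    met earlier than \<open>G\<close>, by maximality, so the dichotomy gives it the same carrier,
    which \<open>Y\<close> contains.\<close>
  have "\<exists>Y\<in>A. \<exists>Z. Z \<notin> A \<and> adj Y Z \<and> Z \<in> \<Phi> \<and> ?\<sigma> \<subseteq> Z \<and> ?\<sigma> \<subseteq> Y"
  proof (rule ccontr)
    assume no: "\<not> ?thesis"
    have "H \<in> A" if "(\<lambda>X Y. adj X Y \<and> Y \<in> \<Phi> \<and> ?\<sigma> \<subseteq> Y \<and> ?\<sigma> \<subseteq> X)\<^sup>*\<^sup>* X H" for H
      using that by (induction rule: rtranclp_induct) (use X(1) no in blast)+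
    from this[OF path] show False using G(1) by blast
  qed
  then obtain Y Z where YZ: "Y \<in> A" "Z \<notin> A" "adj Y Z" "Z \<in> \<Phi>" "?\<sigma> \<subseteq> Z" "?\<sigma> \<subseteq> Y" by blast
  have finZ: "finite Z" using fan_facet[OF fan YZ(4)] by blast
  have ZU: "Z \<in> upper - A" using star_upper[OF finG qnz YZ(4,5)] YZ(2) by blast
  have "(a - ?q) \<bullet> r w \<le> 0" if "w \<in> Z" for w
  proof (rule ccontr)
    assume "\<not> (a - ?q) \<bullet> r w \<le> 0"
    then have "norm ?q < norm (near_pt r a Z)"
      by (intro star_far[OF finG finZ YZ(5) that]) simp
    then show False using max[OF ZU] by simp
  qed
  then have "carrier r a Z = ?\<sigma>" by (rule star_near(2)[OF subset_refl G\<Phi> YZ(4,5)])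
  then show ?thesis using YZ ZU by (intro bexI[of _ Y] bexI[of _ Z]) auto
qed

end

section \<open>Trees of a half-space\<close>

text \<open>Adds the elements of \<open>U\<close> one by one; \<open>rank\<close> is the time of the addition.\<close>

lemma parent_exists:
  assumes "finite U" "F \<in> U"
    and ext: "\<And>A. A \<subseteq> U \<Longrightarrow> F \<in> A \<Longrightarrow> A \<noteq> U \<Longrightarrow> \<exists>X\<in>A. \<exists>Y\<in>U - A. P X Y"
  obtains par and rank :: "'b \<Rightarrow> nat" where
    "\<And>Y. Y \<in> U \<Longrightarrow> Y \<noteq> F \<Longrightarrow> par Y \<in> U \<and> P (par Y) Y \<and> rank (par Y) < rank Y"
    "\<And>Y. Y \<in> U \<Longrightarrow> rank Y < card U"
proof -
  define good where "good A par rank n \<longleftrightarrow> A \<subseteq> U \<and> F \<in> A \<and> card A = n \<and>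
      (\<forall>Y\<in>A. rank Y < n \<and> (Y \<noteq> F \<longrightarrow> par Y \<in> A \<and> P (par Y) Y \<and> rank (par Y) < rank Y))"
    for A par and rank :: "'b \<Rightarrow> nat" and n
  have "\<exists>A par rank. good A par rank (Suc n)" if "Suc n \<le> card U" for n
    using that
  proof (induction n)
    case 0
    have "good {F} id (\<lambda>_. 0) (Suc 0)" using assms(2) by (simp add: good_def)
    then show ?case by blast
  next
    case (Suc n)
    then obtain A par rank where g: "good A par rank (Suc n)" by (meson Suc_leD)
    then have A: "A \<subseteq> U" "F \<in> A" "card A = Suc n"
      and pr: "\<And>Y. Y \<in> A \<Longrightarrow> rank Y < Suc n \<and> (Y \<noteq> F \<longrightarrow> par Y \<in> A \<and> P (par Y) Y \<and> rank (par Y) < rank Y)"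
      by (simp_all add: good_def)
    have "A \<noteq> U" using A(3) Suc.prems by auto
    then obtain X Y where XY: "X \<in> A" "Y \<in> U - A" "P X Y" using ext[OF A(1,2)] by blast
    have "finite A" using A(1) assms(1) finite_subset by blast
    define par' where "par' = par(Y := X)"
    define rank' where "rank' = rank(Y := Suc n)"
    have old: "par' Z = par Z" "rank' Z = rank Z" if "Z \<in> A" for Z
      using that XY(2) by (auto simp: par'_def rank'_def)
    have new: "par' Y = X" "rank' Y = Suc n" by (auto simp: par'_def rank'_def)
    have "rank' Z < Suc (Suc n) \<and>
        (Z \<noteq> F \<longrightarrow> par' Z \<in> insert Y A \<and> P (par' Z) Z \<and> rank' (par' Z) < rank' Z)"
      if "Z \<in> insert Y A" for Z
    proof (cases "Z = Y")
      case True
      then show ?thesis using new XY pr old[OF XY(1)] by auto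
    next
      case False
      then have "Z \<in> A" using that by simp
      then show ?thesis using pr[OF \<open>Z \<in> A\<close>] old[OF \<open>Z \<in> A\<close>] old[of "par Z"] by auto
    qed
    then have "good (insert Y A) par' rank' (Suc (Suc n))"
      using A XY \<open>finite A\<close> by (simp add: good_def)
    then show ?case by blast
  qed
  moreover have "card U \<noteq> 0" using assms by auto
  ultimately obtain A par rank where g: "good A par rank (card U)"
    by (metis Suc_pred' dual_order.refl not_gr0)
  then have "A = U" using card_subset_eq[OF assms(1), of A] by (simp add: good_def)
  then show thesis using that[of par rank] g by (simp add: good_def)
qed

text \<open>The tree with parent function \<open>par\<close> and slots \<open>sl\<close>, explored from \<open>\<kappa>\<close> to depth less than \<open>n\<close>.\<close>

primrec grow :: "nat \<Rightarrow> 'v set set \<Rightarrow> 'v set set \<Rightarrow> 'v set \<Rightarrow> ('v set \<Rightarrow> 'v set) \<Rightarrow>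
    ('v list \<Rightarrow> rose list) \<Rightarrow> nat \<Rightarrow> 'v list \<Rightarrow> rose" where
  "grow k \<Phi> U F\<^sub>0 par sl 0 \<kappa> = leaf"
| "grow k \<Phi> U F\<^sub>0 par sl (Suc n) \<kappa> = Rose [Rose (sl \<kappa>), Rose (map (\<lambda>i.
     if set (nb \<Phi> \<kappa> i) \<in> U \<and> set (nb \<Phi> \<kappa> i) \<noteq> F\<^sub>0 \<and> par (set (nb \<Phi> \<kappa> i)) = set \<kappa>
     then grow k \<Phi> U F\<^sub>0 par sl n (nb \<Phi> \<kappa> i) else leaf) [0..<k])]"

lemma child_grow:
  "i < k \<Longrightarrow> child (grow k \<Phi> U F\<^sub>0 par sl (Suc n) \<kappa>) i =
    (if set (nb \<Phi> \<kappa> i) \<in> U \<and> set (nb \<Phi> \<kappa> i) \<noteq> F\<^sub>0 \<and> par (set (nb \<Phi> \<kappa> i)) = set \<kappa>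
     then grow k \<Phi> U F\<^sub>0 par sl n (nb \<Phi> \<kappa> i) else leaf)"
  by simp

lemma walk_Cons: "walk \<Phi> \<kappa> (i # p) = walk \<Phi> (nb \<Phi> \<kappa> i) p"
  by (simp add: walk_def)

lemma addr_grow_length: "p \<in> addr k (grow k \<Phi> U F\<^sub>0 par sl n \<kappa>) \<Longrightarrow> length p < n"
  proof (induction n arbitrary: p \<kappa>)
    case 0
    then show ?case by (simp add: addr_def)
  next
    case (Suc n)
    show ?case
    proof (cases p)
      case (Cons i q)
      then have i: "i < k" and q: "set q \<subseteq> {..<k}"
        and nl: "subtree (child (grow k \<Phi> U F\<^sub>0 par sl (Suc n) \<kappa>) i) q \<noteq> leaf"
        using Suc.prems by (auto simp: addr_def simp del: grow.simps)
      then have "child (grow k \<Phi> U F\<^sub>0 par sl (Suc n) \<kappa>) i = grow k \<Phi> U F\<^sub>0 par sl n (nb \<Phi> \<kappa> i)"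
        using child_grow[OF i] by (metis subtree_leaf)
      then have "q \<in> addr k (grow k \<Phi> U F\<^sub>0 par sl n (nb \<Phi> \<kappa> i))"
        using nl q by (simp add: addr_def)
      then show ?thesis using Suc.IH Cons by auto
    qed simp
  qed

lemma finite_addr_grow: "finite (addr k (grow k \<Phi> U F\<^sub>0 par sl n \<kappa>))"
proof -
  have "addr k (grow k \<Phi> U F\<^sub>0 par sl n \<kappa>) \<subseteq> {p. set p \<subseteq> {..<k} \<and> length p \<le> n}"
    using addr_grow_length by (fastforce simp: addr_def)
  then show ?thesis
    by (rule finite_subset) (rule finite_lists_length_le, simp)
qed

text \<open>A node pays for its two lists, its slots and the roots of its \<open>k\<close> children,
  a missing child being a single leaf; the leading 1 is the root of the whole tree.\<close>

lemma rsize_grow: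
  "rsize (grow k \<Phi> U F\<^sub>0 par sl n \<kappa>) \<le>
    1 + (\<Sum>p\<in>addr k (grow k \<Phi> U F\<^sub>0 par sl n \<kappa>). 2 + k + sum_list (map rsize (sl (walk \<Phi> \<kappa> p))))"
proof (induction n arbitrary: \<kappa>)
  case 0
  then show ?case by simp
next
  case (Suc n)
  let ?t = "grow k \<Phi> U F\<^sub>0 par sl (Suc n) \<kappa>"
  let ?w = "\<lambda>\<kappa>. 2 + k + sum_list (map rsize (sl \<kappa>))"
  let ?ch = "\<lambda>i. set (nb \<Phi> \<kappa> i) \<in> U \<and> set (nb \<Phi> \<kappa> i) \<noteq> F\<^sub>0 \<and> par (set (nb \<Phi> \<kappa> i)) = set \<kappa>"
  let ?c = "\<lambda>i. if ?ch i then grow k \<Phi> U F\<^sub>0 par sl n (nb \<Phi> \<kappa> i) else leaf"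
  have c: "child ?t i = ?c i" if "i < k" for i by (rule child_grow[OF that])
  have fin: "finite (addr k (?c i))" for i
    by (cases "?ch i") (simp_all add: finite_addr_grow, simp add: addr_def)
  have size: "rsize (?c i) \<le> 1 + (\<Sum>p\<in>addr k (?c i). ?w (walk \<Phi> \<kappa> (i # p)))" for i
    using Suc.IH[of "nb \<Phi> \<kappa> i"] by (auto simp: walk_Cons)
  have sub: "insert [] (\<Union>i<k. Cons i ` addr k (?c i)) \<subseteq> addr k ?t"
  proof
    fix p assume "p \<in> insert [] (\<Union>i<k. Cons i ` addr k (?c i))"
    then consider "p = []" | i q where "i < k" "q \<in> addr k (?c i)" "p = i # q" by auto
    then show "p \<in> addr k ?t"
    proof cases
      case 1
      then show ?thesis by (simp add: addr_def)
    next
      case 2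
      have "subtree ?t p = subtree (?c i) q" using 2(3) c[OF 2(1)] by (simp only: subtree_simps)
      then show ?thesis using 2 by (auto simp: addr_def)
    qed
  qed
  have "rsize ?t = 3 + sum_list (map rsize (sl \<kappa>)) + (\<Sum>i<k. rsize (?c i))"
    by (simp add: comp_def interv_sum_list_conv_sum_set_nat atLeast0LessThan)
  also have "\<dots> \<le> 3 + sum_list (map rsize (sl \<kappa>)) + (\<Sum>i<k. 1 + (\<Sum>p\<in>addr k (?c i). ?w (walk \<Phi> \<kappa> (i # p))))"
    using size by (intro add_left_mono sum_mono) blast
  also have "\<dots> = 1 + (?w \<kappa> + (\<Sum>i<k. \<Sum>p\<in>addr k (?c i). ?w (walk \<Phi> \<kappa> (i # p))))"
    unfolding sum.distrib by simp
  also have "(\<Sum>i<k. \<Sum>p\<in>addr k (?c i). ?w (walk \<Phi> \<kappa> (i # p))) =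
      (\<Sum>i<k. \<Sum>q\<in>Cons i ` addr k (?c i). ?w (walk \<Phi> \<kappa> q))"
    by (rule sum.cong[OF refl], subst sum.reindex) simp_all
  also have "\<dots> = (\<Sum>q\<in>(\<Union>i<k. Cons i ` addr k (?c i)). ?w (walk \<Phi> \<kappa> q))"
    using fin by (intro sum.UNION_disjoint[symmetric]) auto
  also have "?w \<kappa> + \<dots> = (\<Sum>q\<in>insert [] (\<Union>i<k. Cons i ` addr k (?c i)). ?w (walk \<Phi> \<kappa> q))"
    using fin by (subst sum.insert) auto
  also have "\<dots> \<le> (\<Sum>q\<in>addr k ?t. ?w (walk \<Phi> \<kappa> q))"
    by (rule sum_mono2[OF finite_addr_grow sub]) simp
  finally show ?case by simp
qed

context
  fixes k N :: nat and \<Phi> U :: "'v set set" and F\<^sub>0 :: "'v set" and par :: "'v set \<Rightarrow> 'v set"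
    and rank :: "'v set \<Rightarrow> nat" and sl :: "'v list \<Rightarrow> rose list" and \<kappa> :: "'v list"
  assumes P: "npm k \<Phi>" and U: "U \<subseteq> \<Phi>" and \<kappa>: "ordered_facet \<Phi> \<kappa>" "set \<kappa> = F\<^sub>0" "F\<^sub>0 \<in> U"
    and par: "\<And>Y. Y \<in> U \<Longrightarrow> Y \<noteq> F\<^sub>0 \<Longrightarrow> par Y \<in> U \<and> adj (par Y) Y \<and> rank (par Y) < rank Y"
    and rank: "\<And>Y. Y \<in> U \<Longrightarrow> rank Y < N"
begin

abbreviation (input) "tree \<equiv> grow k \<Phi> U F\<^sub>0 par sl N \<kappa>"

text \<open>\<open>Suc m\<close> is the depth left at the node. Ranks increase along tree edges and
  stay below \<open>N\<close>, so the depth never runs out too early.\<close>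

lemma grow_subtree:
  assumes "p \<in> addr k tree"
  shows "ordered_facet \<Phi> (walk \<Phi> \<kappa> p) \<and> node \<Phi> \<kappa> p \<in> U \<and>
    (\<exists>m. N \<le> Suc m + rank (node \<Phi> \<kappa> p) \<and> subtree tree p = grow k \<Phi> U F\<^sub>0 par sl (Suc m) (walk \<Phi> \<kappa> p))"
  using assms
proof (induction p rule: rev_induct)
  case Nil
  obtain m where "N = Suc m" using rank[OF \<kappa>(3)] by (cases N) auto
  then show ?case using \<kappa> by (auto simp: node_def intro!: exI[of _ m])
next
  case (snoc i p)
  have p: "p \<in> addr k tree" and i: "i < k" using snoc.prems addr_prefix by (auto simp: addr_def)
  from snoc.IH[OF p] obtain m where m: "N \<le> Suc m + rank (node \<Phi> \<kappa> p)"
    "subtree tree p = grow k \<Phi> U F\<^sub>0 par sl (Suc m) (walk \<Phi> \<kappa> p)" and o: "ordered_facet \<Phi> (walk \<Phi> \<kappa> p)"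
    by blast
  let ?Y = "node \<Phi> \<kappa> (p @ [i])"
  have "subtree tree (p @ [i]) = child (subtree tree p) i" by simp
  moreover have "subtree tree (p @ [i]) \<noteq> leaf" using snoc.prems unfolding addr_def mem_Collect_eq by (rule conjunct2)
  ultimately have Y: "?Y \<in> U" "?Y \<noteq> F\<^sub>0" "par ?Y = node \<Phi> \<kappa> p"
    and sub: "subtree tree (p @ [i]) = grow k \<Phi> U F\<^sub>0 par sl m (walk \<Phi> \<kappa> (p @ [i]))"
    using m(2) child_grow[OF i, of \<Phi> U F\<^sub>0 par sl m "walk \<Phi> \<kappa> p"]
    by (auto simp: node_def simp del: grow.simps split: if_splits)
  have "rank (node \<Phi> \<kappa> p) < rank ?Y" using par[OF Y(1,2)] Y(3) by simp
  then have "N \<le> m + rank ?Y" using m(1) by simp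
  moreover have "rank ?Y < N" using rank[OF Y(1)] .
  ultimately obtain m' where "m = Suc m'" by (cases m) auto
  then show ?case
    using Y(1) sub \<open>N \<le> m + rank ?Y\<close> nb_ordered[OF P o i] by (auto simp del: grow.simps)
qed

lemma grow_child_iff:
  assumes p: "p \<in> addr k tree" and i: "i < k"
  shows "p @ [i] \<in> addr k tree \<longleftrightarrow>
    node \<Phi> \<kappa> (p @ [i]) \<in> U \<and> node \<Phi> \<kappa> (p @ [i]) \<noteq> F\<^sub>0 \<and> par (node \<Phi> \<kappa> (p @ [i])) = node \<Phi> \<kappa> p"
proof -
  obtain m where m: "N \<le> Suc m + rank (node \<Phi> \<kappa> p)"
    "subtree tree p = grow k \<Phi> U F\<^sub>0 par sl (Suc m) (walk \<Phi> \<kappa> p)"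
    using grow_subtree[OF p] by blast
  let ?Y = "node \<Phi> \<kappa> (p @ [i])"
  have s: "subtree tree (p @ [i]) = child (subtree tree p) i" by simp
  have c: "subtree tree (p @ [i]) = (if ?Y \<in> U \<and> ?Y \<noteq> F\<^sub>0 \<and> par ?Y = node \<Phi> \<kappa> p
      then grow k \<Phi> U F\<^sub>0 par sl m (walk \<Phi> \<kappa> (p @ [i])) else leaf)"
    unfolding s m(2) child_grow[OF i] by (simp add: node_def)
  have set: "set (p @ [i]) \<subseteq> {..<k}" using p i by (auto simp: addr_def)
  show ?thesis
  proof
    assume "p @ [i] \<in> addr k tree"
    then have "subtree tree (p @ [i]) \<noteq> leaf" unfolding addr_def mem_Collect_eq by (rule conjunct2)
    then show "?Y \<in> U \<and> ?Y \<noteq> F\<^sub>0 \<and> par ?Y = node \<Phi> \<kappa> p" unfolding c by (auto split: if_splits)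
  next
    assume Y: "?Y \<in> U \<and> ?Y \<noteq> F\<^sub>0 \<and> par ?Y = node \<Phi> \<kappa> p"
    then have "N \<le> m + rank ?Y" "rank ?Y < N" using par[of ?Y] m(1) rank[of ?Y] by auto
    then obtain m' where "m = Suc m'" by (cases m) auto
    then have "subtree tree (p @ [i]) \<noteq> leaf" unfolding c using Y by simp
    with set show "p @ [i] \<in> addr k tree" unfolding addr_def mem_Collect_eq by (rule conjI)
  qed
qed

text \<open>A facet determines its parent and, by \<open>nb_inj\<close>, the port leading to it; the
  root facet is barred from being a child.\<close>

lemma grow_inj: "inj_on (node \<Phi> \<kappa>) (addr k tree)"
proof -
  have "p = q" if "p \<in> addr k tree" "q \<in> addr k tree" "node \<Phi> \<kappa> p = node \<Phi> \<kappa> q" for p q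
    using that
  proof (induction p arbitrary: q rule: rev_induct)
    case Nil
    show ?case
    proof (cases q rule: rev_cases)
      case (snoc q' j)
      have "q' \<in> addr k tree" "j < k" using Nil.prems(2) snoc addr_prefix by (auto simp: addr_def)
      then have "node \<Phi> \<kappa> q \<noteq> F\<^sub>0" using grow_child_iff[of q' j] Nil.prems(2) snoc by simp
      then show ?thesis using Nil.prems(3) \<kappa> by (simp add: node_def)
    qed simp
  next
    case (snoc i p)
    have p: "p \<in> addr k tree" "i < k" using snoc.prems(1) addr_prefix by (auto simp: addr_def)
    note cp = grow_child_iff[THEN iffD1, OF p snoc.prems(1)]
    show ?case
    proof (cases q rule: rev_cases)
      case Nil
      then show ?thesis using cp snoc.prems(3) \<kappa> by (simp add: node_def)
    next
      case (snoc q' j)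
      have q: "q' \<in> addr k tree" "j < k" using \<open>q \<in> addr k tree\<close> snoc addr_prefix by (auto simp: addr_def)
      note cq = grow_child_iff[THEN iffD1, OF q \<open>q \<in> addr k tree\<close>[unfolded snoc]]
      have e: "node \<Phi> \<kappa> (p @ [i]) = node \<Phi> \<kappa> (q' @ [j])" using snoc.prems(3) snoc by simp
      then have "node \<Phi> \<kappa> p = node \<Phi> \<kappa> q'" using cp cq by simp
      then have pq: "p = q'" using snoc.IH[OF p(1) q(1)] by simp
      have "i = j"
        by (rule nb_inj[OF P _ p(2) q(2)]) (use grow_subtree[OF p(1)] e pq in \<open>auto simp: node_def\<close>)
      then show ?thesis using pq snoc by simp
    qed
  qed
  then show ?thesis by (rule inj_onI)
qed

lemma grow_edge:
  assumes p: "p \<in> addr k tree" and Y: "Y \<in> U" "Y \<noteq> F\<^sub>0" "par Y = node \<Phi> \<kappa> p"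
  shows "\<exists>i. p @ [i] \<in> addr k tree \<and> node \<Phi> \<kappa> (p @ [i]) = Y"
proof -
  have "adj (set (walk \<Phi> \<kappa> p)) Y" using par[OF Y(1,2)] Y(3) by (simp add: node_def)
  then obtain i where i: "i < k" "set (nb \<Phi> (walk \<Phi> \<kappa> p) i) = Y"
    using adj_nb[OF P _ subsetD[OF U Y(1)]] grow_subtree[OF p] by blast
  then have "node \<Phi> \<kappa> (p @ [i]) = Y" by (simp add: node_def)
  then show ?thesis using grow_child_iff[OF p i(1)] Y by blast
qed

lemma grow_nodes: "node \<Phi> \<kappa> ` addr k tree = U"
proof (intro subset_antisym subsetI)
  fix G assume "G \<in> U"
  then show "G \<in> node \<Phi> \<kappa> ` addr k tree"
  proof (induction "rank G" arbitrary: G rule: less_induct)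
    case less
    have nil: "[] \<in> addr k tree"
    proof -
      obtain m where "N = Suc m" using rank[OF \<kappa>(3)] by (cases N) auto
      then show ?thesis by (simp add: addr_def)
    qed
    show ?case
    proof (cases "G = F\<^sub>0")
      case True
      then show ?thesis using nil \<kappa> by (force simp: node_def)
    next
      case False
      note pr = par[OF less.prems False]
      then obtain p where "p \<in> addr k tree" "node \<Phi> \<kappa> p = par G"
        using less.hyps[of "par G"] by auto
      then show ?thesis using grow_edge[OF _ less.prems False, of p] by force
    qed
  qed
qed (use grow_subtree in blast)

lemma grow_slot:
  assumes "p \<in> addr k tree" "j < length (sl (walk \<Phi> \<kappa> p))"
  shows "slot (subtree tree p) j = sl (walk \<Phi> \<kappa> p) ! j"
  using grow_subtree[OF assms(1)] assms(2) by auto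

end

text \<open>Walking back along the parents turns a prescribed ordering of any facet into an ordering of
  the root.\<close>

lemma grow_reroot:
  fixes \<Phi> U :: "'v set set" and rank :: "'v set \<Rightarrow> nat"
  assumes P: "npm k \<Phi>" and U: "U \<subseteq> \<Phi>" "F\<^sub>0 \<in> U"
    and par: "\<And>Y. Y \<in> U \<Longrightarrow> Y \<noteq> F\<^sub>0 \<Longrightarrow> par Y \<in> U \<and> adj (par Y) Y \<and> rank (par Y) < rank Y"
    and rank: "\<And>Y. Y \<in> U \<Longrightarrow> rank Y < N"
    and \<alpha>: "ordered_facet \<Phi> \<alpha>" "set \<alpha> \<in> U"
  shows "\<exists>\<kappa> p. ordered_facet \<Phi> \<kappa> \<and> set \<kappa> = F\<^sub>0 \<and> p \<in> addr k (grow k \<Phi> U F\<^sub>0 par sl N \<kappa>) \<and>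
    walk \<Phi> \<kappa> p = \<alpha>"
  using \<alpha>
proof (induction "rank (set \<alpha>)" arbitrary: \<alpha> rule: less_induct)
  case less
  show ?case
  proof (cases "set \<alpha> = F\<^sub>0")
    case True
    obtain m where "N = Suc m" using rank[OF U(2)] by (cases N) auto
    then have "[] \<in> addr k (grow k \<Phi> U F\<^sub>0 par sl N \<alpha>)" by (simp add: addr_def)
    then show ?thesis using True less.prems by (intro exI[of _ \<alpha>] exI[of _ "[]"]) simp
  next
    case False
    note pr = par[OF less.prems(2) False]
    then obtain i where i: "i < k" "set (nb \<Phi> \<alpha> i) = par (set \<alpha>)"
      using adj_nb[OF P less.prems(1), of "par (set \<alpha>)"] adj_sym U(1) by blast
    have o: "ordered_facet \<Phi> (nb \<Phi> \<alpha> i)" by (rule nb_ordered[OF P less.prems(1) i(1)])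
    obtain \<kappa> p where \<kappa>: "ordered_facet \<Phi> \<kappa>" "set \<kappa> = F\<^sub>0" "p \<in> addr k (grow k \<Phi> U F\<^sub>0 par sl N \<kappa>)"
      "walk \<Phi> \<kappa> p = nb \<Phi> \<alpha> i"
      using less.hyps[OF _ o] pr i(2) by auto
    have w: "walk \<Phi> \<kappa> (p @ [i]) = \<alpha>" using \<kappa>(4) nb_nb[OF P less.prems(1) i(1)] by simp
    have "p @ [i] \<in> addr k (grow k \<Phi> U F\<^sub>0 par sl N \<kappa>)"
      by (rule grow_child_iff[where N = N and rank = rank, THEN iffD2])
        (use P U \<kappa> par rank i w less.prems False in \<open>auto simp: node_def\<close>)
    then show ?thesis using \<kappa> w by blast
  qed
qed

lemma rtranclp_symp: "(\<And>x y. R x y \<Longrightarrow> R y x) \<Longrightarrow> R\<^sup>*\<^sup>* x y \<Longrightarrow> R\<^sup>*\<^sup>* y x"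
  by (metis rtranclp_conversep conversepI rtranclp_converseD rtranclp_mono predicate2I predicate2D)

text \<open>Completeness of the deductions on the side of \<open>a\<close>. The assumption
  \<open>host\<close> abstracts from how the slots are filled.\<close>

lemma run_known:
  fixes L :: "'a::euclidean_space set" and r :: "'v \<Rightarrow> 'a" and rank :: "'v set \<Rightarrow> nat"
    and sl :: "'v list \<Rightarrow> rose list"
  assumes fan: "fan k L \<Phi> r" and aL: "a \<in> L" and k: "2 \<le> k"
    and F\<^sub>0: "F\<^sub>0 \<in> \<Phi>" "a \<in> pc r F\<^sub>0" "F\<^sub>0 \<in> upper \<Phi> r a"
    and \<kappa>: "ordered_facet \<Phi> \<kappa>" "set \<kappa> = F\<^sub>0"
    and par: "\<And>Y. Y \<in> upper \<Phi> r a \<Longrightarrow> Y \<noteq> F\<^sub>0 \<Longrightarrow>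
      par Y \<in> upper \<Phi> r a \<and> (adj (par Y) Y \<and> carrier r a Y \<subseteq> par Y) \<and> rank (par Y) < rank Y"
    and rank: "\<And>Y. Y \<in> upper \<Phi> r a \<Longrightarrow> rank Y < N"
  defines "t \<equiv> grow k \<Phi> (upper \<Phi> r a) F\<^sub>0 par sl N \<kappa>"
  assumes host: "\<And>\<sigma> F. \<sigma> \<noteq> {} \<Longrightarrow> card \<sigma> + 2 \<le> k \<Longrightarrow> F \<in> upper \<Phi> r a \<Longrightarrow> \<sigma> \<subseteq> F \<Longrightarrow>
      \<exists>p\<in>addr k t. \<exists>j<2 ^ k. sel k (walk \<Phi> \<kappa> p) j = \<sigma> \<and> slot (subtree t p) j \<noteq> leaf"
    and FG: "F \<in> \<Phi>" "G \<in> \<Phi>" "adj F G" "v \<in> F \<inter> G" "0 < a \<bullet> r v"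
  shows "known k \<Phi> \<kappa> t F G"
proof -
  let ?U = "upper \<Phi> r a"
  have P: "npm k \<Phi>" by (rule fan_npm[OF fan])
  have U: "?U \<subseteq> \<Phi>" by (auto simp: upper_def[OF fan aL])
  have par': "\<And>Y. Y \<in> ?U \<Longrightarrow> Y \<noteq> F\<^sub>0 \<Longrightarrow> par Y \<in> ?U \<and> adj (par Y) Y \<and> rank (par Y) < rank Y"
    using par by blast
  note setting = P U \<kappa> F\<^sub>0(3) par' rank
  have inj: "inj_on (node \<Phi> \<kappa>) (addr k t)"
    unfolding t_def by (rule grow_inj[OF setting])
  have nodes: "node \<Phi> \<kappa> ` addr k t = ?U"
    unfolding t_def by (rule grow_nodes[OF setting])
  define ad where "ad X = inv_into (addr k t) (node \<Phi> \<kappa>) X" for X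
  have ad: "ad X \<in> addr k t" "node \<Phi> \<kappa> (ad X) = X" if "X \<in> ?U" for X
    using that nodes inv_into_into[of X "node \<Phi> \<kappa>" "addr k t"] f_inv_into_f[of X "node \<Phi> \<kappa>" "addr k t"]
    by (auto simp: ad_def)
  have adu: "ad (node \<Phi> \<kappa> p) = p" if "p \<in> addr k t" for p
    using inv_into_f_f[OF inj that] by (simp add: ad_def)
  have mem: "X \<in> ?U" if "X \<in> \<Phi>" "u \<in> X" "0 < a \<bullet> r u" for X u
    using that by (auto simp: upper_def[OF fan aL])
  define Fs where "Fs = (\<Union>X\<in>\<Phi>. Pow X)"
  have finFs: "finite Fs" using fan_finite[OF fan] fan_facet[OF fan] by (auto simp: Fs_def)
  have main: "Q (ad F) (ad G)" if Q: "closed_rel k \<Phi> \<kappa> t Q"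
    and FG: "F \<in> \<Phi>" "G \<in> \<Phi>" "adj F G" "v \<in> F \<inter> G" "0 < a \<bullet> r v" for Q F G v
    using FG
  \<comment> \<open>Sweeping in time order becomes induction on the number of faces with strictly
    larger norm, i.e. those met strictly earlier.\<close>
  proof (induction "card {\<rho> \<in> Fs. norm (near_pt r a (F \<inter> G)) < norm (near_pt r a \<rho>)}"
      arbitrary: F G v rule: less_induct)
    case less
    note F = less.prems(1) and G = less.prems(2) and FG = less.prems(3)
    define q where "q = near_pt r a (F \<inter> G)"
    define \<sigma> where "\<sigma> = carrier r a (F \<inter> G)"
    have fin: "finite F" "card F = k" "finite (F \<inter> G)" using fan_facet[OF fan F] by auto
    have \<sigma>sub: "\<sigma> \<subseteq> F \<inter> G" unfolding \<sigma>_def by (rule carrier_subset[OF fin(3)])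
    have qnz: "q \<noteq> 0" unfolding q_def by (rule near_pt_pos[of "F \<inter> G" v a r, OF fin(3) less.prems(4,5)])
    obtain u where u: "u \<in> \<sigma>" "0 < a \<bullet> r u"
      using carrier_positive[OF fin(3) qnz[unfolded q_def]] by (auto simp: \<sigma>_def)
    have starU: "X \<in> ?U" if "X \<in> \<Phi>" "\<sigma> \<subseteq> X" for X
      using mem[OF that(1) _ u(2)] u(1) that(2) by blast
    have orth: "(a - q) \<bullet> r w = 0" if "w \<in> \<sigma>" for w
      unfolding q_def by (rule carrier_orth[OF fin(3)]) (use that \<sigma>_def in simp)
    have far: "norm q < norm (near_pt r a A)" if "finite A" "\<sigma> \<subseteq> A" "w \<in> A" "0 < (a - q) \<bullet> r w" for A w
      using star_far[OF fan aL fin(3), where G = A and w = w] that by (simp add: q_def \<sigma>_def)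
    have near: "near_pt r a X = q" "carrier r a X = \<sigma>"
      if "X \<in> \<Phi>" "\<sigma> \<subseteq> X" "\<And>w. w \<in> X \<Longrightarrow> (a - q) \<bullet> r w \<le> 0" for X
      using star_near[OF fan aL, where A = "F \<inter> G" and F = F and G = X] F that by (auto simp: q_def \<sigma>_def)
    define tre where "tre X Y \<longleftrightarrow> X \<in> ?U \<and> Y \<in> ?U \<and> Y \<noteq> F\<^sub>0 \<and> par Y = X" for X Y
    \<comment> \<open>The gluings around \<open>\<sigma>\<close> available at this stage: tree
      edges, and ridges met strictly earlier.\<close>
    define E where "E X Y \<longleftrightarrow> X \<in> ?U \<and> Y \<in> ?U \<and> adj X Y \<and> \<sigma> \<subseteq> X \<inter> Y \<and>
      (tre X Y \<or> tre Y X \<or> norm q < norm (near_pt r a (X \<inter> Y)))" for X Y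
    have Esym: "E Y X" if "E X Y" for X Y
      using that adj_sym by (auto simp: E_def Int_commute)
    have treQ: "Q (ad X) (ad Y) \<and> Q (ad Y) (ad X)" if "tre X Y" for X Y
    proof -
      have XY: "X \<in> ?U" "Y \<in> ?U" "Y \<noteq> F\<^sub>0" "par Y = X" using that by (auto simp: tre_def)
      have "\<exists>i. ad X @ [i] \<in> addr k t \<and> node \<Phi> \<kappa> (ad X @ [i]) = Y"
        using grow_edge[OF setting, of "ad X" sl Y] ad[OF XY(1)] XY unfolding t_def by simp
      then obtain i where i: "ad X @ [i] \<in> addr k t" "node \<Phi> \<kappa> (ad X @ [i]) = Y" by blast
      then have "ad Y = ad X @ [i]" using adu by blast
      moreover have "Q (ad X) (ad X @ [i]) \<and> Q (ad X @ [i]) (ad X)"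
        using Q i(1) unfolding closed_rel_def by blast
      ultimately show ?thesis by simp
    qed
    have EQ: "Q (ad X) (ad Y)" if E: "E X Y" for X Y
    proof (cases "tre X Y \<or> tre Y X")
      case True
      then show ?thesis using treQ by blast
    next
      case False
      then have XY: "X \<in> \<Phi>" "Y \<in> \<Phi>" "adj X Y" "\<sigma> \<subseteq> X \<inter> Y" "norm q < norm (near_pt r a (X \<inter> Y))"
        using E U by (auto simp: E_def)
      have "{\<rho> \<in> Fs. norm (near_pt r a (X \<inter> Y)) < norm (near_pt r a \<rho>)} \<subset>
          {\<rho> \<in> Fs. norm q < norm (near_pt r a \<rho>)}"
        using XY(1,5) by (auto simp: Fs_def)
      then have "card {\<rho> \<in> Fs. norm (near_pt r a (X \<inter> Y)) < norm (near_pt r a \<rho>)} <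
          card {\<rho> \<in> Fs. norm q < norm (near_pt r a \<rho>)}"
        using finFs by (intro psubset_card_mono) auto
      then show ?thesis
        using less.hyps[of X Y u] XY u by (auto simp: q_def)
    qed
    define S where "S = {X \<in> \<Phi>. \<sigma> \<subseteq> X}"
    have SU: "X \<in> ?U" if "X \<in> S" for X using that starU by (auto simp: S_def)
    \<comment> \<open>The facets around \<open>\<sigma>\<close> that the cap met before reaching
      \<open>q\<close>; they form the open half of the link.\<close>
    define B where "B = {X \<in> S. \<exists>w\<in>X. 0 < (a - q) \<bullet> r w}"
    \<comment> \<open>The nearest point of the root is \<open>a\<close>. If the root lies around
      \<open>\<sigma>\<close> but not in \<open>B\<close>, then \<open>q = a\<close> and
      \<open>B\<close> is empty; so when \<open>B\<close> is nonempty, every facet of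
      \<open>S\<close> outside it has a parent.\<close>
    have F0case: "F\<^sub>0 \<in> S \<Longrightarrow> F\<^sub>0 \<notin> B \<Longrightarrow> a - q = 0"
      using near(1)[of F\<^sub>0] apex_near_pt[OF fan aL F\<^sub>0(1,2)] unfolding S_def B_def
      by (simp add: not_less)
    \<comment> \<open>Outside \<open>B\<close> the carrier is \<open>\<sigma>\<close>, which the
      parent contains. Descending the tree therefore stays around \<open>\<sigma>\<close> until it
      ends in \<open>B\<close> or, if \<open>B\<close> is empty, at the root.\<close>
    have parS: "E X (par X) \<and> par X \<in> S \<and> rank (par X) < rank X" if X: "X \<in> S" "X \<notin> B" "X \<noteq> F\<^sub>0" for X
    proof -
      have X\<Phi>: "X \<in> \<Phi>" "\<sigma> \<subseteq> X" using X(1) by (auto simp: S_def)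
      have "\<And>w. w \<in> X \<Longrightarrow> (a - q) \<bullet> r w \<le> 0" using X by (auto simp: B_def not_less)
      then have c: "carrier r a X = \<sigma>" by (rule near(2)[OF X\<Phi>])
      note pr = par[OF SU[OF X(1)] X(3)]
      have "par X \<in> S" using pr c U by (auto simp: S_def)
      moreover have "E X (par X)"
        using pr c X\<Phi> SU[OF X(1)] X(3) adj_sym by (auto simp: E_def tre_def)
      ultimately show ?thesis using pr by blast
    qed
    have "\<exists>Z. \<forall>X\<in>S. E\<^sup>*\<^sup>* X Z"
    proof (cases "B = {}")
      case True
      have "E\<^sup>*\<^sup>* X F\<^sub>0" if "X \<in> S" for X
        using that
      proof (induction "rank X" arbitrary: X rule: less_induct)
        case less
        show ?case
        proof (cases "X = F\<^sub>0")
          case False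
          then have *: "E X (par X)" "par X \<in> S" "rank (par X) < rank X"
            using parS[OF less.prems] True by auto
          then show ?thesis using less.hyps[of "par X"] by (meson converse_rtranclp_into_rtranclp)
        qed simp
      qed
      then show ?thesis by blast
    next
      case False
      then obtain Z where Z: "Z \<in> B" by blast
      then have "a - q \<noteq> 0" by (auto simp: B_def)
      have BZ: "E\<^sup>*\<^sup>* X Z" if X: "X \<in> B" for X
      proof -
        obtain f g where f: "f \<in> X" "0 < (a - q) \<bullet> r f" and g: "g \<in> Z" "0 < (a - q) \<bullet> r g"
          and XZ: "X \<in> \<Phi>" "\<sigma> \<subseteq> X" "Z \<in> \<Phi>" "\<sigma> \<subseteq> Z"
          using X Z by (auto simp: B_def S_def)
        have "(\<lambda>X Y. adj X Y \<and> Y \<in> \<Phi> \<and> \<sigma> \<subseteq> Y \<and> \<sigma> \<subseteq> X \<and> (\<exists>v\<in>X \<inter> Y. 0 < (a - q) \<bullet> r v))\<^sup>*\<^sup>* X Z"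
          by (rule fan_star_halfspace_connected[OF fan orth XZ(1,2) f XZ(3,4) g])
        moreover have "E\<^sup>*\<^sup>* X H \<and> H \<in> \<Phi>"
          if "(\<lambda>X Y. adj X Y \<and> Y \<in> \<Phi> \<and> \<sigma> \<subseteq> Y \<and> \<sigma> \<subseteq> X \<and> (\<exists>v\<in>X \<inter> Y. 0 < (a - q) \<bullet> r v))\<^sup>*\<^sup>* X H" for H
          using that
        proof (induction rule: rtranclp_induct)
          case base
          then show ?case using XZ by simp
        next
          case (step Y H)
          then obtain w where w: "w \<in> Y \<inter> H" "0 < (a - q) \<bullet> r w" by blast
          have "finite (Y \<inter> H)" using step fan_facet[OF fan, of H] by blast
          then have "norm q < norm (near_pt r a (Y \<inter> H))"
            using far[of "Y \<inter> H" w] w step.hyps(2) by blast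
          then have "E Y H" using step starU by (auto simp: E_def)
          then show ?case using step by (meson rtranclp.rtrancl_into_rtrancl)
        qed
        ultimately show ?thesis by blast
      qed
      have "E\<^sup>*\<^sup>* X Z" if "X \<in> S" for X
        using that
      proof (induction "rank X" arbitrary: X rule: less_induct)
        case less
        show ?case
        proof (cases "X \<in> B")
          case False
          then have "X \<noteq> F\<^sub>0" using F0case less.prems \<open>a - q \<noteq> 0\<close> by blast
          then have *: "E X (par X)" "par X \<in> S" "rank (par X) < rank X"
            using parS[OF less.prems False] by auto
          then show ?thesis using less.hyps[of "par X"] by (meson converse_rtranclp_into_rtranclp)
        qed (rule BZ)
      qed
      then show ?thesis by blast
    qed
    then have conn: "E\<^sup>*\<^sup>* X Y" if "X \<in> S" "Y \<in> S" for X Y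
      using that rtranclp_symp[of E, OF Esym] by (meson rtranclp_trans)
    have FS: "F \<in> S" "G \<in> S" using F G \<sigma>sub by (auto simp: S_def)
    have FU: "F \<in> ?U" "G \<in> ?U" using SU FS by auto
    show ?case
    \<comment> \<open>Links of faces of size at most k - 2 are stored. Otherwise
      \<open>\<sigma>\<close> is the whole ridge, its star is just \<open>F\<close> and
      \<open>G\<close>, and a path from \<open>F\<close> to \<open>G\<close> must begin with the
      gluing in question.\<close>
    proof (cases "card \<sigma> + 2 \<le> k")
      case True
      have "\<sigma> \<noteq> {}" using u by auto
      then obtain p\<^sub>0 j where p0: "p\<^sub>0 \<in> addr k t" "j < 2 ^ k" "sel k (walk \<Phi> \<kappa> p\<^sub>0) j = \<sigma>"
        "slot (subtree t p\<^sub>0) j \<noteq> leaf"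
        using host[OF _ True FU(1)] \<sigma>sub by blast
      have op: "ordered_facet \<Phi> (walk \<Phi> \<kappa> p\<^sub>0)" "node \<Phi> \<kappa> p\<^sub>0 \<in> ?U"
        using grow_subtree[OF setting] p0(1) unfolding t_def by blast+
      have p0S: "node \<Phi> \<kappa> p\<^sub>0 \<in> S"
        using sel_subset(1)[OF P op(1) p0(2)] p0(3) op(2) U by (auto simp: S_def node_def)
      let ?R = "\<lambda>x y. y \<in> addr k t \<and> Q x y \<and> adj (node \<Phi> \<kappa> x) (node \<Phi> \<kappa> y) \<and>
             sel k (walk \<Phi> \<kappa> p\<^sub>0) j \<subseteq> node \<Phi> \<kappa> x \<inter> node \<Phi> \<kappa> y"
      have ER: "?R (ad X) (ad Y)" if "E X Y" for X Y
        using EQ[OF that] that ad p0(3) by (auto simp: E_def)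
      have reach: "?R\<^sup>*\<^sup>* p\<^sub>0 (ad X)" if "E\<^sup>*\<^sup>* (node \<Phi> \<kappa> p\<^sub>0) X" for X
        using that
      proof (induction rule: rtranclp_induct)
        case base
        then show ?case using adu[OF p0(1)] by simp
      next
        case (step X Y)
        show ?case by (rule rtranclp.rtrancl_into_rtrancl[OF step.IH ER[OF step.hyps(2)]])
      qed
      show ?thesis
      proof (rule closed_rel_star[OF Q p0(1,2,4)])
        fix X assume X: "X \<in> \<Phi>" "sel k (walk \<Phi> \<kappa> p\<^sub>0) j \<subseteq> X"
        then have XS: "X \<in> S" using p0(3) by (simp add: S_def)
        show "\<exists>p\<in>addr k t. node \<Phi> \<kappa> p = X \<and> ?R\<^sup>*\<^sup>* p\<^sub>0 p"
          using ad[OF SU[OF XS]] reach[OF conn[OF p0S XS]] by blast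
      qed (use ad FU FG \<sigma>sub p0(3) in simp_all)
    next
      case False
      have cFG: "card (F \<inter> G) + 1 = k"
      proof -
        obtain w where w: "w \<in> F" "F \<inter> G = F - {w}" using adjE[OF FG] by metis
        then show ?thesis using fin card_Suc_Diff1[of F w] by simp
      qed
      then have \<sigma>eq: "\<sigma> = F \<inter> G"
        using False \<sigma>sub fin(3) card_seteq[of "F \<inter> G" \<sigma>] by simp
      have "F \<noteq> G" using FG by (auto simp: adj_def)
      then obtain Y where Y: "E F Y"
        using conn[OF FS] by (meson converse_rtranclpE)
      then have "Y \<noteq> F" "Y \<in> \<Phi>" "F \<inter> G \<subseteq> Y" using U \<sigma>eq by (auto simp: E_def adj_def)
      then have "Y = G" using npm_two_facets[OF P F G _ FG] by blast
      then show ?thesis using EQ[OF Y] by simp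
    qed
  qed
  have FU: "F \<in> ?U" "G \<in> ?U" using mem[OF FG(1) _ FG(5)] mem[OF FG(2) _ FG(5)] FG(4) by auto
  show ?thesis
    unfolding known_def
    using main[OF _ FG] ad[OF FU(1)] ad[OF FU(2)] by blast
qed

section \<open>Sizes of codes\<close>

text \<open>The division is exact for \<open>2 \<le> k\<close>. The value 2 at \<open>k = 2\<close>
  leaves room for the leaves of a cycle and its root.\<close>

definition code_bound :: "nat \<Rightarrow> nat"
  where "code_bound k = ((k - 1)\<^sup>2 * (fact k)\<^sup>2) div 2"

text \<open>The cost of all links per facet: a facet has k choose j faces of size j and contributes
  one facet to the link of each. The sum stops at k - 2, the last size whose links are fans of
  dimension at least 2.\<close>

definition links_bound :: "nat \<Rightarrow> nat"
  where "links_bound k = (\<Sum>j\<in>{1..k - 2}. (k choose j) * code_bound (k - j))"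

lemma two_code_bound: "2 \<le> k \<Longrightarrow> 2 * code_bound k = (k - 1)\<^sup>2 * (fact k)\<^sup>2"
proof -
  assume "2 \<le> k"
  then have "2 dvd (fact k :: nat)" by (intro dvd_fact) auto
  then show ?thesis by (simp add: code_bound_def)
qed

text \<open>Since (k choose j) (k - j)! = k! / j!, the term j = 1 gives k! (k - 1)!. The other
  terms, fewer than k - 1 in number, have j! \<ge> 2 and (k - j)! \<le> (k - 2)!, so together they
  add at most half of it. The factor 3/2 and the 1/2 of \<open>code_bound\<close> are cleared of
  denominators.\<close>

lemma links_bound_le:
  assumes k: "3 \<le> k"
  shows "4 * links_bound k \<le> 3 * ((k - 2)\<^sup>2 * (fact k * fact (k - 1)))"
proof -
  let ?c = "(k - 2)\<^sup>2 * fact k :: nat"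
  have tm: "2 * ((k choose j) * code_bound (k - j)) \<le> (k - 2)\<^sup>2 * (((k choose j) * fact (k - j)) * fact (k - j))"
    if j: "j \<in> {1..k - 2}" for j
  proof -
    have "2 * code_bound (k - j) = (k - j - 1)\<^sup>2 * (fact (k - j))\<^sup>2"
      using j k by (intro two_code_bound) auto
    also have "\<dots> \<le> (k - 2)\<^sup>2 * (fact (k - j))\<^sup>2"
      using j by (intro mult_right_mono power_mono) auto
    finally have "(k choose j) * (2 * code_bound (k - j)) \<le> (k choose j) * ((k - 2)\<^sup>2 * (fact (k - j))\<^sup>2)"
      by (rule mult_left_mono) simp
    then show ?thesis by (simp add: power2_eq_square ac_simps)
  qed
  have first: "(k choose 1) * fact (k - 1) = (fact k :: nat)"
    using k by (simp add: fact_reduce)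
  have later: "2 * (((k choose j) * fact (k - j)) * fact (k - j)) \<le> fact k * fact (k - 2)"
    if j: "j \<in> {2..k - 2}" for j
  proof -
    have "j \<le> k" using j k by auto
    have "2 \<le> (fact j :: nat)" using fact_mono_nat[of 2 j] j by simp
    then have "2 * ((k choose j) * fact (k - j)) \<le> fact j * ((k choose j) * fact (k - j))"
      by (rule mult_right_mono) simp
    also have "\<dots> = fact k"
      using binomial_fact_lemma[of j k] \<open>j \<le> k\<close> by (simp add: ac_simps)
    finally have "2 * ((k choose j) * fact (k - j)) \<le> fact k" .
    moreover have "(fact (k - j) :: nat) \<le> fact (k - 2)" using j by (intro fact_mono_nat) auto
    ultimately have "(2 * ((k choose j) * fact (k - j))) * fact (k - j) \<le> fact k * (fact (k - 2) :: nat)"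
      by (rule mult_mono) auto
    then show ?thesis by (simp add: ac_simps)
  qed
  have "2 * links_bound k = (\<Sum>j\<in>{1..k - 2}. 2 * ((k choose j) * code_bound (k - j)))"
    by (simp add: links_bound_def sum_distrib_left)
  also have "\<dots> \<le> (\<Sum>j\<in>{1..k - 2}. (k - 2)\<^sup>2 * (((k choose j) * fact (k - j)) * fact (k - j)))"
    by (rule sum_mono) (rule tm)
  also have "\<dots> = (k - 2)\<^sup>2 * (\<Sum>j\<in>{1..k - 2}. ((k choose j) * fact (k - j)) * fact (k - j))"
    by (simp add: sum_distrib_left)
  also have "{1..k - 2} = insert 1 {2..k - 2}" using k by auto
  also have "(\<Sum>j\<in>insert 1 {2..k - 2}. ((k choose j) * fact (k - j)) * fact (k - j)) =
      fact k * fact (k - 1) + (\<Sum>j\<in>{2..k - 2}. ((k choose j) * fact (k - j)) * fact (k - j))"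
    using first by simp
  finally have 1: "2 * links_bound k \<le> (k - 2)\<^sup>2 * (fact k * fact (k - 1) +
      (\<Sum>j\<in>{2..k - 2}. ((k choose j) * fact (k - j)) * fact (k - j)))" .
  have "2 * (\<Sum>j\<in>{2..k - 2}. ((k choose j) * fact (k - j)) * fact (k - j)) \<le> (\<Sum>j\<in>{2..k - 2}. fact k * fact (k - 2))"
    unfolding sum_distrib_left by (rule sum_mono) (rule later)
  also have "\<dots> = (k - 3) * (fact k * fact (k - 2))" using k by (simp add: Suc_diff_le numeral_eq_Suc)
  also have "\<dots> \<le> (k - 1) * (fact k * fact (k - 2))" by (intro mult_right_mono) auto
  also have "\<dots> = fact k * fact (k - 1)"
    using k fact_reduce[of "k - 1", where ?'a = nat] by (simp add: numeral_eq_Suc ac_simps)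
  finally have "2 * (\<Sum>j\<in>{2..k - 2}. ((k choose j) * fact (k - j)) * fact (k - j)) \<le> fact k * (fact (k - 1) :: nat)" .
  then have "2 * (fact k * fact (k - 1) + (\<Sum>j\<in>{2..k - 2}. ((k choose j) * fact (k - j)) * fact (k - j)))
      \<le> 3 * (fact k * (fact (k - 1) :: nat))" by simp
  then have "(k - 2)\<^sup>2 * (2 * (fact k * fact (k - 1) + (\<Sum>j\<in>{2..k - 2}. ((k choose j) * fact (k - j)) * fact (k - j))))
      \<le> (k - 2)\<^sup>2 * (3 * (fact k * (fact (k - 1) :: nat)))" by (rule mult_left_mono) simp
  moreover have "2 * l \<le> c * x \<Longrightarrow> c * (2 * x) \<le> c * (3 * y) \<Longrightarrow> 4 * l \<le> 3 * (c * y)"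
    for l c x y :: nat unfolding mult.left_commute[of c] by linarith
  ultimately show ?thesis using 1 by blast
qed

text \<open>The left side is the cost of a code per facet: 3 for the root and the additive 1 of each
  tree, 2 + k + 2^k for the nodes of each of two trees, \<open>k\<close> for each of two paths, and
  the links twice.\<close>

lemma code_bound_step:
  assumes k: "3 \<le> k"
  shows "7 + 4 * k + 2 * 2 ^ k + 2 * links_bound k \<le> code_bound k"
proof -
  obtain m where m: "k = m + 3" using k by (metis add.commute le_Suc_ex)
  define f where "f = (fact (k - 1) :: nat)"
  have fk: "fact k = k * f" using k by (simp add: f_def fact_reduce)
  have f2: "2 \<le> f" unfolding f_def using fact_mono_nat[of 2 "k - 1"] k by simp
  have pow: "(2::nat) ^ k \<le> 2 * fact k" using k
  proof (induction k rule: dec_induct)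
    case (step n)
    have "(2::nat) ^ Suc n = 2 * 2 ^ n" by simp
    also have "\<dots> \<le> Suc n * (2 * fact n)" using step by (intro mult_mono) auto
    finally show ?case by simp
  qed (simp add: eval_nat_numeral)
  have "2 * (7 + 4 * k + 2 * 2 ^ k) \<le> 14 + 8 * k + 8 * fact k" using pow by simp
  also have "\<dots> \<le> 9 * (fact k * f)"
  proof -
    have kf: "3 * f \<le> fact k" unfolding fk using k by simp
    have a: "2 * k \<le> fact k" unfolding fk using f2 by simp
    have "6 \<le> (fact k :: nat)" using kf f2 by simp
    moreover have "2 * fact k \<le> fact k * f" using mult_left_mono[OF f2, of "fact k"] by simp
    ultimately show ?thesis using a by linarith
  qed
  finally have A: "2 * (7 + 4 * k + 2 * 2 ^ k) \<le> 9 * (fact k * f)" .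
  have B: "4 * links_bound k \<le> 3 * ((k - 2)\<^sup>2 * (fact k * f))"
    using links_bound_le[OF k] by (simp add: f_def)
  \<comment> \<open>The coefficients of \<open>fact k * f\<close> are compared; at
    \<open>k = 3\<close> both sides are 12.\<close>
  have "9 + 3 * (k - 2)\<^sup>2 \<le> (k - 1)\<^sup>2 * k"
    unfolding m by (simp add: power2_eq_square algebra_simps)
  then have "(9 + 3 * (k - 2)\<^sup>2) * (fact k * f) \<le> ((k - 1)\<^sup>2 * k) * (fact k * f)"
    by (rule mult_right_mono) simp
  also have "\<dots> = 2 * code_bound k"
    using two_code_bound[of k] k by (simp add: fk power2_eq_square ac_simps)
  finally have "9 * (fact k * f) + 3 * ((k - 2)\<^sup>2 * (fact k * f)) \<le> 2 * code_bound k"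
    by (simp add: algebra_simps)
  moreover have "2 * x \<le> 9 * X \<Longrightarrow> 4 * l \<le> 3 * Y \<Longrightarrow> 9 * X + 3 * Y \<le> 2 * c \<Longrightarrow> x + 2 * l \<le> c"
    for x l c X Y :: nat by linarith
  ultimately show ?thesis using A B by blast
qed

lemma sum_faces_by_card:
  assumes F: "finite F" "card F = k" and g: "\<And>n. g n \<ge> (0::nat)"
  shows "(\<Sum>\<sigma>\<in>{\<sigma>. \<sigma> \<subseteq> F \<and> \<sigma> \<noteq> {} \<and> card \<sigma> + 2 \<le> k}. g (card \<sigma>)) =
    (\<Sum>j\<in>{1..k - 2}. (k choose j) * g j)"
proof -
  let ?S = "{\<sigma>. \<sigma> \<subseteq> F \<and> \<sigma> \<noteq> {} \<and> card \<sigma> + 2 \<le> k}"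
  have fin: "finite ?S" using F(1) by simp
  have "card ` ?S \<subseteq> {1..k - 2}"
    using F(1) by (auto simp: Suc_le_eq card_gt_0_iff finite_subset)
  then have "(\<Sum>\<sigma>\<in>?S. g (card \<sigma>)) = (\<Sum>j\<in>{1..k - 2}. \<Sum>\<sigma>\<in>{\<sigma> \<in> ?S. card \<sigma> = j}. g (card \<sigma>))"
    by (intro sum.group[symmetric] fin) auto
  also have "\<dots> = (\<Sum>j\<in>{1..k - 2}. (k choose j) * g j)"
  proof (rule sum.cong[OF refl])
    fix j assume j: "j \<in> {1..k - 2}"
    then have "{\<sigma> \<in> ?S. card \<sigma> = j} = {\<sigma>. \<sigma> \<subseteq> F \<and> card \<sigma> = j}" by auto
    then show "(\<Sum>\<sigma>\<in>{\<sigma> \<in> ?S. card \<sigma> = j}. g (card \<sigma>)) = (k choose j) * g j"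
      using n_subsets[OF F(1), of j] F(2) by simp
  qed
  finally show ?thesis .
qed

text \<open>Double counting of the pairs formed by a face and a facet containing it.\<close>

lemma link_sizes:
  assumes "finite \<Phi>" "\<And>F. F \<in> \<Phi> \<Longrightarrow> finite F \<and> card F = k"
  shows "(\<Sum>\<sigma>\<in>{\<sigma>. \<sigma> \<noteq> {} \<and> card \<sigma> + 2 \<le> k \<and> (\<exists>F\<in>\<Phi>. \<sigma> \<subseteq> F)}. code_bound (k - card \<sigma>) * card (link \<Phi> \<sigma>))
    \<le> card \<Phi> * links_bound k"
proof -
  let ?S = "{\<sigma>. \<sigma> \<noteq> {} \<and> card \<sigma> + 2 \<le> k \<and> (\<exists>F\<in>\<Phi>. \<sigma> \<subseteq> F)}"
  have "?S \<subseteq> (\<Union>F\<in>\<Phi>. Pow F)" by auto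
  then have fin: "finite ?S" by (rule finite_subset) (use assms in auto)
  have "(\<Sum>\<sigma>\<in>?S. code_bound (k - card \<sigma>) * card (link \<Phi> \<sigma>))
      \<le> (\<Sum>\<sigma>\<in>?S. \<Sum>F\<in>{F \<in> \<Phi>. \<sigma> \<subseteq> F}. code_bound (k - card \<sigma>))"
  proof (rule sum_mono)
    fix \<sigma>
    have "card (link \<Phi> \<sigma>) \<le> card {F \<in> \<Phi>. \<sigma> \<subseteq> F}"
      unfolding link_def using assms(1) by (intro card_image_le) simp
    then show "code_bound (k - card \<sigma>) * card (link \<Phi> \<sigma>) \<le> (\<Sum>F\<in>{F \<in> \<Phi>. \<sigma> \<subseteq> F}. code_bound (k - card \<sigma>))"
      by simp
  qed
  also have "\<dots> = (\<Sum>F\<in>\<Phi>. \<Sum>\<sigma>\<in>{\<sigma> \<in> ?S. \<sigma> \<subseteq> F}. code_bound (k - card \<sigma>))"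
    by (rule sum.swap_restrict[OF fin assms(1)])
  also have "\<dots> = (\<Sum>F\<in>\<Phi>. links_bound k)"
  proof (rule sum.cong[OF refl])
    fix F assume F: "F \<in> \<Phi>"
    have "{\<sigma> \<in> ?S. \<sigma> \<subseteq> F} = {\<sigma>. \<sigma> \<subseteq> F \<and> \<sigma> \<noteq> {} \<and> card \<sigma> + 2 \<le> k}" using F by auto
    then show "(\<Sum>\<sigma>\<in>{\<sigma> \<in> ?S. \<sigma> \<subseteq> F}. code_bound (k - card \<sigma>)) = links_bound k"
      using sum_faces_by_card[of F k "\<lambda>j. code_bound (k - j)"] assms(2)[OF F]
      by (simp add: links_bound_def)
  qed
  finally show ?thesis by simp
qed

section \<open>Existence of codes\<close>

text \<open>The part of \<open>coded\<close> that concerns one half-space, with its size budget; the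
  bound on \<open>length p\<close> controls the recorded paths.\<close>

definition run_code :: "nat \<Rightarrow> 'v set set \<Rightarrow> 'v set set \<Rightarrow> 'v list \<Rightarrow> rose \<Rightarrow> bool"
  where "run_code k \<Phi> U \<kappa> t \<longleftrightarrow>
    inj_on (node \<Phi> \<kappa>) (addr k t) \<and> node \<Phi> \<kappa> ` addr k t = U \<and>
    (\<forall>p\<in>addr k t. \<forall>j<2 ^ k. slot (subtree t p) j \<noteq> leaf \<longrightarrow>
      coded (k - card (idx k j)) (link \<Phi> (sel k (walk \<Phi> \<kappa> p) j)) (rest k (walk \<Phi> \<kappa> p) j)
        (slot (subtree t p) j)) \<and>
    (\<forall>p\<in>addr k t. length p < card \<Phi>) \<and>
    rsize t \<le> 1 + card \<Phi> * (2 + k + 2 ^ k) + card \<Phi> * links_bound k"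

lemma idx_inj: "i < 2 ^ k \<Longrightarrow> j < 2 ^ k \<Longrightarrow> idx k i = idx k j \<Longrightarrow> i = j"
proof -
  assume *: "i < 2 ^ k" "j < 2 ^ k" "idx k i = idx k j"
  have "distinct (map set (subseqs [0..<k]))" by (rule distinct_set_subseqs) simp
  moreover have "map set (subseqs [0..<k]) ! i = map set (subseqs [0..<k]) ! j"
    using * by (simp add: idx_def length_subseqs)
  ultimately show "i = j" using *(1,2) by (subst (asm) nth_eq_iff_index_eq) (simp_all add: length_subseqs)
qed

text \<open>A filled slot must be distinguishable from an empty one;
  \<open>\<Phi> \<noteq> {}\<close> rules out the cycle of length 0, whose code would be
  \<open>leaf\<close>.\<close>

lemma coded_not_leaf: "coded k \<Phi> \<kappa> t \<Longrightarrow> finite \<Phi> \<Longrightarrow> \<Phi> \<noteq> {} \<Longrightarrow> t \<noteq> leaf"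
  by (induction rule: coded.induct) (auto simp: card_gt_0_iff)

text \<open>\<open>T\<close> is a function of the root ordering because the ordering of the second
  root becomes known only later, from the facet where the two runs meet. Parents and hosts do not
  depend on it.\<close>

lemma run_exists:
  fixes L :: "'a::euclidean_space set" and r :: "'v \<Rightarrow> 'a"
  assumes fan: "fan k L \<Phi> r" and aL: "a \<in> L" and k: "3 \<le> k"
    and links: "\<And>\<sigma> F \<rho>. F \<in> \<Phi> \<Longrightarrow> \<sigma> \<subseteq> F \<Longrightarrow> \<sigma> \<noteq> {} \<Longrightarrow> card \<sigma> + 2 \<le> k \<Longrightarrow>
      ordered_facet (link \<Phi> \<sigma>) \<rho> \<Longrightarrow>
      \<exists>u. coded (k - card \<sigma>) (link \<Phi> \<sigma>) \<rho> u \<and> rsize u \<le> code_bound (k - card \<sigma>) * card (link \<Phi> \<sigma>)"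
    and F\<^sub>0: "F\<^sub>0 \<in> \<Phi>" "a \<in> pc r F\<^sub>0" "F\<^sub>0 \<in> upper \<Phi> r a"
  obtains T where
    "\<And>\<kappa>. ordered_facet \<Phi> \<kappa> \<Longrightarrow> set \<kappa> = F\<^sub>0 \<Longrightarrow> run_code k \<Phi> (upper \<Phi> r a) \<kappa> (T \<kappa>)"
    "\<And>\<kappa> F G v. ordered_facet \<Phi> \<kappa> \<Longrightarrow> set \<kappa> = F\<^sub>0 \<Longrightarrow> F \<in> \<Phi> \<Longrightarrow> G \<in> \<Phi> \<Longrightarrow> adj F G \<Longrightarrow>
       v \<in> F \<inter> G \<Longrightarrow> 0 < a \<bullet> r v \<Longrightarrow> known k \<Phi> \<kappa> (T \<kappa>) F G"
    "\<And>\<alpha>. ordered_facet \<Phi> \<alpha> \<Longrightarrow> set \<alpha> \<in> upper \<Phi> r a \<Longrightarrow>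
       \<exists>\<kappa> p. ordered_facet \<Phi> \<kappa> \<and> set \<kappa> = F\<^sub>0 \<and> p \<in> addr k (T \<kappa>) \<and> walk \<Phi> \<kappa> p = \<alpha>"
proof -
  let ?U = "upper \<Phi> r a"
  have P: "npm k \<Phi>" by (rule fan_npm[OF fan])
  have U: "?U \<subseteq> \<Phi>" by (auto simp: upper_def[OF fan aL])
  have finU: "finite ?U" using U fan_finite[OF fan] finite_subset by blast
  obtain par and rank :: "'v set \<Rightarrow> nat" where
    par: "\<And>Y. Y \<in> ?U \<Longrightarrow> Y \<noteq> F\<^sub>0 \<Longrightarrow> par Y \<in> ?U \<and> (adj (par Y) Y \<and> carrier r a Y \<subseteq> par Y) \<and> rank (par Y) < rank Y"
    and rankU: "\<And>Y. Y \<in> ?U \<Longrightarrow> rank Y < card ?U"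
  proof (rule parent_exists[OF finU F\<^sub>0(3), of "\<lambda>X Y. adj X Y \<and> carrier r a Y \<subseteq> X"])
    fix A assume "A \<subseteq> ?U" "F\<^sub>0 \<in> A" "A \<noteq> ?U"
    from upper_extend[OF fan aL F\<^sub>0(1,2) this]
    show "\<exists>X\<in>A. \<exists>Y\<in>?U - A. adj X Y \<and> carrier r a Y \<subseteq> X" .
  qed (rule that)
  have par': "\<And>Y. Y \<in> ?U \<Longrightarrow> Y \<noteq> F\<^sub>0 \<Longrightarrow> par Y \<in> ?U \<and> adj (par Y) Y \<and> rank (par Y) < rank Y"
    using par by blast
  define N where "N = card \<Phi>"
  have rank: "rank Y < N" if "Y \<in> ?U" for Y
    using rankU[OF that] card_mono[OF fan_finite[OF fan] U] by (simp add: N_def)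
  define Fc where "Fc = {\<sigma>. \<sigma> \<noteq> {} \<and> card \<sigma> + 2 \<le> k \<and> (\<exists>F\<in>\<Phi>. \<sigma> \<subseteq> F)}"
  \<comment> \<open>Each face is hosted by a single facet, so that the code of its link is paid for
    once.\<close>
  define h where "h \<sigma> = (SOME F. F \<in> ?U \<and> \<sigma> \<subseteq> F)" for \<sigma>
  define cd where "cd \<sigma> \<rho> = (SOME u. coded (k - card \<sigma>) (link \<Phi> \<sigma>) \<rho> u \<and>
      rsize u \<le> code_bound (k - card \<sigma>) * card (link \<Phi> \<sigma>))" for \<sigma> \<rho>
  define filled where "filled \<kappa> j \<longleftrightarrow> sel k \<kappa> j \<in> Fc \<and> h (sel k \<kappa> j) = set \<kappa>" for \<kappa> :: "'v list" and j
  define sl where "sl \<kappa> = map (\<lambda>j. if filled \<kappa> j then cd (sel k \<kappa> j) (rest k \<kappa> j) else leaf) [0..<2 ^ k]" for \<kappa>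
  have slen: "length (sl \<kappa>) = 2 ^ k" for \<kappa> by (simp add: sl_def)
  have slj: "sl \<kappa> ! j = (if filled \<kappa> j then cd (sel k \<kappa> j) (rest k \<kappa> j) else leaf)" if "j < 2 ^ k" for \<kappa> j
    using that by (simp add: sl_def)
  have cd: "coded (k - card \<sigma>) (link \<Phi> \<sigma>) \<rho> (cd \<sigma> \<rho>) \<and>
      rsize (cd \<sigma> \<rho>) \<le> code_bound (k - card \<sigma>) * card (link \<Phi> \<sigma>)"
    if "\<sigma> \<in> Fc" "ordered_facet (link \<Phi> \<sigma>) \<rho>" for \<sigma> \<rho>
    unfolding cd_def by (rule someI_ex) (use links that in \<open>auto simp: Fc_def\<close>)
  have linknf: "finite (link \<Phi> \<sigma>)" "link \<Phi> \<sigma> \<noteq> {}" if "\<sigma> \<in> Fc" for \<sigma>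
    using that fan_finite[OF fan] by (auto simp: Fc_def link_def)
  define T where "T \<kappa> = grow k \<Phi> ?U F\<^sub>0 par sl N \<kappa>" for \<kappa>
  {
    fix \<kappa> assume \<kappa>: "ordered_facet \<Phi> \<kappa>" "set \<kappa> = F\<^sub>0"
    note setting = P U \<kappa> F\<^sub>0(3) par' rank
    have inj: "inj_on (node \<Phi> \<kappa>) (addr k (T \<kappa>))"
      unfolding T_def by (rule grow_inj[OF setting])
    have nodes: "node \<Phi> \<kappa> ` addr k (T \<kappa>) = ?U"
      unfolding T_def by (rule grow_nodes[OF setting])
    have ow: "ordered_facet \<Phi> (walk \<Phi> \<kappa> p)" "node \<Phi> \<kappa> p \<in> ?U" if "p \<in> addr k (T \<kappa>)" for p
      using grow_subtree[OF setting] that unfolding T_def by blast+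
    have slt: "slot (subtree (T \<kappa>) p) j = sl (walk \<Phi> \<kappa> p) ! j" if "p \<in> addr k (T \<kappa>)" "j < 2 ^ k" for p j
      using grow_slot[OF setting that(1)[unfolded T_def], of j] that(2) unfolding T_def
      by (simp add: sl_def)
    have of: "ordered_facet (link \<Phi> (sel k (walk \<Phi> \<kappa> p) j)) (rest k (walk \<Phi> \<kappa> p) j)"
      "card (sel k (walk \<Phi> \<kappa> p) j) = card (idx k j)"
      if "p \<in> addr k (T \<kappa>)" "j < 2 ^ k" for p j
      using sel_subset[OF P ow(1)[OF that(1)] that(2)] by auto
    have wlen: "length (walk \<Phi> \<kappa> p) = k" "distinct (walk \<Phi> \<kappa> p)" if "p \<in> addr k (T \<kappa>)" for p
      using ordered_facet_length[OF P ow(1)[OF that]] ow(1)[OF that] by (auto simp: ordered_facet_def)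
    have run: "run_code k \<Phi> ?U \<kappa> (T \<kappa>)"
      unfolding run_code_def
    proof (intro conjI ballI allI impI)
      show "inj_on (node \<Phi> \<kappa>) (addr k (T \<kappa>))" "node \<Phi> \<kappa> ` addr k (T \<kappa>) = ?U"
        by (fact inj) (fact nodes)
      show "length p < card \<Phi>" if "p \<in> addr k (T \<kappa>)" for p
        using addr_grow_length that unfolding T_def N_def by blast
      fix p j assume p: "p \<in> addr k (T \<kappa>)" and j: "j < 2 ^ k" and nl: "slot (subtree (T \<kappa>) p) j \<noteq> leaf"
      then have f: "filled (walk \<Phi> \<kappa> p) j"
        using slt[OF p j] slj[OF j, of "walk \<Phi> \<kappa> p"] by (simp split: if_split_asm)
      then show "coded (k - card (idx k j)) (link \<Phi> (sel k (walk \<Phi> \<kappa> p) j)) (rest k (walk \<Phi> \<kappa> p) j)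
        (slot (subtree (T \<kappa>) p) j)"
        using cd[OF _ of(1)[OF p j]] of(2)[OF p j] slt[OF p j] slj[OF j] by (simp add: filled_def)
    next
      let ?W = "\<lambda>\<sigma>. code_bound (k - card \<sigma>) * card (link \<Phi> \<sigma>)"
      let ?A = "addr k (T \<kappa>)"
      let ?D = "SIGMA p:?A. {j. j < 2 ^ k \<and> filled (walk \<Phi> \<kappa> p) j}"
      have finA: "finite ?A" unfolding T_def by (rule finite_addr_grow)
      have cA: "card ?A \<le> N"
        using card_image[OF inj] nodes card_mono[OF fan_finite[OF fan] U] by (simp add: N_def)
      have slots: "sum_list (map rsize (sl (walk \<Phi> \<kappa> p)))
          \<le> 2 ^ k + (\<Sum>j\<in>{j. j < 2 ^ k \<and> filled (walk \<Phi> \<kappa> p) j}. ?W (sel k (walk \<Phi> \<kappa> p) j))"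
        if p: "p \<in> ?A" for p
      proof -
        let ?\<kappa> = "walk \<Phi> \<kappa> p"
        have "sum_list (map rsize (sl ?\<kappa>)) = (\<Sum>j<2 ^ k. rsize (sl ?\<kappa> ! j))"
          unfolding sum_list_sum_nth length_map slen atLeast0LessThan
          by (rule sum.cong) (simp_all add: slen)
        also have "\<dots> \<le> (\<Sum>j<2 ^ k. 1 + (if filled ?\<kappa> j then ?W (sel k ?\<kappa> j) else 0))"
        proof (rule sum_mono)
          fix j :: nat assume "j \<in> {..<2 ^ k}"
          then have j: "j < 2 ^ k" by simp
          show "rsize (sl ?\<kappa> ! j) \<le> 1 + (if filled ?\<kappa> j then ?W (sel k ?\<kappa> j) else 0)"
            using cd[OF _ of(1)[OF p j]] slj[OF j, of ?\<kappa>] by (auto simp: filled_def)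
        qed
        also have "\<dots> = 2 ^ k + (\<Sum>j<2 ^ k. if filled ?\<kappa> j then ?W (sel k ?\<kappa> j) else 0)"
          unfolding sum.distrib by simp
        also have "(\<Sum>j<2 ^ k. if filled ?\<kappa> j then ?W (sel k ?\<kappa> j) else 0) =
            (\<Sum>j\<in>{j. j < 2 ^ k \<and> filled ?\<kappa> j}. ?W (sel k ?\<kappa> j))"
          by (rule sum.mono_neutral_cong_right) auto
        finally show ?thesis .
      qed
      \<comment> \<open>The stored face determines its host, hence the address and then the slot;
        summing over filled slots counts each face at most once.\<close>
      have injD: "inj_on (\<lambda>(p, j). sel k (walk \<Phi> \<kappa> p) j) ?D"
      proof (rule inj_onI, clarify)
        fix p j p' j' assume p: "p \<in> ?A" "j < 2 ^ k" "filled (walk \<Phi> \<kappa> p) j"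
          and p': "p' \<in> ?A" "j' < 2 ^ k" "filled (walk \<Phi> \<kappa> p') j'"
          and e: "sel k (walk \<Phi> \<kappa> p) j = sel k (walk \<Phi> \<kappa> p') j'"
        have "node \<Phi> \<kappa> p = node \<Phi> \<kappa> p'" using p(3) p'(3) e by (simp add: filled_def node_def)
        then have pp: "p = p'" using inj p(1) p'(1) by (simp add: inj_on_def)
        have "inj_on ((!) (walk \<Phi> \<kappa> p)) {..<k}" using wlen[OF p(1)] by (simp add: inj_on_nth)
        then have "idx k j = idx k j'"
          using e idx_subset[OF p(2)] idx_subset[OF p'(2)] pp by (simp add: sel_def inj_on_image_eq_iff)
        then show "p = p' \<and> j = j'" using pp idx_inj p(2) p'(2) by blast
      qed
      have "(\<Sum>p\<in>?A. \<Sum>j\<in>{j. j < 2 ^ k \<and> filled (walk \<Phi> \<kappa> p) j}. ?W (sel k (walk \<Phi> \<kappa> p) j))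
          = (\<Sum>(p, j)\<in>?D. ?W (sel k (walk \<Phi> \<kappa> p) j))"
        by (rule sum.Sigma) (use finA in auto)
      also have "\<dots> = (\<Sum>\<sigma>\<in>(\<lambda>(p, j). sel k (walk \<Phi> \<kappa> p) j) ` ?D. ?W \<sigma>)"
        by (subst sum.reindex[OF injD]) (simp add: case_prod_unfold comp_def)
      also have "\<dots> \<le> (\<Sum>\<sigma>\<in>Fc. ?W \<sigma>)"
      proof (rule sum_mono2)
        have "Fc \<subseteq> (\<Union>F\<in>\<Phi>. Pow F)" by (auto simp: Fc_def)
        then show "finite Fc"
          by (rule finite_subset) (use fan_finite[OF fan] fan_facet[OF fan] in auto)
      qed (auto simp: filled_def)
      also have "\<dots> \<le> N * links_bound k"
        unfolding Fc_def N_def using link_sizes[of \<Phi> k] fan_finite[OF fan] fan_facet[OF fan] by simp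
      finally have hosted: "(\<Sum>p\<in>?A. \<Sum>j\<in>{j. j < 2 ^ k \<and> filled (walk \<Phi> \<kappa> p) j}. ?W (sel k (walk \<Phi> \<kappa> p) j))
          \<le> N * links_bound k" .
      have "rsize (T \<kappa>) \<le> 1 + (\<Sum>p\<in>?A. 2 + k + sum_list (map rsize (sl (walk \<Phi> \<kappa> p))))"
        unfolding T_def by (rule rsize_grow)
      also have "\<dots> \<le> 1 + (\<Sum>p\<in>?A. (2 + k + 2 ^ k) +
          (\<Sum>j\<in>{j. j < 2 ^ k \<and> filled (walk \<Phi> \<kappa> p) j}. ?W (sel k (walk \<Phi> \<kappa> p) j)))"
        using slots by (intro add_left_mono sum_mono) fastforce
      also have "\<dots> = 1 + (card ?A * (2 + k + 2 ^ k) +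
          (\<Sum>p\<in>?A. \<Sum>j\<in>{j. j < 2 ^ k \<and> filled (walk \<Phi> \<kappa> p) j}. ?W (sel k (walk \<Phi> \<kappa> p) j)))"
        unfolding sum.distrib sum_constant by (simp add: distrib_left)
      also have "\<dots> \<le> 1 + (N * (2 + k + 2 ^ k) + N * links_bound k)"
        by (intro add_left_mono add_mono mult_right_mono cA hosted) simp
      finally show "rsize (T \<kappa>) \<le> 1 + card \<Phi> * (2 + k + 2 ^ k) + card \<Phi> * links_bound k"
        by (simp add: N_def)
    qed
    have kn: "known k \<Phi> \<kappa> (T \<kappa>) F G"
      if "F \<in> \<Phi>" "G \<in> \<Phi>" "adj F G" "v \<in> F \<inter> G" "0 < a \<bullet> r v" for F G v
      unfolding T_def
    proof (rule run_known[OF fan aL _ F\<^sub>0 \<kappa> par rank _ that])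
      show "2 \<le> k" using k by simp
      fix \<sigma> F assume \<sigma>: "\<sigma> \<noteq> {}" "card \<sigma> + 2 \<le> k" and F: "F \<in> ?U" "\<sigma> \<subseteq> F"
      then have "\<sigma> \<in> Fc" using U by (auto simp: Fc_def)
      have h: "h \<sigma> \<in> ?U" "\<sigma> \<subseteq> h \<sigma>" unfolding h_def using someI[of "\<lambda>F. F \<in> ?U \<and> \<sigma> \<subseteq> F" F] F by auto
      obtain p where p: "p \<in> addr k (T \<kappa>)" "node \<Phi> \<kappa> p = h \<sigma>"
        using h(1)[folded nodes] by (metis imageE)
      let ?\<kappa> = "walk \<Phi> \<kappa> p"
      define I where "I = {i. i < k \<and> ?\<kappa> ! i \<in> \<sigma>}"
      have "I \<subseteq> {..<k}" by (auto simp: I_def)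
      then obtain j where j: "j < 2 ^ k" "idx k j = I" using idx_surj by blast
      have "\<sigma> \<subseteq> set ?\<kappa>" using h(2) p(2) by (simp add: node_def)
      then have "sel k ?\<kappa> j = \<sigma>"
        using wlen(1)[OF p(1)] j(2) by (auto simp: sel_def I_def in_set_conv_nth subset_iff)
      moreover from this have f: "filled ?\<kappa> j"
        using \<open>\<sigma> \<in> Fc\<close> p(2) by (simp add: filled_def node_def)
      have "slot (subtree (T \<kappa>) p) j \<noteq> leaf"
        unfolding slt[OF p(1) j(1)] slj[OF j(1)]
        using f coded_not_leaf[OF conjunct1[OF cd[OF _ of(1)[OF p(1) j(1)]]]] linknf by (simp add: filled_def)
      ultimately show "\<exists>p\<in>addr k (grow k \<Phi> ?U F\<^sub>0 par sl N \<kappa>). \<exists>j<2 ^ k.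
          sel k (walk \<Phi> \<kappa> p) j = \<sigma> \<and> slot (subtree (grow k \<Phi> ?U F\<^sub>0 par sl N \<kappa>) p) j \<noteq> leaf"
        using p(1) j(1) unfolding T_def by blast
    qed
    note run kn
  } note result = this
  show thesis
  proof (rule that[of T])
    show "\<exists>\<kappa> p. ordered_facet \<Phi> \<kappa> \<and> set \<kappa> = F\<^sub>0 \<and> p \<in> addr k (T \<kappa>) \<and> walk \<Phi> \<kappa> p = \<alpha>"
      if "ordered_facet \<Phi> \<alpha>" "set \<alpha> \<in> ?U" for \<alpha>
      unfolding T_def by (rule grow_reroot[OF P U F\<^sub>0(3) par' rank that])
  qed (use result in blast)+
qed

text \<open>Port \<open>i\<close> costs i + 1 nodes, at most \<open>k\<close>; as there are fewer
  than \<open>n\<close> ports, one more \<open>k\<close> is left for the root.\<close>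

lemma rsize_path_code:
  assumes "set p \<subseteq> {..<k}" "length p < n" "1 \<le> k"
  shows "rsize (path_code p) \<le> k * n"
proof -
  have "rsize (Rose (replicate i leaf)) = Suc i" for i by (simp add: sum_list_replicate)
  then have "rsize (path_code p) = Suc (\<Sum>i\<leftarrow>p. Suc i)"
    by (simp add: path_code_def comp_def del: rsize.simps) (simp add: comp_def)
  also have "(\<Sum>i\<leftarrow>p. Suc i) \<le> (\<Sum>i\<leftarrow>p. k)"
    using assms(1) by (intro sum_list_mono) auto
  also have "(\<Sum>i\<leftarrow>p. k) = length p * k" by (simp add: sum_list_triv)
  also have "Suc (length p * k) \<le> k + length p * k" using assms(3) by simp
  also have "\<dots> = k * Suc (length p)" by simp
  also have "\<dots> \<le> k * n" using assms(2) by (intro mult_left_mono) auto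
  finally show ?thesis by simp
qed

lemma apex_upper:
  fixes L :: "'a::euclidean_space set" and r :: "'v \<Rightarrow> 'a"
  assumes fan: "fan k L \<Phi> r" and a: "a \<in> L" "a \<noteq> 0" and F: "F \<in> \<Phi>" "a \<in> pc r F"
  shows "F \<in> upper \<Phi> r a"
proof -
  have "near_pt r a F \<noteq> 0" using apex_near_pt[OF fan a(1) F] a(2) by simp
  then have "\<exists>u\<in>carrier r a F. 0 < a \<bullet> r u"
    using carrier_positive fan_facet[OF fan F(1)] by blast
  then show ?thesis
    using carrier_subset[of F r a] fan_facet[OF fan F(1)] F(1) by (auto simp: upper_def[OF fan a(1)])
qed

lemma coded_exists:
  fixes L :: "'a::euclidean_space set" and r :: "'v \<Rightarrow> 'a"
  assumes "2 \<le> k" "fan k L \<Phi> r" "ordered_facet \<Phi> \<kappa>"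
  shows "\<exists>t. coded k \<Phi> \<kappa> t \<and> rsize t \<le> code_bound k * card \<Phi>"
  using assms
proof (induction k arbitrary: L \<Phi> r \<kappa> rule: less_induct)
  case (less k)
  note fan = less.prems(2)
  have P: "npm k \<Phi>" by (rule fan_npm[OF fan])
  have N: "1 \<le> card \<Phi>"
    using fan_finite[OF fan] fan_nonempty[OF fan] by (simp add: Suc_leI card_gt_0_iff)
  show ?case
  proof (cases "k = 2")
    case True
    have "rsize (Rose (replicate (card \<Phi>) leaf)) \<le> code_bound k * card \<Phi>"
      using N True by (simp add: sum_list_replicate code_bound_def)
    then show ?thesis using coded.cycle True by blast
  next
    case False
    then have k: "3 \<le> k" using less.prems(1) by simp
    have links: "\<exists>u. coded (k - card \<sigma>) (link \<Phi> \<sigma>) \<rho> u \<and>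
        rsize u \<le> code_bound (k - card \<sigma>) * card (link \<Phi> \<sigma>)"
      if F: "F \<in> \<Phi>" "\<sigma> \<subseteq> F" and \<sigma>: "\<sigma> \<noteq> {}" "card \<sigma> + 2 \<le> k" and \<rho>: "ordered_facet (link \<Phi> \<sigma>) \<rho>"
      for \<sigma> F \<rho>
    proof -
      obtain L' :: "'a set" and r' where "fan (k - card \<sigma>) L' (link \<Phi> \<sigma>) r'"
        by (rule fan_link[OF fan F]) (rule that)
      moreover have "finite \<sigma>" using F fan_facet[OF fan] finite_subset by blast
      then have "k - card \<sigma> < k" "2 \<le> k - card \<sigma>" using \<sigma> by (auto simp: card_gt_0_iff)
      ultimately show ?thesis using less.IH \<rho> by blast
    qed
    have \<kappa>: "ordered_facet \<Phi> \<kappa>" and F: "set \<kappa> \<in> \<Phi>"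
      using less.prems(3) by (auto simp: ordered_facet_def)
    have kF: "finite (set \<kappa>)" "card (set \<kappa>) = k" using fan_facet[OF fan F] by auto
    let ?x = "\<Sum>v\<in>set \<kappa>. 1 *\<^sub>R r v"
    have xL: "?x \<in> L" using fan_mem[OF fan F] fan_subspace[OF fan] by (auto intro!: subspace_sum)
    obtain e where e: "0 < e" "\<And>y. y \<in> L \<Longrightarrow> dist ?x y < e \<Longrightarrow> \<exists>G\<in>\<Phi>. set \<kappa> \<subseteq> G \<and> y \<in> pc r G"
      by (rule fan_near[OF fan F subset_refl, of "\<lambda>_. 1"]) auto
    have rnz: "r v \<noteq> 0" if G: "G \<in> \<Phi>" "v \<in> G" for G v
    proof
      assume "r v = 0"
      then have "(\<Sum>u\<in>G. (if u = v then 1 else 0) *\<^sub>R r u) = 0" by (intro sum.neutral) auto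
      from fan_indep[OF fan G(1) this G(2)] show False by simp
    qed
    \<comment> \<open>A generic vector near an interior point of the prescribed root cone: the first
      run can then start at \<open>set \<kappa>\<close>, and no ray is orthogonal to the
      vector.\<close>
    have "\<exists>y\<in>L. dist ?x y < e \<and> (\<forall>u\<in>r ` \<Union>\<Phi>. u \<bullet> y \<noteq> 0)"
    proof (rule generic_vector[OF _ fan_subspace[OF fan] _ xL e(1)])
      show "finite (r ` \<Union>\<Phi>)" using fan_finite[OF fan] fan_facet[OF fan] by auto
      show "\<exists>b\<in>L. u \<bullet> b \<noteq> 0" if "u \<in> r ` \<Union>\<Phi>" for u
        using that rnz fan_mem[OF fan] by (intro bexI[of _ u]) auto
    qed
    then obtain a where a: "a \<in> L" "dist ?x a < e" and agen: "\<And>G v. G \<in> \<Phi> \<Longrightarrow> v \<in> G \<Longrightarrow> a \<bullet> r v \<noteq> 0"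
      by (auto simp: inner_commute)
    obtain G where "G \<in> \<Phi>" "set \<kappa> \<subseteq> G" "a \<in> pc r G" using e(2)[OF a] by blast
    then have aF: "a \<in> pc r (set \<kappa>)"
      using fan_facet[OF fan] kF card_subset_eq[of G "set \<kappa>"] by auto
    have "set \<kappa> \<noteq> {}" using kF k by auto
    then have anz: "a \<noteq> 0" using agen[OF F] by force
    have maL: "- a \<in> L" using a(1) fan_subspace[OF fan] by (simp add: subspace_neg)
    obtain F' where F': "F' \<in> \<Phi>" "- a \<in> pc r F'" using fan_cover[OF fan maL] by blast
    let ?U = "upper \<Phi> r a" and ?U' = "upper \<Phi> r (- a)"
    have Umem: "X \<in> ?U \<longleftrightarrow> X \<in> \<Phi> \<and> (\<exists>v\<in>X. 0 < a \<bullet> r v)"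
      "X \<in> ?U' \<longleftrightarrow> X \<in> \<Phi> \<and> (\<exists>v\<in>X. a \<bullet> r v < 0)" for X
      by (auto simp: upper_def[OF fan a(1)] upper_def[OF fan maL])
    obtain T where T: "\<And>\<mu>. ordered_facet \<Phi> \<mu> \<Longrightarrow> set \<mu> = set \<kappa> \<Longrightarrow> run_code k \<Phi> ?U \<mu> (T \<mu>)"
      "\<And>\<mu> F G v. ordered_facet \<Phi> \<mu> \<Longrightarrow> set \<mu> = set \<kappa> \<Longrightarrow> F \<in> \<Phi> \<Longrightarrow> G \<in> \<Phi> \<Longrightarrow> adj F G \<Longrightarrow>
         v \<in> F \<inter> G \<Longrightarrow> 0 < a \<bullet> r v \<Longrightarrow> known k \<Phi> \<mu> (T \<mu>) F G"
      "\<And>\<alpha>. ordered_facet \<Phi> \<alpha> \<Longrightarrow> set \<alpha> \<in> ?U \<Longrightarrow>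
         \<exists>\<mu> p. ordered_facet \<Phi> \<mu> \<and> set \<mu> = set \<kappa> \<and> p \<in> addr k (T \<mu>) \<and> walk \<Phi> \<mu> p = \<alpha>"
      by (rule run_exists[OF fan a(1) k links F aF apex_upper[OF fan a(1) anz F aF]])
        (assumption+, rule that, assumption+)
    obtain T' where T': "\<And>\<mu>. ordered_facet \<Phi> \<mu> \<Longrightarrow> set \<mu> = F' \<Longrightarrow> run_code k \<Phi> ?U' \<mu> (T' \<mu>)"
      "\<And>\<mu> F G v. ordered_facet \<Phi> \<mu> \<Longrightarrow> set \<mu> = F' \<Longrightarrow> F \<in> \<Phi> \<Longrightarrow> G \<in> \<Phi> \<Longrightarrow> adj F G \<Longrightarrow>
         v \<in> F \<inter> G \<Longrightarrow> 0 < - a \<bullet> r v \<Longrightarrow> known k \<Phi> \<mu> (T' \<mu>) F G"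
      "\<And>\<alpha>. ordered_facet \<Phi> \<alpha> \<Longrightarrow> set \<alpha> \<in> ?U' \<Longrightarrow>
         \<exists>\<mu> p. ordered_facet \<Phi> \<mu> \<and> set \<mu> = F' \<and> p \<in> addr k (T' \<mu>) \<and> walk \<Phi> \<mu> p = \<alpha>"
      by (rule run_exists[OF fan maL k links F' apex_upper[OF fan maL _ F']])
        (assumption+, use anz in simp, rule that, assumption+)
    \<comment> \<open>A facet whose cone contains a nonzero vector orthogonal to \<open>a\<close>
      has vertices of both signs and serves as the common facet.\<close>
    have "dim {a} < dim L" using fan_dim[OF fan] k anz by simp
    then obtain z where z: "z \<in> L" "z \<noteq> 0" "a \<bullet> z = 0"
      using subspace_thin[OF fan_subspace[OF fan], of "{a}"] a(1) by (auto simp: inner_commute)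
    obtain M where M: "M \<in> \<Phi>" "z \<in> pc r M" using fan_cover[OF fan z(1)] by blast
    then have "(\<exists>v\<in>M. 0 < a \<bullet> r v) \<and> (\<exists>v\<in>M. a \<bullet> r v < 0)"
      using pc_both_signs[OF _ M(2) z(2,3)] fan_facet[OF fan M(1)] agen by blast
    then have MU: "M \<in> ?U" "M \<in> ?U'" using M(1) Umem by auto
    let ?t = "T \<kappa>"
    note t = T(1)[OF \<kappa> refl] and tk = T(2)[OF \<kappa> refl]
    have nodes1: "node \<Phi> \<kappa> ` addr k ?t = ?U" using t by (simp add: run_code_def)
    obtain p where p: "p \<in> addr k ?t" "node \<Phi> \<kappa> p = M"
      using MU(1)[folded nodes1] by (metis imageE)
    \<comment> \<open>The first run dictates the ordering of the common facet; \<open>T'(3)\<close>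
      roots the second run so that it arrives there with the same ordering.\<close>
    define \<alpha> where "\<alpha> = walk \<Phi> \<kappa> p"
    have \<alpha>: "ordered_facet \<Phi> \<alpha>" "set \<alpha> = M"
      using walk_ordered[OF P \<kappa>] p by (auto simp: addr_def \<alpha>_def node_def)
    obtain \<kappa>' p' where \<kappa>': "ordered_facet \<Phi> \<kappa>'" "set \<kappa>' = F'" and p': "p' \<in> addr k (T' \<kappa>')" "walk \<Phi> \<kappa>' p' = \<alpha>"
      using T'(3)[OF \<alpha>(1)] \<alpha>(2) MU(2) by blast
    let ?t' = "T' \<kappa>'"
    note t' = T'(1)[OF \<kappa>'] and tk' = T'(2)[OF \<kappa>']
    have nodes: "node \<Phi> \<kappa> ` addr k ?t = ?U" "node \<Phi> \<kappa>' ` addr k ?t' = ?U'"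
      using t t' by (simp_all add: run_code_def)
    have "coded k \<Phi> \<kappa> (Rose [?t, ?t', path_code p, path_code p'])"
    proof (rule coded.runs[OF k \<kappa>'(1)])
      show "inj_on (node \<Phi> \<kappa>) (addr k ?t)" "inj_on (node \<Phi> \<kappa>') (addr k ?t')"
        using t t' by (simp_all add: run_code_def)
      show "coded (k - card (idx k j)) (link \<Phi> (sel k (walk \<Phi> \<kappa> q) j)) (rest k (walk \<Phi> \<kappa> q) j)
          (slot (subtree ?t q) j)"
        if "q \<in> addr k ?t" "j < 2 ^ k" "slot (subtree ?t q) j \<noteq> leaf" for q j
        using t that by (simp add: run_code_def)
      show "coded (k - card (idx k j)) (link \<Phi> (sel k (walk \<Phi> \<kappa>' q) j)) (rest k (walk \<Phi> \<kappa>' q) j)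
          (slot (subtree ?t' q) j)"
        if "q \<in> addr k ?t'" "j < 2 ^ k" "slot (subtree ?t' q) j \<noteq> leaf" for q j
        using t' that by (simp add: run_code_def)
      show "X \<in> node \<Phi> \<kappa> ` addr k ?t \<union> node \<Phi> \<kappa>' ` addr k ?t'" if X: "X \<in> \<Phi>" for X
      proof -
        have "card X = k" using fan_facet[OF fan X] by simp
        then obtain v where "v \<in> X" using k by fastforce
        then show ?thesis
          using agen[OF X] X unfolding nodes Un_iff Umem by (meson linorder_neqE_linordered_idom)
      qed
      show "known k \<Phi> \<kappa> ?t X Y \<or> known k \<Phi> \<kappa>' ?t' X Y" if XY: "X \<in> \<Phi>" "Y \<in> \<Phi>" "adj X Y" for X Y
      proof -
        obtain w where "w \<in> X" "X \<inter> Y = X - {w}" using adjE[OF XY(3)] by metis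
        then have "card (X \<inter> Y) + 1 = k"
          using fan_facet[OF fan XY(1)] card_Suc_Diff1[of X w] by simp
        \<comment> \<open>The sign of any vertex of the ridge names a run that glues it.\<close>
        then have "X \<inter> Y \<noteq> {}" using k by auto
        then obtain v where v: "v \<in> X \<inter> Y" by blast
        then have "0 < a \<bullet> r v \<or> 0 < - a \<bullet> r v" using agen[OF XY(1)] by force
        then show ?thesis using tk[OF XY v] tk'[OF XY v] by blast
      qed
      show "p \<in> addr k ?t" "p' \<in> addr k ?t'" "walk \<Phi> \<kappa> p = walk \<Phi> \<kappa>' p'"
        using p p' by (simp_all add: \<alpha>_def)
      fix X assume X: "X \<in> node \<Phi> \<kappa> ` addr k ?t" "X \<in> node \<Phi> \<kappa>' ` addr k ?t'"
      obtain x y where x: "x \<in> X" "0 < a \<bullet> r x" and y: "y \<in> X" "a \<bullet> r y < 0" and XP: "X \<in> \<Phi>"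
        using X unfolding nodes Umem by blast
      obtain x' y' where x': "x' \<in> M" "0 < a \<bullet> r x'" and y': "y' \<in> M" "a \<bullet> r y' < 0"
        using MU unfolding Umem by blast
      have "(\<lambda>X Y. adj X Y \<and> Y \<in> \<Phi> \<and> (\<exists>v\<in>X \<inter> Y. 0 < a \<bullet> r v) \<and> (\<exists>v\<in>X \<inter> Y. a \<bullet> r v < 0))\<^sup>*\<^sup>* M X"
        by (rule fan_equator_connected[OF fan k a(1) agen M(1) x' y' XP x y])
      moreover have "H \<in> \<Phi> \<and> (\<lambda>X Y. adj X Y \<and> known k \<Phi> \<kappa> ?t X Y \<and> known k \<Phi> \<kappa>' ?t' X Y)\<^sup>*\<^sup>* M H"
        if "(\<lambda>X Y. adj X Y \<and> Y \<in> \<Phi> \<and> (\<exists>v\<in>X \<inter> Y. 0 < a \<bullet> r v) \<and> (\<exists>v\<in>X \<inter> Y. a \<bullet> r v < 0))\<^sup>*\<^sup>* M H" for H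
        using that
      proof (induction rule: rtranclp_induct)
        case base
        then show ?case using M(1) by simp
      next
        case (step X Y)
        then obtain v w where v: "v \<in> X \<inter> Y" "0 < a \<bullet> r v" and w: "w \<in> X \<inter> Y" "a \<bullet> r w < 0"
          and XY: "X \<in> \<Phi>" "Y \<in> \<Phi>" "adj X Y" by blast
        have "0 < - a \<bullet> r w" using w by simp
        then have "known k \<Phi> \<kappa> ?t X Y" "known k \<Phi> \<kappa>' ?t' X Y"
          using tk[OF XY v] tk'[OF XY w(1)] by blast+
        then have "adj X Y \<and> known k \<Phi> \<kappa> ?t X Y \<and> known k \<Phi> \<kappa>' ?t' X Y" using XY by blast
        from rtranclp.rtrancl_into_rtrancl[OF conjunct2[OF step.IH] this] show ?case using XY by blast
      qed
      ultimately show "(\<lambda>X Y. adj X Y \<and> known k \<Phi> \<kappa> ?t X Y \<and> known k \<Phi> \<kappa>' ?t' X Y)\<^sup>*\<^sup>* (node \<Phi> \<kappa> p) X"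
        unfolding p(2) by blast
    qed
    moreover have "rsize (Rose [?t, ?t', path_code p, path_code p']) \<le> code_bound k * card \<Phi>"
    proof -
      let ?N = "card \<Phi>"
      have pc: "rsize (path_code p) \<le> k * ?N" "rsize (path_code p') \<le> k * ?N"
        using t t' p(1) p'(1) k by (auto intro!: rsize_path_code simp: run_code_def addr_def)
      have tt: "rsize ?t \<le> 1 + ?N * (2 + k + 2 ^ k) + ?N * links_bound k"
        "rsize ?t' \<le> 1 + ?N * (2 + k + 2 ^ k) + ?N * links_bound k"
        using t t' by (simp_all add: run_code_def)
      have "rsize (Rose [?t, ?t', path_code p, path_code p']) \<le>
          3 + 2 * (?N * (2 + k + 2 ^ k) + ?N * links_bound k) + 2 * (k * ?N)"
        using pc tt by simp
      also have "\<dots> \<le> 3 * ?N + 2 * (?N * (2 + k + 2 ^ k) + ?N * links_bound k) + 2 * (k * ?N)"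
        using N by simp
      also have "\<dots> = (7 + 4 * k + 2 * 2 ^ k + 2 * links_bound k) * ?N" by (simp add: algebra_simps)
      also have "\<dots> \<le> code_bound k * ?N" by (rule mult_right_mono[OF code_bound_step[OF k]]) simp
      finally show ?thesis .
    qed
    ultimately show ?thesis by blast
  qed
qed

section \<open>Spherical simplices\<close>

text \<open>On a great circle the coefficients are ratios of sines of the partial angles; the
  identity is verified by showing that the difference \<open>?w\<close> has norm zero. Excluding
  antipodes leaves \<open>x = y = z\<close> as the only degenerate case.\<close>

lemma arc_dist_imp_cone:
  fixes x y z :: "'a::euclidean_space"
  assumes n: "norm x = 1" "norm y = 1" "norm z = 1" and anti: "y \<noteq> - x"
    and eq: "sphere_dist x z + sphere_dist z y = sphere_dist x y"
  obtains \<alpha> \<beta> where "0 \<le> \<alpha>" "0 \<le> \<beta>" "z = \<alpha> *\<^sub>R x + \<beta> *\<^sub>R y"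
proof -
  have unit: "u \<bullet> u = 1" if "norm u = 1" for u :: 'a using that by (simp add: dot_square_norm)
  have b: "\<bar>u \<bullet> v\<bar> \<le> 1" if "norm u = 1" "norm v = 1" for u v :: 'a
    using Cauchy_Schwarz_ineq2[of u v] that by simp
  have same: "u = v" if "norm u = 1" "norm v = 1" "u \<bullet> v = 1" for u v :: 'a
  proof -
    have "(u - v) \<bullet> (u - v) = 0"
      using that unit by (simp add: inner_diff_left inner_diff_right inner_commute)
    then show ?thesis by simp
  qed
  define \<theta> where "\<theta> = sphere_dist x z"
  define \<phi> where "\<phi> = sphere_dist z y"
  define \<psi> where "\<psi> = sphere_dist x y"
  have c: "cos \<theta> = x \<bullet> z" "cos \<phi> = z \<bullet> y" "cos \<psi> = x \<bullet> y"
    using b n by (auto simp: \<theta>_def \<phi>_def \<psi>_def sphere_dist_def cos_arccos_abs)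
  have r: "0 \<le> \<theta>" "\<theta> \<le> pi" "0 \<le> \<phi>" "\<phi> \<le> pi" "0 \<le> \<psi>" "\<psi> \<le> pi"
    using b n by (auto simp: \<theta>_def \<phi>_def \<psi>_def sphere_dist_def abs_le_iff intro!: arccos_lbound arccos_ubound)
  have s: "0 \<le> sin \<theta>" "0 \<le> sin \<phi>" "0 \<le> sin \<psi>" using r by (auto intro: sin_ge_zero)
  have sum: "\<psi> = \<theta> + \<phi>" using eq by (simp add: \<theta>_def \<phi>_def \<psi>_def)
  show thesis
  proof (cases "sin \<psi> = 0")
    case True
    have "\<psi> \<noteq> pi"
    proof
      assume "\<psi> = pi"
      then have "x \<bullet> (- y) = 1" using c(3) by simp
      then have "x = - y" using same[of x "- y"] n by simp
      then show False using anti by simp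
    qed
    then have "\<psi> = 0" using True r sin_gt_zero[of \<psi>] by fastforce
    then have "\<theta> = 0" using sum r by simp
    then have "z = x" using same[of x z] c(1) n by simp
    then show thesis using that[of 1 0] by simp
  next
    case False
    let ?w = "sin \<psi> *\<^sub>R z - sin \<phi> *\<^sub>R x - sin \<theta> *\<^sub>R y"
    have "?w \<bullet> ?w = (sin \<psi>)\<^sup>2 + (sin \<phi>)\<^sup>2 + (sin \<theta>)\<^sup>2 - 2 * sin \<psi> * sin \<phi> * cos \<theta>
        - 2 * sin \<psi> * sin \<theta> * cos \<phi> + 2 * sin \<phi> * sin \<theta> * cos \<psi>"
      unfolding c using unit[OF n(1)] unit[OF n(2)] unit[OF n(3)]
      by (simp add: inner_diff_left inner_diff_right inner_commute power2_eq_square algebra_simps)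
    also have "\<dots> = (sin \<phi>)\<^sup>2 * (1 - ((sin \<theta>)\<^sup>2 + (cos \<theta>)\<^sup>2)) +
        (sin \<theta>)\<^sup>2 * (1 - ((sin \<phi>)\<^sup>2 + (cos \<phi>)\<^sup>2))"
    proof -
      have "(s * C + c * S)\<^sup>2 + S\<^sup>2 + s\<^sup>2 - 2 * (s * C + c * S) * S * c - 2 * (s * C + c * S) * s * C
          + 2 * S * s * (c * C - s * S) = S\<^sup>2 * (1 - (s\<^sup>2 + c\<^sup>2)) + s\<^sup>2 * (1 - (S\<^sup>2 + C\<^sup>2))"
        for s c S C :: real by (simp add: power2_eq_square algebra_simps)
      then show ?thesis unfolding sum sin_add cos_add .
    qed
    also have "\<dots> = 0" by simp
    finally have "?w = 0" by simp
    then have e: "sin \<psi> *\<^sub>R z = sin \<phi> *\<^sub>R x + sin \<theta> *\<^sub>R y" by (simp add: algebra_simps)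
    have "z = (1 / sin \<psi>) *\<^sub>R (sin \<psi> *\<^sub>R z)" using False by simp
    also have "\<dots> = (sin \<phi> / sin \<psi>) *\<^sub>R x + (sin \<theta> / sin \<psi>) *\<^sub>R y"
      unfolding e by (simp add: scaleR_add_right)
    finally show thesis using that s by (metis divide_nonneg_nonneg)
  qed
qed

lemma cone_imp_arc_dist:
  fixes x y z :: "'a::euclidean_space"
  assumes n: "norm x = 1" "norm y = 1" "norm z = 1"
    and z: "0 \<le> \<alpha>" "0 \<le> \<beta>" "z = \<alpha> *\<^sub>R x + \<beta> *\<^sub>R y"
  shows "sphere_dist x z + sphere_dist z y = sphere_dist x y"
proof -
  have unit: "u \<bullet> u = 1" if "norm u = 1" for u :: 'a using that by (simp add: dot_square_norm)
  have b: "\<bar>u \<bullet> v\<bar> \<le> 1" if "norm u = 1" "norm v = 1" for u v :: 'a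
    using Cauchy_Schwarz_ineq2[of u v] that by simp
  define c where "c = x \<bullet> y"
  have c1: "-1 \<le> c" "c \<le> 1" using b[OF n(1,2)] by (auto simp: c_def abs_le_iff)
  have xz: "x \<bullet> z = \<alpha> + \<beta> * c" and zy: "z \<bullet> y = \<alpha> * c + \<beta>"
    using unit n by (auto simp: z(3) c_def inner_add_right inner_add_left)
  have zz: "\<alpha>\<^sup>2 + \<beta>\<^sup>2 + 2 * \<alpha> * \<beta> * c = 1"
    using unit[OF n(3)] unit[OF n(1)] unit[OF n(2)] unfolding z(3) c_def
    by (simp add: inner_add_right inner_add_left inner_commute power2_eq_square algebra_simps)
  define \<theta> where "\<theta> = sphere_dist x z"
  define \<phi> where "\<phi> = sphere_dist z y"
  have cs: "cos \<theta> = \<alpha> + \<beta> * c" "cos \<phi> = \<alpha> * c + \<beta>"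
    using b[OF n(1,3)] b[OF n(3,2)] by (simp_all add: \<theta>_def \<phi>_def sphere_dist_def cos_arccos_abs xz zy)
  have r: "0 \<le> \<theta>" "\<theta> \<le> pi" "0 \<le> \<phi>" "\<phi> \<le> pi"
    using b n by (auto simp: \<theta>_def \<phi>_def sphere_dist_def abs_le_iff intro!: arccos_lbound arccos_ubound)
  have q: "0 \<le> 1 - c\<^sup>2" using c1 by (simp add: abs_square_le_1 abs_le_iff)
  have "1 - (\<alpha> + \<beta> * c)\<^sup>2 = \<beta>\<^sup>2 * (1 - c\<^sup>2)" "1 - (\<alpha> * c + \<beta>)\<^sup>2 = \<alpha>\<^sup>2 * (1 - c\<^sup>2)"
    using zz by algebra+
  then have "sin \<theta> = \<beta> * sqrt (1 - c\<^sup>2)" "sin \<phi> = \<alpha> * sqrt (1 - c\<^sup>2)"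
    using sin_cos_sqrt[of \<theta>] sin_cos_sqrt[of \<phi>] sin_ge_zero r z(1,2)
    by (simp_all add: cs real_sqrt_mult)
  then have "cos (\<theta> + \<phi>) = (\<alpha> + \<beta> * c) * (\<alpha> * c + \<beta>) - \<alpha> * \<beta> * (sqrt (1 - c\<^sup>2))\<^sup>2"
    by (simp add: cos_add cs power2_eq_square)
  also have "\<dots> = c * (\<alpha>\<^sup>2 + \<beta>\<^sup>2 + 2 * \<alpha> * \<beta> * c)"
    using q by (simp add: power2_eq_square algebra_simps)
  finally have cc: "cos (\<theta> + \<phi>) = c" by (simp add: zz)
  \<comment> \<open>This bounds \<open>\<theta> + \<phi>\<close> by \<open>pi\<close>, as needed for
    \<open>arccos\<close> to invert \<open>cos\<close>.\<close>
  have "0 \<le> (\<alpha> + \<beta>) * (1 + c)" using z c1 by simp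
  then have "cos (pi - \<phi>) \<le> cos \<theta>" unfolding cos_pi_minus cs by (simp add: algebra_simps)
  then have "\<theta> \<le> pi - \<phi>" using cos_mono_le_eq[of "pi - \<phi>" \<theta>] r by simp
  then have "arccos c = \<theta> + \<phi>" unfolding cc[symmetric] using r by (intro arccos_cos) auto
  then show ?thesis by (simp add: \<theta>_def \<phi>_def c_def sphere_dist_def)
qed

text \<open>Turns metric convexity into linear algebra. The open hemisphere keeps antipodes out of
  the cone, so \<open>arc_dist_imp_cone\<close> applies; conversely generators are added one at a
  time, each normalised sum lying on an arc between points already obtained.\<close>

lemma sphere_hull_eq_cone:
  fixes V :: "'a::euclidean_space set"
  assumes V: "finite V" "V \<subseteq> sphere 0 1" and h: "\<And>v. v \<in> V \<Longrightarrow> 0 < h \<bullet> v"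
  shows "sphere_convex hull V = sphere 0 1 \<inter> pc (\<lambda>x. x) V"
proof
  have hpos: "0 < h \<bullet> x" if x: "x \<in> pc (\<lambda>x. x) V" "x \<noteq> 0" for x
  proof -
    obtain c where c: "\<And>v. v \<in> V \<Longrightarrow> 0 \<le> c v" "x = (\<Sum>v\<in>V. c v *\<^sub>R v)"
      using pcE[OF x(1)] by metis
    have "\<exists>v\<in>V. c v \<noteq> 0"
    proof (rule ccontr)
      assume "\<not> (\<exists>v\<in>V. c v \<noteq> 0)"
      then have "x = 0" unfolding c(2) by (intro sum.neutral) simp
      then show False using x(2) by simp
    qed
    then obtain v where v: "v \<in> V" "0 < c v" using c(1) by (metis less_le)
    have "h \<bullet> x = (\<Sum>v\<in>V. c v * (h \<bullet> v))" by (simp add: c(2) inner_sum_right)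
    also have "0 < \<dots>"
      using V(1) v c(1) h by (intro sum_pos2[of V v]) (auto intro: mult_nonneg_nonneg less_imp_le)
    finally show ?thesis .
  qed
  have "sphere_convex (sphere 0 1 \<inter> pc (\<lambda>x. x) V)"
    unfolding sphere_convex_def
  proof (intro conjI ballI impI)
    fix x y z assume x: "x \<in> sphere 0 1 \<inter> pc (\<lambda>x. x) V" and y: "y \<in> sphere 0 1 \<inter> pc (\<lambda>x. x) V"
      and z: "z \<in> sphere 0 1" and e: "sphere_dist x z + sphere_dist z y = sphere_dist x y"
    have n: "norm x = 1" "norm y = 1" "norm z = 1" using x y z by auto
    have "0 < h \<bullet> x" "0 < h \<bullet> y" using hpos x y n by force+
    then have "y \<noteq> - x" by auto
    from arc_dist_imp_cone[OF n this e] obtain \<alpha> \<beta> where ab: "0 \<le> \<alpha>" "0 \<le> \<beta>" "z = \<alpha> *\<^sub>R x + \<beta> *\<^sub>R y"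
      by metis
    have "\<alpha> *\<^sub>R x + \<beta> *\<^sub>R y \<in> pc (\<lambda>x. x) V"
      using x y ab(1,2) by (intro pc_add pc_scale) auto
    then show "z \<in> sphere 0 1 \<inter> pc (\<lambda>x. x) V" using z ab(3) by simp
  qed auto
  moreover have "V \<subseteq> sphere 0 1 \<inter> pc (\<lambda>x. x) V"
    using V pc_gen[OF V(1), of _ "\<lambda>x. x"] by auto
  ultimately show "sphere_convex hull V \<subseteq> sphere 0 1 \<inter> pc (\<lambda>x. x) V"
    by (intro hull_minimal)
next
  have "(1 / norm x) *\<^sub>R x \<in> C"
    if C: "sphere_convex C" and W: "finite W" "W \<subseteq> C" and x: "x \<in> pc (\<lambda>x. x) W" "x \<noteq> 0" for C W x
    using W x
  proof (induction W arbitrary: x rule: finite_induct)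
    case empty
    then show ?case by (auto simp: pc_def)
  next
    case (insert v W)
    obtain c where c: "\<And>v'. v' \<in> insert v W \<Longrightarrow> 0 \<le> c v'" "x = (\<Sum>v\<in>insert v W. c v *\<^sub>R v)"
      using pcE[OF insert.prems(2)] by metis
    define y where "y = (\<Sum>v\<in>W. c v *\<^sub>R v)"
    have x: "x = c v *\<^sub>R v + y" using c(2) insert.hyps by (simp add: y_def)
    have y: "y \<in> pc (\<lambda>x. x) W" unfolding y_def by (rule pcI) (use c in auto)
    have CS: "C \<subseteq> sphere 0 1" using C by (simp add: sphere_convex_def)
    have v: "v \<in> C" "norm v = 1" using insert.prems(1) CS by auto
    show ?case
    proof (cases "y = 0")
      case True
      then have "c v \<noteq> 0" using x insert.prems(3) by auto
      then have "(1 / norm x) *\<^sub>R x = v" using True x v(2) c(1)[of v] by simp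
      then show ?thesis using v by simp
    next
      case False
      define u where "u = (1 / norm y) *\<^sub>R y"
      have u: "u \<in> C" unfolding u_def using insert.IH[OF _ y False] insert.prems(1) by simp
      then have nu: "norm u = 1" using CS by auto
      define z where "z = (1 / norm x) *\<^sub>R x"
      have nz: "norm z = 1" using insert.prems(3) by (simp add: z_def)
      have xe: "c v *\<^sub>R v + norm y *\<^sub>R u = x" using False x by (simp add: u_def)
      have "z = (1 / norm x) *\<^sub>R (c v *\<^sub>R v + norm y *\<^sub>R u)" unfolding z_def xe ..
      then have "z = (c v / norm x) *\<^sub>R v + (norm y / norm x) *\<^sub>R u"
        by (simp add: scaleR_add_right)
      then have "sphere_dist v z + sphere_dist z u = sphere_dist v u"
        by (intro cone_imp_arc_dist[OF v(2) nu nz, of "c v / norm x" "norm y / norm x"])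
          (use c(1)[of v] in auto)
      then have "z \<in> C"
        using C v(1) u nz unfolding sphere_convex_def by (metis mem_sphere_0)
      then show ?thesis by (simp add: z_def)
    qed
  qed
  then show "sphere 0 1 \<inter> pc (\<lambda>x. x) V \<subseteq> sphere_convex hull V"
    using V(1) by (force simp: hull_def)
qed

section \<open>Face posets of spherical polytopes and simplices\<close>

lemma poset_isomorphic_sym: "poset_isomorphic A B \<Longrightarrow> poset_isomorphic B A"
proof -
  assume "poset_isomorphic A B"
  then obtain f where f: "bij_betw f A B" "\<forall>x\<in>A. \<forall>y\<in>A. f x \<le> f y \<longleftrightarrow> x \<le> y"
    unfolding poset_isomorphic_def by blast
  let ?g = "inv_into A f"
  have "bij_betw ?g B A" using f(1) by (rule bij_betw_inv_into)
  moreover have "?g x \<le> ?g y \<longleftrightarrow> x \<le> y" if "x \<in> B" "y \<in> B" for x y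
    using f(2) that bij_betw_inv_into_right[OF f(1)] bij_betw_apply[OF \<open>bij_betw ?g B A\<close>] by metis
  ultimately show ?thesis unfolding poset_isomorphic_def by blast
qed

lemma poset_isomorphic_trans:
  "poset_isomorphic A B \<Longrightarrow> poset_isomorphic B C \<Longrightarrow> poset_isomorphic A C"
proof -
  assume "poset_isomorphic A B" "poset_isomorphic B C"
  then obtain f g where f: "bij_betw f A B" "\<forall>x\<in>A. \<forall>y\<in>A. f x \<le> f y \<longleftrightarrow> x \<le> y"
    and g: "bij_betw g B C" "\<forall>x\<in>B. \<forall>y\<in>B. g x \<le> g y \<longleftrightarrow> x \<le> y"
    unfolding poset_isomorphic_def by blast
  have "bij_betw (g \<circ> f) A C" using f(1) g(1) by (rule bij_betw_trans)
  moreover have "(g \<circ> f) x \<le> (g \<circ> f) y \<longleftrightarrow> x \<le> y" if "x \<in> A" "y \<in> A" for x y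
    using f g(2) that bij_betw_apply[OF f(1)] by simp
  ultimately show ?thesis unfolding poset_isomorphic_def by blast
qed

definition scone :: "'a::euclidean_space set \<Rightarrow> 'a set"
  where "scone W = sphere 0 1 \<inter> pc (\<lambda>x. x) W"

lemma scone_mono: "finite B \<Longrightarrow> A \<subseteq> B \<Longrightarrow> scone A \<subseteq> scone B"
  using pc_mono[of B A "\<lambda>x. x"] by (auto simp: scone_def)

lemma scone_gen: "finite W \<Longrightarrow> W \<subseteq> sphere 0 1 \<Longrightarrow> W \<subseteq> scone W"
  using pc_gen[of W _ "\<lambda>x. x"] by (auto simp: scone_def)

lemma scone_empty [simp]: "scone {} = {}"
  by (auto simp: scone_def pc_def)

lemma scone_singleton: "norm w = 1 \<Longrightarrow> scone {w} = {w}"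
proof -
  assume w: "norm w = 1"
  have "x = w" if "norm x = 1" "x = c *\<^sub>R w" "0 \<le> c" for x c
  proof -
    have "c = 1" using that w by simp
    then show ?thesis using that by simp
  qed
  then show ?thesis using w pc_gen[of "{w}" w "\<lambda>x. x"] by (auto simp: scone_def pc_def)
qed

text \<open>The supporting form is nonnegative on the generators, so where it vanishes on a
  combination, only generators in the face carry weight.\<close>

lemma spherical_face_generated:
  assumes W: "finite W" "W \<subseteq> sphere 0 1" and F: "F spherical_face_of scone W"
  shows "F = scone (W \<inter> F)"
proof -
  obtain a where a: "\<And>x. x \<in> scone W \<Longrightarrow> 0 \<le> a \<bullet> x" "F = scone W \<inter> {x. a \<bullet> x = 0}"
    using F unfolding spherical_face_of_def by blast
  have WS: "W \<subseteq> scone W" using scone_gen[OF W] .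
  have WF: "W \<inter> F = {w \<in> W. a \<bullet> w = 0}" using a(2) WS by auto
  show ?thesis
  proof (intro subset_antisym subsetI)
    fix x assume x: "x \<in> F"
    then have "x \<in> pc (\<lambda>x. x) W" "norm x = 1" "a \<bullet> x = 0" using a(2) by (auto simp: scone_def)
    then obtain c where c: "\<And>v. v \<in> W \<Longrightarrow> 0 \<le> c v" "x = (\<Sum>v\<in>W. c v *\<^sub>R v)"
      unfolding pc_def by blast
    have "(\<Sum>v\<in>W. c v * (a \<bullet> v)) = 0"
      using \<open>a \<bullet> x = 0\<close> by (simp add: c(2) inner_sum_right)
    moreover have nn: "0 \<le> c v * (a \<bullet> v)" if "v \<in> W" for v using c(1) a(1) WS that by auto
    ultimately have "\<forall>v\<in>W. c v * (a \<bullet> v) = 0" using sum_nonneg_eq_0_iff[OF W(1), of "\<lambda>v. c v * (a \<bullet> v)"] by blast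
    then have "x = (\<Sum>v\<in>W \<inter> F. c v *\<^sub>R v)"
      unfolding c(2) WF using W(1) by (intro sum.mono_neutral_right) auto
    also have "\<dots> \<in> pc (\<lambda>x. x) (W \<inter> F)" by (rule pcI) (use c in auto)
    finally show "x \<in> scone (W \<inter> F)" using \<open>norm x = 1\<close> by (simp add: scone_def)
  next
    fix x assume x: "x \<in> scone (W \<inter> F)"
    then obtain c where "x = (\<Sum>v\<in>W \<inter> F. c v *\<^sub>R v)" by (auto simp: scone_def pc_def)
    then have "a \<bullet> x = 0" unfolding WF by (simp add: inner_sum_right)
    moreover have "x \<in> scone W" using x scone_mono[OF W(1)] by blast
    ultimately show "x \<in> F" using a(2) by simp
  qed
qed

text \<open>The slice of the cone at height 1 over \<open>h\<close> is a Euclidean polytope; its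
  extreme points generate it by Krein-Milman and are exposed.\<close>

lemma spherical_polytope_vertices:
  fixes P :: "'a::euclidean_space set"
  assumes "spherical_polytope P"
  obtains W h where "finite W" "W \<subseteq> sphere 0 1" "P = scone W" "\<And>w. w \<in> W \<Longrightarrow> 0 < h \<bullet> w"
    "\<And>w. w \<in> W \<Longrightarrow> {w} spherical_face_of P"
proof -
  obtain V h where V: "finite V" "V \<subseteq> sphere 0 1" "\<And>v. v \<in> V \<Longrightarrow> 0 < h \<bullet> v" "P = sphere_convex hull V"
    using assms unfolding spherical_polytope_def by blast
  have P: "P = scone V" unfolding V(4) scone_def by (rule sphere_hull_eq_cone[OF V(1-3)])
  define e where "e v = (1 / (h \<bullet> v)) *\<^sub>R v" for v
  define Q where "Q = convex hull (e ` V)"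
  define W where "W = {v \<in> V. e v extreme_point_of Q}"
  have WV: "W \<subseteq> V" by (auto simp: W_def)
  have finW: "finite W" using WV V(1) finite_subset by blast
  have he: "v = (h \<bullet> v) *\<^sub>R e v" "h \<bullet> e v = 1" if "v \<in> V" for v
    using V(3)[OF that] by (auto simp: e_def)
  have inj: "v = w" if "v \<in> V" "w \<in> V" "e v = e w" for v w
  proof -
    have "norm ((h \<bullet> v) *\<^sub>R e w) = norm ((h \<bullet> w) *\<^sub>R e w)"
      using he(1)[OF that(1)] he(1)[OF that(2)] that(3) V(2) that(1,2) by (metis mem_sphere_0 subsetD)
    moreover have "e w \<noteq> 0" using he(2)[OF that(2)] by auto
    ultimately have "h \<bullet> v = h \<bullet> w" using V(3)[OF that(1)] V(3)[OF that(2)] by simp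
    then show ?thesis using he(1)[OF that(1)] he(1)[OF that(2)] that(3) by metis
  qed
  have ext: "{x. x extreme_point_of Q} = e ` W"
    using extreme_point_of_convex_hull[of _ "e ` V"] by (auto simp: W_def Q_def)
  have QE: "Q = convex hull (e ` W)"
    unfolding ext[symmetric] unfolding Q_def by (rule Krein_Milman_polytope) (use V(1) in simp)
  have gen: "V \<subseteq> pc (\<lambda>x. x) W"
  proof
    fix v assume v: "v \<in> V"
    have "e ` W \<subseteq> pc (\<lambda>x. x) W"
      using WV V(3) pc_gen[OF finW, of _ "\<lambda>x. x"] by (auto simp: e_def less_imp_le intro!: pc_scale)
    then have "Q \<subseteq> pc (\<lambda>x. x) W"
      unfolding QE by (intro hull_minimal pc_convex[OF finW])
    moreover have "e v \<in> Q" using v by (simp add: Q_def hull_inc)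
    ultimately have "(h \<bullet> v) *\<^sub>R e v \<in> pc (\<lambda>x. x) W" using V(3)[OF v] by (intro pc_scale) auto
    then show "v \<in> pc (\<lambda>x. x) W" using he(1)[OF v] by simp
  qed
  have "pc (\<lambda>x. x) V \<subseteq> pc (\<lambda>x. x) W"
    using gen convex_cone_convex_cone_hull[of "(\<lambda>x. x) ` W"]
    unfolding pc_eq_hull[OF V(1)] pc_eq_hull[OF finW] by (intro hull_minimal) auto
  moreover have "pc (\<lambda>x. x) W \<subseteq> pc (\<lambda>x. x) V" by (rule pc_mono[OF V(1) WV])
  ultimately have PW: "P = scone W" by (auto simp: P scone_def)
  have face: "{w} spherical_face_of P" if w: "w \<in> W" for w
  proof -
    have wV: "w \<in> V" using w WV by blast
    have "{e w} exposed_face_of Q"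
      using w polyhedron_convex_hull[of "e ` V"] V(1)
      by (simp add: exposed_face_of_polyhedron Q_def W_def face_of_singleton)
    then obtain a b where ab: "Q \<subseteq> {x. a \<bullet> x \<le> b}" "{e w} = Q \<inter> {x. a \<bullet> x = b}"
      unfolding exposed_face_of_def by blast
    \<comment> \<open>Homogenises the exposing affine form: on the slice
      \<open>h \<bullet> x = 1\<close> the linear form takes the value b - a \<bullet> x.\<close>
    define u where "u = b *\<^sub>R h - a"
    have uv: "u \<bullet> v = (h \<bullet> v) * (b - a \<bullet> e v)" if "v \<in> V" for v
    proof -
      have "u \<bullet> v = u \<bullet> ((h \<bullet> v) *\<^sub>R e v)" using he(1)[OF that] by simp
      also have "\<dots> = (h \<bullet> v) * (b * (h \<bullet> e v) - a \<bullet> e v)" by (simp add: u_def inner_diff_left)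
      finally show ?thesis using he(2)[OF that] by simp
    qed
    have eQ: "e v \<in> Q" if "v \<in> V" for v using that by (simp add: Q_def hull_inc)
    have nn: "0 \<le> u \<bullet> v" if "v \<in> V" for v
      using uv[OF that] V(3)[OF that] ab(1) eQ[OF that] by (auto simp: zero_le_mult_iff)
    have z: "u \<bullet> v = 0 \<longleftrightarrow> v = w" if "v \<in> V" for v
    proof -
      have "u \<bullet> v = 0 \<longleftrightarrow> a \<bullet> e v = b" using uv[OF that] V(3)[OF that] by auto
      also have "\<dots> \<longleftrightarrow> e v \<in> {e w}" unfolding ab(2) using eQ[OF that] by simp
      also have "\<dots> \<longleftrightarrow> v = w" using inj[OF that wV] by auto
      finally show ?thesis .
    qed
    define F where "F = P \<inter> {x. u \<bullet> x = 0}"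
    have "0 \<le> u \<bullet> x" if "x \<in> P" for x
    proof -
      obtain c where c: "\<And>v. v \<in> V \<Longrightarrow> 0 \<le> c v" "x = (\<Sum>v\<in>V. c v *\<^sub>R v)"
        using \<open>x \<in> P\<close> unfolding P scone_def pc_def by blast
      show ?thesis
        unfolding c(2) inner_sum_right using c(1) nn by (intro sum_nonneg) auto
    qed
    then have F: "F spherical_face_of scone V"
      unfolding P[symmetric] spherical_face_of_def F_def by blast
    have "V \<inter> F = {w}"
      using z wV scone_gen[OF V(1,2)] by (auto simp: F_def P)
    then have "F = scone {w}" using spherical_face_generated[OF V(1,2) F] by simp
    also have "\<dots> = {w}" using wV V(2) by (intro scone_singleton) auto
    finally show ?thesis using F P by simp
  qed
  show thesis
    by (rule that[OF finW _ PW _ face]) (use WV V in auto)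
qed

lemma simplex_face_poset:
  fixes D :: "'a::euclidean_space set"
  assumes "int d simplex D"
  obtains C :: "'a set" where "finite C" "card C = d + 1"
    "poset_isomorphic {I. I \<subseteq> C \<and> I \<noteq> {}} {F. F face_of D \<and> F \<noteq> {}}"
proof -
  obtain C where C: "\<not> affine_dependent C" "int (card C) = int d + 1" "D = convex hull C"
    using assms unfolding simplex_def by blast
  have sub: "convex hull I \<subseteq> convex hull J \<longleftrightarrow> I \<subseteq> J" if "I \<subseteq> C" "J \<subseteq> C" for I J
  proof
    assume hull: "convex hull I \<subseteq> convex hull J"
    show "I \<subseteq> J"
    proof
      fix x assume x: "x \<in> I"
      show "x \<in> J"
      proof (rule ccontr)
        assume "x \<notin> J"
        have "x \<in> convex hull J" using hull x hull_inc[of x I convex] by blast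
        also have "\<dots> \<subseteq> affine hull J" by (rule convex_hull_subset_affine_hull)
        also have "\<dots> \<subseteq> affine hull (C - {x})" using that \<open>x \<notin> J\<close> by (intro hull_mono) auto
        finally show False using C(1) x that(1) unfolding affine_dependent_def by blast
      qed
    qed
  qed (rule hull_mono)
  have faces: "F face_of D \<longleftrightarrow> (\<exists>I\<subseteq>C. F = convex hull I)" for F
    unfolding C(3) using face_of_convex_hull_affine_independent[OF C(1)] by auto
  have "bij_betw (\<lambda>I. convex hull I) {I. I \<subseteq> C \<and> I \<noteq> {}} {F. F face_of D \<and> F \<noteq> {}}"
    unfolding bij_betw_def
  proof
    show "inj_on (\<lambda>I. convex hull I) {I. I \<subseteq> C \<and> I \<noteq> {}}"
      using sub by (intro inj_onI) blast
    show "(\<lambda>I. convex hull I) ` {I. I \<subseteq> C \<and> I \<noteq> {}} = {F. F face_of D \<and> F \<noteq> {}}"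
      unfolding faces by (auto simp: image_iff)
  qed
  then have "poset_isomorphic {I. I \<subseteq> C \<and> I \<noteq> {}} {F. F face_of D \<and> F \<noteq> {}}"
    unfolding poset_isomorphic_def using sub by (intro exI[of _ "\<lambda>I. convex hull I"]) auto
  then show thesis
    using that[of C] C aff_independent_finite by auto
qed

text \<open>The definition prescribes only a combinatorial type. The isomorphism with the subsets of
  a (d + 1)-set gives the number of vertices and shows that every nonempty set of them spans a face;
  linear independence follows from the latter.\<close>

lemma spherical_simplex_vertices:
  fixes P :: "'a::euclidean_space set"
  assumes "spherical_simplex d P"
  obtains W where "finite W" "card W = d + 1" "W \<subseteq> sphere 0 1" "P = scone W"
    "\<And>c w. (\<Sum>w\<in>W. c w *\<^sub>R w) = 0 \<Longrightarrow> w \<in> W \<Longrightarrow> c w = 0"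
    "\<And>A. A \<subseteq> W \<Longrightarrow> A \<noteq> {} \<Longrightarrow> scone A spherical_face_of P"
proof -
  have "spherical_polytope P" using assms by (simp add: spherical_simplex_def)
  then obtain W h where W: "finite W" "W \<subseteq> sphere 0 1" "P = scone W" "\<And>w. w \<in> W \<Longrightarrow> 0 < h \<bullet> w"
    "\<And>w. w \<in> W \<Longrightarrow> {w} spherical_face_of P"
    by (rule spherical_polytope_vertices) (rule that)
  let ?Fs = "{F. F spherical_face_of P \<and> F \<noteq> {}}"
  obtain D :: "'a set" where D: "int d simplex D" "poset_isomorphic ?Fs {F. F face_of D \<and> F \<noteq> {}}"
    using assms by (auto simp: spherical_simplex_def)
  obtain C :: "'a set" where C: "finite C" "card C = d + 1"
    "poset_isomorphic {I. I \<subseteq> C \<and> I \<noteq> {}} {F. F face_of D \<and> F \<noteq> {}}"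
    by (rule simplex_face_poset[OF D(1)]) (rule that)
  obtain G where G: "bij_betw G {I. I \<subseteq> C \<and> I \<noteq> {}} ?Fs"
    and Gle: "\<And>I J. I \<subseteq> C \<Longrightarrow> I \<noteq> {} \<Longrightarrow> J \<subseteq> C \<Longrightarrow> J \<noteq> {} \<Longrightarrow> G I \<subseteq> G J \<longleftrightarrow> I \<subseteq> J"
    using poset_isomorphic_trans[OF C(3) poset_isomorphic_sym[OF D(2)]]
    unfolding poset_isomorphic_def by auto
  have GF: "G I spherical_face_of P" "G I \<noteq> {}" if "I \<subseteq> C" "I \<noteq> {}" for I
    using bij_betw_apply[OF G, of I] that by auto
  have gen: "F = scone (W \<inter> F)" if "F spherical_face_of P" for F
    using spherical_face_generated[OF W(1,2)] that W(3) by simp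
  \<comment> \<open>A nonempty face inside a singleton is that singleton, so a vertex of
    \<open>P\<close> corresponds to a vertex of the model simplex.\<close>
  have "\<exists>c\<in>C. G {c} = {w}" if w: "w \<in> W" for w
  proof -
    have "{w} \<in> ?Fs" using W(5)[OF w] by simp
    then obtain I where I: "I \<subseteq> C" "I \<noteq> {}" "G I = {w}"
      using G unfolding bij_betw_def by (metis (mono_tags, lifting) imageE mem_Collect_eq)
    then obtain c where c: "c \<in> I" by blast
    then have "G {c} \<subseteq> {w}" using Gle[of "{c}" I] I by auto
    then have "G {c} = {w}" using GF(2)[of "{c}"] c I(1) by blast
    then show ?thesis using c I(1) by blast
  qed
  then obtain \<nu> where \<nu>: "\<And>w. w \<in> W \<Longrightarrow> \<nu> w \<in> C \<and> G {\<nu> w} = {w}" by metis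
  have in_G: "w \<in> G I \<longleftrightarrow> \<nu> w \<in> I" if "w \<in> W" "I \<subseteq> C" "I \<noteq> {}" for w I
  proof -
    have "w \<in> G I \<longleftrightarrow> G {\<nu> w} \<subseteq> G I" using \<nu>[OF that(1)] by simp
    also have "\<dots> \<longleftrightarrow> {\<nu> w} \<subseteq> I" using Gle[of "{\<nu> w}" I] \<nu>[OF that(1)] that(2,3) by simp
    finally show ?thesis by simp
  qed
  have "inj_on \<nu> W" using \<nu> by (intro inj_onI) (metis singleton_inject)
  moreover have "\<nu> ` W = C"
  proof (intro subset_antisym subsetI)
    fix c assume c: "c \<in> C"
    have "W \<inter> G {c} \<noteq> {}" using gen[OF GF(1)[of "{c}"]] GF(2)[of "{c}"] c scone_empty by fastforce
    then obtain w where w: "w \<in> W" "w \<in> G {c}" by blast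
    then have "\<nu> w = c" using in_G[OF w(1), of "{c}"] c by simp
    then show "c \<in> \<nu> ` W" using w(1) by blast
  qed (use \<nu> in auto)
  ultimately have "card W = d + 1" using card_image[of \<nu> W] C(2) by simp
  have WG: "W \<inter> G (\<nu> ` A) = A" if "A \<subseteq> W" "A \<noteq> {}" for A
  proof -
    have "\<nu> ` A \<subseteq> C" "\<nu> ` A \<noteq> {}" using that \<nu> by auto
    then show ?thesis using in_G[of _ "\<nu> ` A"] that \<open>inj_on \<nu> W\<close> by (auto dest: inj_onD)
  qed
  have face: "scone A spherical_face_of P" if "A \<subseteq> W" "A \<noteq> {}" for A
  proof -
    have "\<nu> ` A \<subseteq> C" "\<nu> ` A \<noteq> {}" using that \<nu> by auto
    then show ?thesis using GF(1)[of "\<nu> ` A"] gen[of "G (\<nu> ` A)"] WG[OF that] by simp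
  qed
  \<comment> \<open>Radon's argument: the form supporting the face spanned by the vertices with
    positive coefficients must vanish on those with negative ones, which would put them into that
    face.\<close>
  have indep: "c w = 0" if c: "(\<Sum>w\<in>W. c w *\<^sub>R w) = 0" and w: "w \<in> W" for c w
  proof (rule ccontr)
    assume "c w \<noteq> 0"
    define A where "A = {w \<in> W. 0 < c w}"
    define B where "B = {w \<in> W. c w < 0}"
    have split: "(\<Sum>w\<in>W. c w * (u \<bullet> w)) = (\<Sum>w\<in>A. c w * (u \<bullet> w)) + (\<Sum>w\<in>B. c w * (u \<bullet> w))" for u
    proof -
      have "(\<Sum>w\<in>W. c w * (u \<bullet> w)) = (\<Sum>w\<in>A \<union> B. c w * (u \<bullet> w))"
        using W(1) by (intro sum.mono_neutral_right) (auto simp: A_def B_def)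
      also have "\<dots> = (\<Sum>w\<in>A. c w * (u \<bullet> w)) + (\<Sum>w\<in>B. c w * (u \<bullet> w))"
        using W(1) by (intro sum.union_disjoint) (auto simp: A_def B_def)
      finally show ?thesis .
    qed
    have zero: "(\<Sum>w\<in>A. c w * (u \<bullet> w)) + (\<Sum>w\<in>B. c w * (u \<bullet> w)) = 0" for u
    proof -
      have "(\<Sum>w\<in>W. c w * (u \<bullet> w)) = u \<bullet> (\<Sum>w\<in>W. c w *\<^sub>R w)" by (simp add: inner_sum_right)
      then show ?thesis using split[of u] c by simp
    qed
    have fin: "finite A" "finite B" using W(1) by (auto simp: A_def B_def)
    have pos: "0 < c w * (h \<bullet> w)" if "w \<in> A" for w using that W(4) by (auto simp: A_def)
    have neg: "c w * (h \<bullet> w) < 0" if "w \<in> B" for w using that W(4) by (auto simp: B_def mult_neg_pos)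
    have "A \<noteq> {}"
    proof
      assume "A = {}"
      then have "w \<in> B" using \<open>c w \<noteq> 0\<close> w by (auto simp: A_def B_def)
      then have "0 < (\<Sum>w\<in>B. - (c w * (h \<bullet> w)))"
        using neg fin by (intro sum_pos) auto
      then show False using zero[of h] \<open>A = {}\<close> by (simp add: sum_negf)
    qed
    have "B \<noteq> {}"
    proof
      assume "B = {}"
      then have "w \<in> A" using \<open>c w \<noteq> 0\<close> w by (auto simp: A_def B_def)
      then have "0 < (\<Sum>w\<in>A. c w * (h \<bullet> w))" using pos fin by (intro sum_pos) auto
      then show False using zero[of h] \<open>B = {}\<close> by simp
    qed
    have AW: "A \<subseteq> W" "B \<subseteq> W" by (auto simp: A_def B_def)
    obtain u where u: "\<And>x. x \<in> P \<Longrightarrow> 0 \<le> u \<bullet> x" "scone A = P \<inter> {x. u \<bullet> x = 0}"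
      using face[OF AW(1) \<open>A \<noteq> {}\<close>] unfolding spherical_face_of_def by blast
    have "u \<bullet> w = 0" if "w \<in> A" for w
      using scone_gen[of A] fin AW W(2) u(2) that by auto
    then have "(\<Sum>w\<in>B. c w * (u \<bullet> w)) = 0" using zero[of u] by simp
    moreover have "0 \<le> - (c w * (u \<bullet> w))" if "w \<in> B" for w
    proof -
      have "w \<in> P" using scone_gen[OF W(1,2)] AW that W(3) by blast
      then show ?thesis using u(1)[of w] that by (auto simp: B_def mult_nonpos_nonneg)
    qed
    ultimately have "\<forall>w\<in>B. - (c w * (u \<bullet> w)) = 0"
      using sum_nonneg_eq_0_iff[OF fin(2), of "\<lambda>w. - (c w * (u \<bullet> w))"] by (simp add: sum_negf)
    moreover obtain b where b: "b \<in> B" using \<open>B \<noteq> {}\<close> by blast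
    ultimately have "u \<bullet> b = 0" by (auto simp: B_def)
    moreover have "b \<in> P" using scone_gen[OF W(1,2)] AW b W(3) by blast
    ultimately have "b \<in> scone A" using u(2) by blast
    moreover have "\<nu> ` A \<subseteq> C" "\<nu> ` A \<noteq> {}" using \<nu> AW \<open>A \<noteq> {}\<close> by auto
    then have "G (\<nu> ` A) = scone A"
      using gen[OF GF(1)[of "\<nu> ` A"]] WG[OF AW(1) \<open>A \<noteq> {}\<close>] by simp
    ultimately have "b \<in> W \<inter> G (\<nu> ` A)" using b AW by auto
    then have "b \<in> A" using WG[OF AW(1) \<open>A \<noteq> {}\<close>] by simp
    then show False using b by (auto simp: A_def B_def)
  qed
  show thesis
    by (rule that[of W]) (fact W(1) \<open>card W = d + 1\<close> W(2,3) | rule indep face, assumption+)+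
qed

section \<open>From triangulations to fans\<close>

definition face_sets :: "'v set set \<Rightarrow> 'v set set"
  where "face_sets \<Phi> = {A. A \<noteq> {} \<and> (\<exists>F\<in>\<Phi>. A \<subseteq> F)}"

text \<open>The tiles are coned from the origin; the vertices are points of the sphere and serve as
  their own rays.\<close>

lemma triangulation_fan:
  fixes T :: "'a::euclidean_space set set"
  assumes T: "geometric_triangulation d T" and dim: "DIM('a) = d + 1"
  obtains \<Phi> where "fan (d + 1) (UNIV :: 'a set) \<Phi> (\<lambda>x. x)" "card \<Phi> = card (complex_facets T)"
    "poset_isomorphic (complex_faces T) (face_sets \<Phi>)"
proof -
  let ?r = "\<lambda>x :: 'a. x"
  have fin: "finite T" and cov: "\<Union>T = sphere 0 1"
    and simp: "\<And>P. P \<in> T \<Longrightarrow> spherical_simplex d P"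
    and Int: "\<And>P Q. P \<in> T \<Longrightarrow> Q \<in> T \<Longrightarrow> (P \<inter> Q) spherical_face_of P \<and> (P \<inter> Q) spherical_face_of Q"
    using T by (auto simp: geometric_triangulation_def)
  define good where "good P W \<longleftrightarrow> finite W \<and> card W = d + 1 \<and> W \<subseteq> sphere 0 1 \<and> P = scone W \<and>
      (\<forall>c. (\<Sum>w\<in>W. c w *\<^sub>R w) = 0 \<longrightarrow> (\<forall>w\<in>W. c w = 0)) \<and>
      (\<forall>A\<subseteq>W. A \<noteq> {} \<longrightarrow> scone A spherical_face_of P)" for P W :: "'a set"
  have "\<exists>W. good P W" if P: "P \<in> T" for P
  proof -
    obtain W where "finite W" "card W = d + 1" "W \<subseteq> sphere 0 1" "P = scone W"
      "\<And>c w. (\<Sum>w\<in>W. c w *\<^sub>R w) = 0 \<Longrightarrow> w \<in> W \<Longrightarrow> c w = 0"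
      "\<And>A. A \<subseteq> W \<Longrightarrow> A \<noteq> {} \<Longrightarrow> scone A spherical_face_of P"
      by (rule spherical_simplex_vertices[OF simp[OF P]]) (rule that)
    then have "good P W" unfolding good_def by (intro conjI) simp_all
    then show ?thesis by (rule exI)
  qed
  then have "\<forall>P\<in>T. \<exists>W. good P W" by blast
  then obtain W where W: "\<forall>P\<in>T. good P (W P)" by (rule bchoice[THEN exE])
  have Wf: "finite (W P)" and Wc: "card (W P) = d + 1" and Ws: "W P \<subseteq> sphere 0 1" and WP: "scone (W P) = P"
    and Wface: "\<And>A. A \<subseteq> W P \<Longrightarrow> A \<noteq> {} \<Longrightarrow> scone A spherical_face_of P" if "P \<in> T" for P
    using bspec[OF W that] by (simp_all add: good_def)
  have Wsub: "W P \<subseteq> P" if "P \<in> T" for P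
    using scone_gen[OF Wf[OF that] Ws[OF that]] WP[OF that] by simp
  have gen: "F = scone (W P \<inter> F)" if "P \<in> T" "F spherical_face_of P" for P F
    using spherical_face_generated[OF Wf[OF that(1)] Ws[OF that(1)]] WP[OF that(1)] that(2) by simp
  define \<Phi> where "\<Phi> = W ` T"
  \<comment> \<open>Ensures that tiles share vertices, not just points. The common point is a
    nonnegative combination of vertices of \<open>Q\<close> in \<open>P\<close>, and the form
    exposing it in \<open>P\<close> vanishes on those with weight, so one of them equals it.\<close>
  have WI: "W P \<inter> (P \<inter> Q) \<subseteq> W Q" if PQ: "P \<in> T" "Q \<in> T" for P Q
  proof
    fix w assume w: "w \<in> W P \<inter> (P \<inter> Q)"
    have nw: "norm w = 1" using w Ws[OF PQ(1)] by auto
    have "{w} spherical_face_of P"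
      using Wface[OF PQ(1), of "{w}"] w scone_singleton[OF nw] by simp
    then obtain u where u: "\<And>x. x \<in> P \<Longrightarrow> 0 \<le> u \<bullet> x" "{w} = P \<inter> {x. u \<bullet> x = 0}"
      unfolding spherical_face_of_def by blast
    have "w \<in> scone (W Q \<inter> (P \<inter> Q))" using gen[OF PQ(2)] Int[OF PQ] w by blast
    then obtain b where b: "\<And>v. v \<in> W Q \<inter> (P \<inter> Q) \<Longrightarrow> 0 \<le> b v" "w = (\<Sum>v\<in>W Q \<inter> (P \<inter> Q). b v *\<^sub>R v)"
      unfolding scone_def pc_def by blast
    have "\<exists>v\<in>W Q \<inter> (P \<inter> Q). b v \<noteq> 0"
    proof (rule ccontr)
      assume "\<not> ?thesis"
      then have "w = 0" unfolding b(2) by (intro sum.neutral) simp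
      then show False using nw by simp
    qed
    then obtain v where v: "v \<in> W Q \<inter> (P \<inter> Q)" "b v \<noteq> 0" by blast
    have "(\<Sum>v\<in>W Q \<inter> (P \<inter> Q). b v * (u \<bullet> v)) = u \<bullet> w"
      by (subst b(2)) (simp add: inner_sum_right)
    also have "\<dots> = 0" using u(2) by blast
    finally have "\<forall>v\<in>W Q \<inter> (P \<inter> Q). b v * (u \<bullet> v) = 0"
      using sum_nonneg_eq_0_iff[of "W Q \<inter> (P \<inter> Q)" "\<lambda>v. b v * (u \<bullet> v)"] Wf[OF PQ(2)] b(1) u(1) by simp
    then have "b v * (u \<bullet> v) = 0" using v(1) by (rule bspec)
    then have "u \<bullet> v = 0" using v(2) by simp
    then have "v = w" using u(2) v(1) by blast
    then show "w \<in> W Q" using v(1) by simp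
  qed
  have fan: "fan (d + 1) (UNIV :: 'a set) \<Phi> ?r"
    unfolding fan_def
  proof (intro conjI ballI allI impI)
    show "dim (UNIV :: 'a set) = d + 1" using dim by (simp add: dim_UNIV)
    show "finite \<Phi>" using fin by (simp add: \<Phi>_def)
    show "(UNIV :: 'a set) \<subseteq> (\<Union>F\<in>\<Phi>. pc ?r F)"
    proof
      fix y :: 'a
      obtain x :: 'a where x: "norm x = 1" "y = norm y *\<^sub>R x"
      proof (cases "y = 0")
        case True
        then show thesis using that[of "SOME b. b \<in> Basis"] by (simp add: SOME_Basis)
      next
        case False
        then show thesis using that[of "(1 / norm y) *\<^sub>R y"] by simp
      qed
      have "x \<in> \<Union>T" unfolding cov using x(1) by simp
      then obtain P where P: "P \<in> T" "x \<in> P" by blast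
      then have "x \<in> pc ?r (W P)" using WP[OF P(1)] by (auto simp: scone_def)
      then have "norm y *\<^sub>R x \<in> pc ?r (W P)" by (rule pc_scale) simp
      then show "y \<in> (\<Union>F\<in>\<Phi>. pc ?r F)" using P(1) x(2) by (auto simp: \<Phi>_def)
    qed
    fix F assume "F \<in> \<Phi>"
    then obtain P where P: "P \<in> T" "F = W P" by (auto simp: \<Phi>_def)
    show "finite F" "card F = d + 1" using Wf Wc P by auto
    show "c v = 0" if "(\<Sum>v\<in>F. c v *\<^sub>R v) = 0" "v \<in> F" for c v
      using bspec[OF W P(1)] that P(2) by (simp add: good_def)
    fix G assume "G \<in> \<Phi>"
    then obtain Q where Q: "Q \<in> T" "G = W Q" by (auto simp: \<Phi>_def)
    show "pc ?r F \<inter> pc ?r G \<subseteq> pc ?r (F \<inter> G)"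
    proof
      fix x assume x: "x \<in> pc ?r F \<inter> pc ?r G"
      show "x \<in> pc ?r (F \<inter> G)"
      proof (cases "x = 0")
        case False
        define y where "y = (1 / norm x) *\<^sub>R x"
        have "y \<in> pc ?r F" "y \<in> pc ?r G" using x by (auto simp: y_def intro!: pc_scale)
        moreover have "norm y = 1" using False by (simp add: y_def)
        ultimately have "y \<in> scone (W P)" "y \<in> scone (W Q)" using P Q by (auto simp: scone_def)
        then have "y \<in> P \<inter> Q" using WP P(1) Q(1) by simp
        then have "y \<in> scone (W P \<inter> (P \<inter> Q))" using gen[OF P(1)] Int[OF P(1) Q(1)] by blast
        also have "\<dots> \<subseteq> scone (F \<inter> G)"
          using WI[OF P(1) Q(1)] Wf[OF P(1)] P(2) Q(2) by (intro scone_mono) auto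
        finally have "norm x *\<^sub>R y \<in> pc ?r (F \<inter> G)" by (intro pc_scale) (auto simp: scone_def)
        then show ?thesis using False by (simp add: y_def)
      qed (simp add: pc_0)
    qed
  qed auto
  have sconele: "scone A \<subseteq> scone B \<longleftrightarrow> A \<subseteq> B" if AB: "A \<in> face_sets \<Phi>" "B \<in> face_sets \<Phi>" for A B
  proof
    obtain F G where F: "F \<in> \<Phi>" "A \<subseteq> F" and G: "G \<in> \<Phi>" "B \<subseteq> G" using AB by (auto simp: face_sets_def)
    have finF: "finite F" "finite G" "F \<subseteq> sphere 0 1" using F(1) G(1) Wf Ws by (auto simp: \<Phi>_def)
    {
      assume "A \<subseteq> B"
      then show "scone A \<subseteq> scone B" using G finF finite_subset by (intro scone_mono) blast+
    next
      assume sub: "scone A \<subseteq> scone B"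
      show "A \<subseteq> B"
      proof
        fix w assume w: "w \<in> A"
        have "A \<subseteq> scone A" using F finF finite_subset by (intro scone_gen) blast+
        then have "(\<Sum>v\<in>{w}. 1 *\<^sub>R v) \<in> pc ?r B" using sub w by (auto simp: scone_def)
        then show "w \<in> B"
          using fan_support[OF fan F(1) _ G, of "{w}" "\<lambda>_. 1" w] w F(2) by auto
      qed
    }
  qed
  have img: "scone ` face_sets \<Phi> = complex_faces T"
  proof (intro subset_antisym subsetI)
    fix F assume "F \<in> scone ` face_sets \<Phi>"
    then obtain A P where A: "A \<noteq> {}" "P \<in> T" "A \<subseteq> W P" "F = scone A"
      by (auto simp: face_sets_def \<Phi>_def)
    have "A \<subseteq> scone A" using A Wf Ws finite_subset by (intro scone_gen) blast+
    then show "F \<in> complex_faces T"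
      using A Wface[OF A(2,3,1)] by (auto simp: complex_faces_def)
  next
    fix F assume "F \<in> complex_faces T"
    then obtain P where P: "P \<in> T" "F spherical_face_of P" "F \<noteq> {}" by (auto simp: complex_faces_def)
    have e: "F = scone (W P \<inter> F)" by (rule gen[OF P(1,2)])
    then have "W P \<inter> F \<noteq> {}" using P(3) scone_empty by metis
    then have "W P \<inter> F \<in> face_sets \<Phi>" using P(1) by (auto simp: face_sets_def \<Phi>_def)
    then show "F \<in> scone ` face_sets \<Phi>" using e by blast
  qed
  have "bij_betw scone (face_sets \<Phi>) (complex_faces T)"
    unfolding bij_betw_def
    by (intro conjI inj_onI img subset_antisym) (simp_all flip: sconele)
  then have "poset_isomorphic (face_sets \<Phi>) (complex_faces T)"
    unfolding poset_isomorphic_def using sconele by blast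
  then have iso: "poset_isomorphic (complex_faces T) (face_sets \<Phi>)" by (rule poset_isomorphic_sym)
  have tile: "P \<in> complex_faces T" if P: "P \<in> T" for P
  proof -
    have "W P \<noteq> {}" using Wc[OF P] by auto
    then have "W P \<in> face_sets \<Phi>" using P by (auto simp: face_sets_def \<Phi>_def)
    then show ?thesis using img WP[OF P] by force
  qed
  have below: "\<exists>P\<in>T. F \<subseteq> P" if "F \<in> complex_faces T" for F
    using that by (auto simp: complex_faces_def spherical_face_of_def)
  \<comment> \<open>Containment of tiles forces containment of vertex sets of equal size.\<close>
  have max: "P = Q" if PQ: "P \<in> T" "Q \<in> T" "P \<subseteq> Q" for P Q
  proof -
    have "W P \<subseteq> W Q" using WI[OF PQ(1,2)] Wsub[OF PQ(1)] PQ(3) by blast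
    then have "W P = W Q" using card_subset_eq[OF Wf[OF PQ(2)]] Wc PQ by simp
    then show ?thesis using WP PQ(1,2) by metis
  qed
  have "complex_facets T = T"
  proof (intro subset_antisym subsetI)
    fix F assume F: "F \<in> complex_facets T"
    then obtain P where "P \<in> T" "F \<subseteq> P" using below unfolding complex_facets_def by blast
    then show "F \<in> T" using F tile by (auto simp: complex_facets_def)
  next
    fix P assume P: "P \<in> T"
    have "P = G" if G: "G \<in> complex_faces T" "P \<subseteq> G" for G
    proof -
      obtain Q where "Q \<in> T" "G \<subseteq> Q" using below[OF G(1)] by blast
      then show ?thesis using max[OF P, of Q] G(2) by blast
    qed
    then show "P \<in> complex_facets T" using tile[OF P] by (auto simp: complex_facets_def)
  qed
  moreover have "inj_on W T" using WP by (intro inj_onI) metis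
  ultimately have "card \<Phi> = card (complex_facets T)" by (simp add: \<Phi>_def card_image)
  then show thesis using that fan iso by blast
qed

lemma face_sets_isomorphic:
  fixes \<Phi> :: "'v set set" and \<Psi> :: "'w set set"
  assumes f: "bij_betw f (\<Union>\<Phi>) (\<Union>\<Psi>)" "\<Psi> = (`) f ` \<Phi>"
  shows "poset_isomorphic (face_sets \<Phi>) (face_sets \<Psi>)"
proof -
  have inj: "inj_on f (\<Union>\<Phi>)" using f(1) by (simp add: bij_betw_def)
  have sub: "A \<subseteq> \<Union>\<Phi>" if "A \<in> face_sets \<Phi>" for A using that by (auto simp: face_sets_def)
  have le: "f ` A \<subseteq> f ` B \<longleftrightarrow> A \<subseteq> B" if "A \<in> face_sets \<Phi>" "B \<in> face_sets \<Phi>" for A B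
    using inj_on_image_subset_iff[OF inj sub[OF that(1)] sub[OF that(2)]] .
  have "(`) f ` face_sets \<Phi> = face_sets \<Psi>"
  proof (intro subset_antisym subsetI)
    fix B assume "B \<in> face_sets \<Psi>"
    then obtain F where F: "F \<in> \<Phi>" "B \<noteq> {}" "B \<subseteq> f ` F" using f(2) by (auto simp: face_sets_def)
    then obtain A where "A \<subseteq> F" "B = f ` A" by (auto simp: subset_image_iff)
    then show "B \<in> (`) f ` face_sets \<Phi>" using F by (auto simp: face_sets_def)
  next
    fix B assume "B \<in> (`) f ` face_sets \<Phi>"
    then obtain A F where "A \<noteq> {}" "F \<in> \<Phi>" "A \<subseteq> F" "B = f ` A" by (auto simp: face_sets_def)
    then have "B \<noteq> {}" "B \<subseteq> f ` F" "f ` F \<in> \<Psi>" using f(2) by auto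
    then show "B \<in> face_sets \<Psi>" unfolding face_sets_def by blast
  qed
  then have "bij_betw ((`) f) (face_sets \<Phi>) (face_sets \<Psi>)"
    unfolding bij_betw_def by (intro conjI inj_onI subset_antisym) (simp_all flip: le)
  then show ?thesis unfolding poset_isomorphic_def using le by blast
qed

section \<open>Counting combinatorial types\<close>

text \<open>Existential in the fan and in the root, so that two triangulations sharing a code can be
  compared whatever choices produced it.\<close>

definition code_of :: "nat \<Rightarrow> 'a::euclidean_space set set \<Rightarrow> rose \<Rightarrow> bool"
  where "code_of d T t \<longleftrightarrow> (\<exists>\<Phi> \<kappa>. fan (d + 1) (UNIV :: 'a set) \<Phi> (\<lambda>x. x) \<and>
    poset_isomorphic (complex_faces T) (face_sets \<Phi>) \<and> ordered_facet \<Phi> \<kappa> \<and> coded (d + 1) \<Phi> \<kappa> t)"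

lemma code_of_exists:
  fixes T :: "'a::euclidean_space set set"
  assumes "DIM('a) = d + 1" "1 \<le> d" "T \<in> triangulations d N"
  shows "\<exists>t. code_of d T t \<and> rsize t \<le> code_bound (d + 1) * N"
proof -
  have T: "geometric_triangulation d T" "card (complex_facets T) = N"
    using assms(3) by (auto simp: triangulations_def)
  obtain \<Phi> where \<Phi>: "fan (d + 1) (UNIV :: 'a set) \<Phi> (\<lambda>x. x)" "card \<Phi> = card (complex_facets T)"
    "poset_isomorphic (complex_faces T) (face_sets \<Phi>)"
    by (rule triangulation_fan[OF T(1) assms(1)]) (rule that)
  obtain F where F: "F \<in> \<Phi>" using fan_nonempty[OF \<Phi>(1)] by blast
  then obtain \<kappa> where "distinct \<kappa>" "set \<kappa> = F"
    using fan_facet[OF \<Phi>(1)] finite_distinct_list by metis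
  then have \<kappa>: "ordered_facet \<Phi> \<kappa>" using F by (simp add: ordered_facet_def)
  obtain t where "coded (d + 1) \<Phi> \<kappa> t" "rsize t \<le> code_bound (d + 1) * card \<Phi>"
    using coded_exists[OF _ \<Phi>(1) \<kappa>] assms(2) by auto
  then show ?thesis using \<Phi> \<kappa> T(2) unfolding code_of_def by auto
qed

lemma code_of_isomorphic:
  fixes S T :: "'a::euclidean_space set set"
  assumes "code_of d S t" "code_of d T t"
  shows "poset_isomorphic (complex_faces S) (complex_faces T)"
proof -
  obtain \<Phi> \<kappa> where \<Phi>: "fan (d + 1) (UNIV :: 'a set) \<Phi> (\<lambda>x. x)" "ordered_facet \<Phi> \<kappa>" "coded (d + 1) \<Phi> \<kappa> t"
    and iS: "poset_isomorphic (complex_faces S) (face_sets \<Phi>)"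
    using assms(1) unfolding code_of_def by blast
  obtain \<Psi> \<mu> where \<Psi>: "fan (d + 1) (UNIV :: 'a set) \<Psi> (\<lambda>x. x)" "ordered_facet \<Psi> \<mu>" "coded (d + 1) \<Psi> \<mu> t"
    and iT: "poset_isomorphic (complex_faces T) (face_sets \<Psi>)"
    using assms(2) unfolding code_of_def by blast
  obtain f where "bij_betw f (\<Union>\<Phi>) (\<Union>\<Psi>)" "\<Psi> = (`) f ` \<Phi>"
    by (rule coded_iso[OF fan_npm[OF \<Phi>(1)] fan_npm[OF \<Psi>(1)] \<Phi>(2) \<Psi>(2) \<Phi>(3) \<Psi>(3)]) (rule that)
  then have "poset_isomorphic (face_sets \<Phi>) (face_sets \<Psi>)" by (rule face_sets_isomorphic)
  then show ?thesis
    using iS iT poset_isomorphic_trans poset_isomorphic_sym by blast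
qed

theorem theorem2:
  fixes d N :: nat
  assumes "DIM('a::euclidean_space) = d + 1"
    and "d \<ge> 1"
    and "N \<ge> 1"
  shows "finite (combinatorial_types d N :: 'a set set set set) \<and>
    card (combinatorial_types d N :: 'a set set set set)
      \<le> 2 ^ (d\<^sup>2 * (fact (d + 1))\<^sup>2 * N)"
proof -
  let ?X = "triangulations d N :: 'a set set set"
  let ?r = "same_combinatorial_type d N :: 'a set set rel"
  let ?n = "code_bound (d + 1) * N"
  define c :: "'a set set \<Rightarrow> rose" where "c T = (SOME t. code_of d T t \<and> rsize t \<le> ?n)" for T
  have c: "code_of d T (c T) \<and> rsize (c T) \<le> ?n" if "T \<in> ?X" for T
    unfolding c_def by (rule someI_ex[OF code_of_exists[OF assms(1,2) that]])
  have rel: "(S, T) \<in> ?r" if "S \<in> ?X" "T \<in> ?X" "c S = c T" for S T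
    using code_of_isomorphic[of d S "c S" T] c[OF that(1)] c[OF that(2)] that
    by (simp add: same_combinatorial_type_def)
  have cls: "?r `` {S} = ?r `` {T}" if "(S, T) \<in> ?r" for S T
    using that poset_isomorphic_sym poset_isomorphic_trans
    unfolding same_combinatorial_type_def by blast
  have "\<forall>K\<in>combinatorial_types d N. \<exists>T. T \<in> ?X \<and> K = ?r `` {T}"
    unfolding combinatorial_types_def quotient_def by blast
  then obtain q where q: "\<forall>K\<in>combinatorial_types d N. q K \<in> ?X \<and> K = ?r `` {q K}"
    by (rule bchoice[THEN exE])
  \<comment> \<open>A class is determined by the code of a representative.\<close>
  have inj: "inj_on (c \<circ> q) (combinatorial_types d N)"
  proof (rule inj_onI)
    fix K K' :: "'a set set set"
    assume K: "K \<in> combinatorial_types d N" "K' \<in> combinatorial_types d N" "(c \<circ> q) K = (c \<circ> q) K'"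
    have "(q K, q K') \<in> ?r" using rel[of "q K" "q K'"] K(3) bspec[OF q K(1)] bspec[OF q K(2)] by simp
    then have "?r `` {q K} = ?r `` {q K'}" by (rule cls)
    then show "K = K'" using bspec[OF q K(1)] bspec[OF q K(2)] by simp
  qed
  have img: "(c \<circ> q) ` combinatorial_types d N \<subseteq> {t. rsize t \<le> ?n}"
    using c q by (simp add: image_subset_iff)
  note R = card_rose_le[of ?n]
  have "finite (combinatorial_types d N :: 'a set set set set)"
    by (rule inj_on_finite[OF inj img conjunct1[OF R]])
  moreover have "card (combinatorial_types d N :: 'a set set set set) \<le> card {t. rsize t \<le> ?n}"
    by (rule card_inj_on_le[OF inj img conjunct1[OF R]])
  \<comment> \<open>Doubling cancels the division in \<open>code_bound\<close>, so the estimate ends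
    exactly at the stated exponent.\<close>
  moreover have "(4::nat) ^ ?n = 2 ^ (d\<^sup>2 * (fact (d + 1))\<^sup>2 * N)"
  proof -
    have "2 * code_bound (d + 1) = d\<^sup>2 * (fact (d + 1))\<^sup>2"
      using two_code_bound[of "d + 1"] assms(2) by simp
    then have "2 * ?n = d\<^sup>2 * (fact (d + 1))\<^sup>2 * N" by (metis mult.assoc)
    moreover have "(4::nat) ^ ?n = 2 ^ (2 * ?n)" by (simp add: power_mult)
    ultimately show ?thesis by metis
  qed
  ultimately show ?thesis using R by linarith
qed

end
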